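(* Let $k\ge 2$ and $\ell \ge 1$ be constant integers. Assuming SETH, distinguishing between $(2k+2)$-radius $\leq 5\ell$ and $(2k+2)$-radius $\geq 9\ell$ cannot be done in $O(m^{k-\delta})$ time on undirected unweighted graphs with $m$ edges, for any constant $\delta>0$. As a corollary, for any constants $\varepsilon\in (0,1)$ and $\beta\ge 0$, computing a $(\frac{9}{5}-\varepsilon,\beta)$-approximation of the $k$-radius requires $m^{\lfloor k/2\rfloor -1-o(1)}$ time under SETH.
   Context: All graphs are undirected and unweighted, with $n$ vertices and $m\ge n-1$ edges; $d(u,v)$ is the shortest-path distance. For a positive integer $k$, the $k$-radius of $G=(V,E)$ is $R_k(G)=\min_{C\subseteq V,|C|=k}\max_{v\in V} d(v,C)$, where $d(v,C)=\min_{c\in C}d(v,c)$. "Distinguishing between $k$-radius $\le a$ and $\ge b$" means: given a graph promised to satisfy either $R_k(G)\le a$ or $R_k(G)\ge b$, decide which. An $(\alpha,\beta)$-approximation of the $k$-radius is a value $\tilde R$ with $R_k(G)\le \tilde R\le \alpha R_k(G)+\beta$. SETH: for every $\varepsilon>0$ there is an integer $q\ge 3$ such that $q$-SAT on $N$ variables cannot be solved in $O((2-\varepsilon)^N)$ time. Model: word-RAM with $O(\log n)$-bit words. *)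

theory Defs
  imports Complex_Main "HOL-Library.Extended_Real"
begin

section \<open>Word-RAM\<close>

text \<open>
  Machine words are naturals below $2^w$, where $w$ is the word length.  A program uses finitely many
  registers (those it mentions) and a word-addressed memory; every instruction costs one time unit.
\<close>

datatype alu_op = OpAdd | OpSub | OpMul | OpDiv | OpMod | OpAnd | OpOr | OpXor | OpShl | OpShr | OpLess

fun alu :: "nat \<Rightarrow> alu_op \<Rightarrow> nat \<Rightarrow> nat \<Rightarrow> nat" where
  "alu w OpAdd x y = (x + y) mod 2 ^ w"
| "alu w OpSub x y = (x + 2 ^ w - y) mod 2 ^ w"
| "alu w OpMul x y = (x * y) mod 2 ^ w"
| "alu w OpDiv x y = x div y"
| "alu w OpMod x y = x mod y"
| "alu w OpAnd x y = and x y"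
| "alu w OpOr x y = or x y"
| "alu w OpXor x y = xor x y"
| "alu w OpShl x y = (x * 2 ^ y) mod 2 ^ w"
| "alu w OpShr x y = x div 2 ^ y"
| "alu w OpLess x y = (if x < y then 1 else 0)"

datatype instr =
    Const nat nat            \<comment> \<open>target register, constant\<close>
  | Alu alu_op nat nat nat   \<comment> \<open>operation, target register, operand registers\<close>
  | Load nat nat             \<comment> \<open>target register, register holding the address\<close>
  | Store nat nat            \<comment> \<open>register holding the address, source register\<close>
  | JumpIfZero nat nat       \<comment> \<open>tested register, jump target\<close>
  | Halt

record config =
  pc :: nat
  regs :: "nat \<Rightarrow> nat"
  mem :: "nat \<Rightarrow> nat"

fun exec_instr :: "nat \<Rightarrow> instr \<Rightarrow> config \<Rightarrow> config" where
  "exec_instr w (Const d x) s =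
     s\<lparr>pc := pc s + 1, regs := (regs s)(d := x mod 2 ^ w)\<rparr>"
| "exec_instr w (Alu f d a b) s =
     s\<lparr>pc := pc s + 1, regs := (regs s)(d := alu w f (regs s a) (regs s b))\<rparr>"
| "exec_instr w (Load d a) s =
     s\<lparr>pc := pc s + 1, regs := (regs s)(d := mem s (regs s a))\<rparr>"
| "exec_instr w (Store a b) s =
     s\<lparr>pc := pc s + 1, mem := (mem s)(regs s a := regs s b)\<rparr>"
| "exec_instr w (JumpIfZero a l) s =
     s\<lparr>pc := (if regs s a = 0 then l else pc s + 1)\<rparr>"
| "exec_instr w Halt s = s"

definition halted :: "instr list \<Rightarrow> config \<Rightarrow> bool" where
  "halted P s \<longleftrightarrow> length P \<le> pc s \<or> P ! pc s = Halt"

definition step :: "nat \<Rightarrow> instr list \<Rightarrow> config \<Rightarrow> config" where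
  "step w P s = (if halted P s then s else exec_instr w (P ! pc s) s)"

definition init_config :: "nat list \<Rightarrow> config" where
  "init_config xs =
     \<lparr>pc = 0, regs = (\<lambda>_. 0), mem = (\<lambda>i. if i < length xs then xs ! i else 0)\<rparr>"

text \<open>
  The input must fit into the addressable memory.  The result is read off the registers after halting.
\<close>

definition runs_within ::
  "nat \<Rightarrow> instr list \<Rightarrow> nat list \<Rightarrow> real \<Rightarrow> ((nat \<Rightarrow> nat) \<Rightarrow> bool) \<Rightarrow> bool" where
  "runs_within w P xs T ok \<longleftrightarrow>
     length xs \<le> 2 ^ w \<and> (\<forall>x\<in>set xs. x < 2 ^ w) \<and>
     (\<exists>t s. real t \<le> T \<and> s = (step w P ^^ t) (init_config xs) \<and> halted P s \<and> ok (regs s))"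


section \<open>SETH\<close>

text \<open>The literal \<open>(i, b)\<close> is satisfied by \<open>\<sigma>\<close> iff \<open>\<sigma> i = b\<close>.\<close>

type_synonym cnf = "(nat \<times> bool) list list"

text \<open>
  Clauses are not repeated, so a \<open>q\<close>-CNF on \<open>N\<close> variables has size polynomial in \<open>N\<close> for fixed \<open>q\<close>.
\<close>

definition is_qcnf :: "nat \<Rightarrow> nat \<Rightarrow> cnf \<Rightarrow> bool" where
  "is_qcnf q N \<phi> \<longleftrightarrow>
     distinct \<phi> \<and> (\<forall>C\<in>set \<phi>. length C \<le> q \<and> (\<forall>(i, b)\<in>set C. i < N))"

definition satisfiable :: "cnf \<Rightarrow> bool" where
  "satisfiable \<phi> \<longleftrightarrow> (\<exists>\<sigma> :: nat \<Rightarrow> bool. \<forall>C\<in>set \<phi>. \<exists>(i, b)\<in>set C. \<sigma> i = b)"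

definition encode_cnf :: "nat \<Rightarrow> cnf \<Rightarrow> nat list" where
  "encode_cnf N \<phi> =
     N # length \<phi> # concat (map (\<lambda>C. length C # map (\<lambda>(i, b). 2 * i + of_bool b) C) \<phi>)"

text \<open>
  \<open>qsat_solvable_in q f\<close>: \<open>q\<close>-SAT on \<open>N\<close> variables can be solved in $O(f(N))$ time.  The time bounds of
  interest are exponential in \<open>N\<close>, so words have $O(N)$ bits: this is what is needed to address
  exponentially large memory, and unit-cost operations on such words only save factors
  polynomial in \<open>N\<close>.
\<close>

definition qsat_solvable_in :: "nat \<Rightarrow> (nat \<Rightarrow> real) \<Rightarrow> bool" where
  "qsat_solvable_in q f \<longleftrightarrow>
     (\<exists>P c K. \<forall>N \<phi>. is_qcnf q N \<phi> \<longrightarrow>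
        runs_within (c * (N + 1)) P (encode_cnf N \<phi>) (K * f N)
          (\<lambda>R. R 0 \<noteq> 0 \<longleftrightarrow> satisfiable \<phi>))"

definition SETH :: bool where
  "SETH \<longleftrightarrow> (\<forall>\<epsilon>>0. \<exists>q\<ge>3. \<not> qsat_solvable_in q (\<lambda>N. (2 - \<epsilon>) ^ N))"


section \<open>The \<open>k\<close>-radius\<close>

definition walk :: "'a set \<Rightarrow> 'a set set \<Rightarrow> 'a list \<Rightarrow> bool" where
  "walk V E p \<longleftrightarrow>
     p \<noteq> [] \<and> set p \<subseteq> V \<and> (\<forall>i. Suc i < length p \<longrightarrow> {p ! i, p ! Suc i} \<in> E)"

text \<open>The distance is \<open>\<infinity>\<close> between different connected components.\<close>

definition gdist :: "'a set \<Rightarrow> 'a set set \<Rightarrow> 'a \<Rightarrow> 'a \<Rightarrow> enat" where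
  "gdist V E u v = (INF p \<in> {p. walk V E p \<and> hd p = u \<and> last p = v}. enat (length p - 1))"

definition set_gdist :: "'a set \<Rightarrow> 'a set set \<Rightarrow> 'a \<Rightarrow> 'a set \<Rightarrow> enat" where
  "set_gdist V E v C = (INF c\<in>C. gdist V E v c)"

text \<open>
  For finite \<open>V\<close> and \<open>1 \<le> k \<le> card V\<close> all infima and suprema here range over nonempty sets and
  are attained.
\<close>

definition k_radius :: "nat \<Rightarrow> 'a set \<Rightarrow> 'a set set \<Rightarrow> enat" where
  "k_radius k V E = (INF C \<in> {C. C \<subseteq> V \<and> card C = k}. SUP v\<in>V. set_gdist V E v C)"


section \<open>Algorithms for the \<open>k\<close>-radius\<close>

text \<open>
  An input graph has vertex set \<open>{..<n}\<close> and is given by a list of its edges, in arbitrary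
  order and orientation.  Thus $m$ is the length of the list.
\<close>

definition edges_of :: "(nat \<times> nat) list \<Rightarrow> nat set set" where
  "edges_of es = (\<lambda>(u, v). {u, v}) ` set es"

definition graph_input :: "nat \<Rightarrow> (nat \<times> nat) list \<Rightarrow> bool" where
  "graph_input n es \<longleftrightarrow>
     (\<forall>(u, v)\<in>set es. u < n \<and> v < n \<and> u \<noteq> v) \<and>
     distinct (map (\<lambda>(u, v). {u, v}) es) \<and>
     n \<le> length es + 1"

definition encode_graph :: "nat \<Rightarrow> (nat \<times> nat) list \<Rightarrow> nat list" where
  "encode_graph n es = n # length es # concat (map (\<lambda>(u, v). [u, v]) es)"

text \<open>The word length $O(\log n)$; the constant \<open>c\<close> is part of the algorithm.\<close>

definition log_word_length :: "nat \<Rightarrow> nat \<Rightarrow> nat" where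
  "log_word_length c n = c * nat \<lceil>log 2 (real n + 1)\<rceil>"

text \<open>
  \<open>k_radius_distinguishable_in k a b f\<close>: one can distinguish between \<open>k\<close>-radius \<open>\<le> a\<close> and
  \<open>k\<close>-radius \<open>\<ge> b\<close> in $O(f(m))$ time.
\<close>

definition k_radius_distinguishable_in :: "nat \<Rightarrow> nat \<Rightarrow> nat \<Rightarrow> (nat \<Rightarrow> real) \<Rightarrow> bool" where
  "k_radius_distinguishable_in k a b f \<longleftrightarrow>
     (\<exists>P c K. \<forall>n es.
        graph_input n es \<and> k \<le> n \<and>
        (k_radius k {..<n} (edges_of es) \<le> enat a \<or> k_radius k {..<n} (edges_of es) \<ge> enat b) \<longrightarrow>
        runs_within (log_word_length c n) P (encode_graph n es) (K * f (length es))
          (\<lambda>R. R 0 \<noteq> 0 \<longleftrightarrow> k_radius k {..<n} (edges_of es) \<le> enat a))"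

definition is_approximation :: "real \<Rightarrow> real \<Rightarrow> enat \<Rightarrow> ereal \<Rightarrow> bool" where
  "is_approximation \<alpha> \<beta> r x \<longleftrightarrow>
     ereal_of_enat r \<le> x \<and> x \<le> ereal \<alpha> * ereal_of_enat r + ereal \<beta>"

text \<open>An output value is a fraction of two words; denominator 0 stands for \<open>\<infinity>\<close>.\<close>

definition output_value :: "(nat \<Rightarrow> nat) \<Rightarrow> ereal" where
  "output_value R = (if R 1 = 0 then \<infinity> else ereal (real (R 0) / real (R 1)))"

definition k_radius_approximable_in :: "nat \<Rightarrow> real \<Rightarrow> real \<Rightarrow> (nat \<Rightarrow> real) \<Rightarrow> bool" where
  "k_radius_approximable_in k \<alpha> \<beta> f \<longleftrightarrow>
     (\<exists>P c K. \<forall>n es. graph_input n es \<and> k \<le> n \<longrightarrow>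
        runs_within (log_word_length c n) P (encode_graph n es) (K * f (length es))
          (\<lambda>R. is_approximation \<alpha> \<beta> (k_radius k {..<n} (edges_of es)) (output_value R)))"

end

theory Submission imports Defs begin

text \<open>
  The variables of a formula are split into \<open>k\<close> blocks.  Elements of the graph are the assignments of
  single blocks, and a clause is a test that an element passes (covers) if it satisfies the clause.
  One center is meant to sit on an element of every block and one on a common root, so the
  \<open>(k + 1)\<close>-radius is considered.  Let elements have distance 5 to the tips of the tests that they
  cover and 9 to all other tips.  To keep the rest of the graph within distance 5 of the intended
  centers, the paths from elements to a tip have to be joined pairwise, which costs a number
  of edges quadratic in the number of elements.  A center inside such a joint is close to all
  tests covered by one of two elements, so arbitrary centers only choose a set of boundedly many
  elements.  Such a set is no more powerful than a choice of one element per block if the tests are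
  strengthened: a test is a family of clauses \<open>C c\<close> indexed by the functions \<open>c\<close> from blocks to
  \<open>{..<R}\<close>, and an element of block \<open>i\<close> fails it iff there is \<open>e < R\<close> such that the
  element satisfies none of the clauses \<open>C c\<close> with \<open>c i = e\<close>.  The number of tests is still polynomial.

  With blocks of \<open>N / k\<close> variables the graph has \<open>2 ^ (2 * N / k)\<close> edges up to polynomial
  factors, hence time \<open>m powr ((k - 1) / 2)\<close> suffices to refute SETH.  The SAT algorithm computes
  every memory cell of the graph from the index of the cell by an expression with bounded loops and
  then simulates the given algorithm, reducing every result to the shorter word length.
\<close>

section \<open>Distances, potentials and subdivided graphs\<close>

text \<open>\<open>k\<close> blocks go with \<open>k + 1\<close> centers, so
  \<open>2 * k + 1\<close> blocks serve for the (2k+2)-radius and give the exponent ((2k+1) - 1)/2 =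
  k. The joints shape the tests. Because of them, \<open>k + 1\<close> centers stand for up to
  \<open>2 * (k + 1)\<close> elements, possibly several of one block, and these combine to many
  assignments: one for each function \<open>c\<close> that tells every block which chosen element to
  use. An unsatisfiable formula defeats each of these assignments by a clause of its own, but a
  single tip has to be far from all centers. A test therefore bundles one clause for every
  \<open>c\<close>, and \<open>R = 2 * (k + 1)\<close> is the number of elements to choose from.
  Writing the graph takes about 2^(2N/k) steps. This stays within the budget of 2^((k-1)N/k) only
  from three blocks on. The first claim has at least five; the approximation claim has fewer only
  where its exponent is negative, and there it suffices that a fast program cannot make a single
  step on large inputs.\<close>

lemma radix_div_mod:
  fixes z p r :: nat
  assumes "p < r" shows "(z * r + p) div r = z" "(z * r + p) mod r = p"
  using assms by auto

lemma radix_less: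
  fixes z p r k :: nat
  assumes "z < k" "p < r" shows "z * r + p < k * r"
proof -
  have "z * r + p < Suc z * r" using assms by simp
  also have "\<dots> \<le> k * r" using assms by (intro mult_right_mono) auto
  finally show ?thesis .
qed

lemma walk_Cons:
  assumes "walk V E p" "v \<in> V" "{v, hd p} \<in> E"
  shows "walk V E (v # p)"
proof -
  have "{(v # p) ! i, (v # p) ! Suc i} \<in> E" if "Suc i < length (v # p)" for i
    using that assms by (cases i) (auto simp: walk_def hd_conv_nth)
  then show ?thesis using assms by (auto simp: walk_def)
qed

text \<open>Upper bounds on the distance to \<open>C\<close> are generated edge by edge, which keeps
  explicit walks out of the case analysis in \<open>radius_le\<close>. Since \<open>center\<close>
  holds for every \<open>d\<close>, the predicate is monotone in \<open>d\<close>.\<close>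

inductive near :: "'a set \<Rightarrow> 'a set set \<Rightarrow> 'a set \<Rightarrow> nat \<Rightarrow> 'a \<Rightarrow> bool" for V E C where
  center: "c \<in> C \<Longrightarrow> c \<in> V \<Longrightarrow> near V E C d c"
| step: "near V E C d u \<Longrightarrow> {u, v} \<in> E \<Longrightarrow> v \<in> V \<Longrightarrow> near V E C (Suc d) v"

lemma near_mono: "near V E C d v \<Longrightarrow> d \<le> d' \<Longrightarrow> near V E C d' v"
proof (induction arbitrary: d' rule: near.induct)
  case (center c d)
  then show ?case by (simp add: near.center)
next
  case (step d u v)
  then obtain d'' where "d' = Suc d''" "d \<le> d''" by (cases d') auto
  with step show ?case by (auto intro: near.step)
qed

lemma set_gdist_le_near:
  assumes "near V E C d v" shows "set_gdist V E v C \<le> enat d"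
proof -
  have "\<exists>p. walk V E p \<and> hd p = v \<and> last p \<in> C \<and> length p - 1 \<le> d"
    using assms
  proof induction
    case (center c d)
    then show ?case by (intro exI[of _ "[c]"]) (auto simp: walk_def)
  next
    case (step d u v)
    then obtain p where p: "walk V E p" "hd p = u" "last p \<in> C" "length p - 1 \<le> d" by blast
    then have "p \<noteq> []" by (simp add: walk_def)
    with p step have "walk V E (v # p)" by (intro walk_Cons) (auto simp: insert_commute)
    with p \<open>p \<noteq> []\<close> show ?case by (intro exI[of _ "v # p"]) (cases p; auto)
  qed
  then obtain p where p: "walk V E p" "hd p = v" "last p \<in> C" "length p - 1 \<le> d" by blast
  have "set_gdist V E v C \<le> gdist V E v (last p)"
    unfolding set_gdist_def using p(3) by (rule INF_lower)
  also have "\<dots> \<le> enat (length p - 1)"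
    unfolding gdist_def using p by (intro INF_lower) auto
  also have "\<dots> \<le> enat d" using p(4) by simp
  finally show ?thesis .
qed

lemma k_radius_le_near:
  assumes "C \<subseteq> V" "card C = k" "\<And>v. v \<in> V \<Longrightarrow> near V E C d v"
  shows "k_radius k V E \<le> enat d"
proof -
  have "k_radius k V E \<le> (SUP v\<in>V. set_gdist V E v C)"
    unfolding k_radius_def using assms(1,2) by (intro INF_lower) auto
  also have "\<dots> \<le> enat d" using assms(3) by (intro SUP_least set_gdist_le_near)
  finally show ?thesis .
qed

lemma walk_Lipschitz:
  fixes h :: "'a \<Rightarrow> nat"
  assumes "walk V E p"
    and "\<And>u v. {u, v} \<in> E \<Longrightarrow> h v \<le> h u + 1"
  shows "h (last p) \<le> h (hd p) + (length p - 1)"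
proof -
  have "i < length p \<Longrightarrow> h (p ! i) \<le> h (p ! 0) + i" for i
  proof (induction i)
    case (Suc i)
    then have "{p ! i, p ! Suc i} \<in> E" using assms(1) by (simp add: walk_def)
    from assms(2)[OF this] Suc show ?case by simp
  qed simp
  from this[of "length p - 1"] show ?thesis
    using assms(1) by (simp add: walk_def hd_conv_nth last_conv_nth)
qed

text \<open>A function that vanishes at \<open>v\<close> and grows by at most 1 per edge is a lower
  bound on the distance from \<open>v\<close>. So each set of centers only needs one far vertex with
  such a certificate, and both may depend on \<open>C\<close>.\<close>

lemma k_radius_ge_potential:
  assumes "\<And>C. C \<subseteq> V \<Longrightarrow> card C = k \<Longrightarrow>
     \<exists>v\<in>V. \<exists>h. h v = 0 \<and> (\<forall>u w. {u, w} \<in> E \<longrightarrow> h w \<le> h u + 1) \<and> (\<forall>c\<in>C. d \<le> (h c :: nat))"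
  shows "enat d \<le> k_radius k V E"
  unfolding k_radius_def
proof (rule INF_greatest, safe)
  fix C assume "C \<subseteq> V" "k = card C"
  then obtain v h where v: "v \<in> V" "h v = 0" and
    h: "\<And>u w. {u, w} \<in> E \<Longrightarrow> h w \<le> h u + (1::nat)" "\<And>c. c \<in> C \<Longrightarrow> d \<le> h c"
    using assms[of C] by metis
  have "enat d \<le> set_gdist V E v C"
    unfolding set_gdist_def gdist_def
  proof (intro INF_greatest, safe)
    fix p assume p: "walk V E p" "v = hd p" "last p \<in> C"
    have "d \<le> h (last p)" using h(2) p(3) by blast
    also have "\<dots> \<le> h (hd p) + (length p - 1)" using p(1) h(1) by (rule walk_Lipschitz)
    finally show "enat d \<le> enat (length p - 1)" using v(2) p(2) by simp
  qed
  also have "\<dots> \<le> (SUP v\<in>V. set_gdist V E v C)" using v(1) by (rule SUP_upper)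
  finally show "enat d \<le> (SUP v\<in>V. set_gdist V E v C)" .
qed


text \<open>Replacing every edge by a path of length \<open>l\<close> scales the gap between 5 and 9
  to \<open>5 * l\<close> and \<open>9 * l\<close>, so that a large \<open>l\<close> can absorb an
  additive error. Vertices and edges are plain numbers and the ends are functions of the edge number
  because an algorithm has to produce the graph. \<open>many_edges\<close> is preserved by the
  subdivision and yields the bound on the order in \<open>graph_input\<close>.\<close>

locale core_graph =
  fixes nv me l :: nat and U W :: "nat \<Rightarrow> nat"
  assumes l_pos: "l \<ge> 1"
    and U_less: "z < me \<Longrightarrow> U z < nv" and W_less: "z < me \<Longrightarrow> W z < nv"
    and no_loop: "z < me \<Longrightarrow> U z \<noteq> W z"
    and no_parallel: "\<lbrakk>z < me; z' < me; {U z, W z} = {U z', W z'}\<rbrakk> \<Longrightarrow> z = z'"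
    and many_edges: "nv \<le> me + 1"
begin

definition node :: "nat \<Rightarrow> nat \<Rightarrow> nat" where
  "node z p = (if p = 0 then U z else if p = l then W z else nv + z * (l - 1) + (p - 1))"

definition order :: nat where "order = nv + me * (l - 1)"

definition edge_list :: "(nat \<times> nat) list" where
  "edge_list = map (\<lambda>y. (node (y div l) (y mod l), node (y div l) (Suc (y mod l)))) [0..<l * me]"

lemma length_edge_list [simp]: "length edge_list = l * me"
  by (simp add: edge_list_def)

lemma inner_index:
  assumes "0 < p" "p < l"
  shows "(z * (l - 1) + (p - 1)) div (l - 1) = z" "(z * (l - 1) + (p - 1)) mod (l - 1) = p - 1"
proof -
  have "p - 1 < l - 1" using assms by linarith
  from radix_div_mod[OF this] show
    "(z * (l - 1) + (p - 1)) div (l - 1) = z" "(z * (l - 1) + (p - 1)) mod (l - 1) = p - 1" .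
qed

lemma node_0: "node z 0 = U z" and node_l: "node z l = W z"
  using l_pos by (auto simp: node_def)

lemma node_less:
  assumes "z < me" "p \<le> l" shows "node z p < order"
proof -
  have "z * (l - 1) + (p - 1) < me * (l - 1)" if "0 < p" "p < l"
    using that assms by (intro radix_less) auto
  then show ?thesis using assms U_less W_less by (auto simp: node_def order_def trans_less_add1)
qed

lemma node_inner_eq:
  assumes "z < me" "z' < me" "node z p = node z' p'" "0 < p" "p < l" "p' \<le> l"
  shows "z = z' \<and> p = p'"
proof -
  have "node z p \<ge> nv" using assms by (simp add: node_def)
  then have "0 < p'" "p' < l"
    using assms U_less[of z'] W_less[of z'] by (auto simp: node_def split: if_splits)
  then have "z * (l - 1) + (p - 1) = z' * (l - 1) + (p' - 1)"
    using assms by (simp add: node_def)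
  then show ?thesis
    using inner_index[OF assms(4,5), of z] inner_index[OF \<open>0 < p'\<close> \<open>p' < l\<close>, of z'] \<open>0 < p'\<close> assms(4)
    by (metis Suc_pred' diff_Suc_1 One_nat_def)
qed

lemma node_eq_same:
  assumes "z < me" "node z p = node z p'" "p \<le> l" "p' \<le> l"
  shows "p = p'"
proof (cases "0 < p \<and> p < l \<or> 0 < p' \<and> p' < l")
  case True
  then show ?thesis using node_inner_eq[of z z p p'] node_inner_eq[of z z p' p] assms by auto
next
  case False
  then show ?thesis using assms no_loop[of z] l_pos by (auto simp: node_def split: if_splits)
qed

lemma sub_edge_inj:
  assumes "z < me" "z' < me" "p < l" "p' < l"
    and eq: "{node z p, node z (Suc p)} = {node z' p', node z' (Suc p')}"
  shows "z = z' \<and> p = p'"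
proof -
  have z: "z = z'"
  proof (cases "l = 1")
    case True
    then have "p = 0" "p' = 0" "Suc 0 = l" using assms by auto
    then have "{U z, W z} = {U z', W z'}" using eq by (metis node_0 node_l)
    then show ?thesis using assms no_parallel by blast
  next
    case False
    \<comment> \<open>For \<open>l \<ge> 2\<close> every edge of the subdivided graph has an end
      strictly inside its path, here at position \<open>r\<close>; such a vertex determines
      \<open>z\<close>.\<close>
    define r where "r = (if p = 0 then 1 else p)"
    have "node z r \<in> {node z' p', node z' (Suc p')}" unfolding eq[symmetric] r_def by auto
    moreover have "0 < r" "r < l" using False assms l_pos by (auto simp: r_def)
    ultimately show ?thesis
      using node_inner_eq[of z z' r p'] node_inner_eq[of z z' r "Suc p'"] assms by auto
  qed
  have "p = p' \<or> p = Suc p' \<and> Suc p = p'"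
    using eq node_eq_same[of z p p'] node_eq_same[of z p "Suc p'"] node_eq_same[of z "Suc p" p']
      assms unfolding z doubleton_eq_iff by (metis Suc_leI less_imp_le)
  then have "p = p'" by auto
  with z show ?thesis by simp
qed

lemma div_less_edges: "y < l * me \<Longrightarrow> y div l < me"
  using l_pos by (simp add: less_mult_imp_div_less mult.commute)

lemma graph_input_edge_list: "graph_input order edge_list"
proof -
  have "node (y div l) (y mod l) < order \<and> node (y div l) (Suc (y mod l)) < order \<and>
     node (y div l) (y mod l) \<noteq> node (y div l) (Suc (y mod l))" if "y < l * me" for y
  proof -
    have "y div l < me" "y mod l < l" using that l_pos div_less_edges by auto
    then show ?thesis
      using node_less node_eq_same[of "y div l" "y mod l" "Suc (y mod l)"] by (auto simp: Suc_leI)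
  qed
  moreover have "inj_on (\<lambda>y. {node (y div l) (y mod l), node (y div l) (Suc (y mod l))}) {0..<l * me}"
  proof (rule inj_onI)
    fix y y' assume y: "y \<in> {0..<l * me}" "y' \<in> {0..<l * me}"
      "{node (y div l) (y mod l), node (y div l) (Suc (y mod l))} =
       {node (y' div l) (y' mod l), node (y' div l) (Suc (y' mod l))}"
    then have "y div l = y' div l \<and> y mod l = y' mod l"
      using l_pos by (intro sub_edge_inj) (auto simp: div_less_edges)
    then show "y = y'" by (metis div_mult_mod_eq)
  qed
  moreover have "order \<le> l * me + 1"
  proof -
    have "l * me = me * (l - 1) + me" using l_pos by (cases l) auto
    then show ?thesis using many_edges by (simp add: order_def)
  qed
  ultimately show ?thesis
    by (auto simp: graph_input_def edge_list_def distinct_map comp_def case_prod_unfold)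
qed

lemma edges_of_edge_list:
  "edges_of edge_list = {{node z p, node z (Suc p)} |z p. z < me \<and> p < l}"
proof -
  have *: "\<exists>y < l * me. z = y div l \<and> p = y mod l" if "z < me" "p < l" for z p
  proof (intro exI conjI)
    show "z * l + p < l * me" using radix_less[OF that] by (simp add: mult.commute)
  qed (use that in auto)
  have "{{node z p, node z (Suc p)} |z p. z < me \<and> p < l} =
      (\<lambda>y. {node (y div l) (y mod l), node (y div l) (Suc (y mod l))}) ` {0..<l * me}"
    (is "?L = ?R")
  proof (intro subset_antisym subsetI)
    fix e assume "e \<in> ?L"
    with * show "e \<in> ?R" by force
  next
    fix e assume "e \<in> ?R"
    then obtain y where "y < l * me" "e = {node (y div l) (y mod l), node (y div l) (Suc (y mod l))}"
      by auto
    moreover from this have "y div l < me" "y mod l < l" using l_pos div_less_edges by auto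
    ultimately show "e \<in> ?L" by blast
  qed
  then show ?thesis by (simp add: edges_of_def edge_list_def image_image)
qed

lemma edge_memI: "z < me \<Longrightarrow> p < l \<Longrightarrow> {node z p, node z (Suc p)} \<in> edges_of edge_list"
  unfolding edges_of_edge_list by blast

lemma vertex_cases:
  assumes "v < order"
  obtains "v < nv" | z p where "z < me" "p < l" "v = node z p" "0 < p"
proof (cases "v < nv")
  case False
  define z where "z = (v - nv) div (l - 1)"
  define p where "p = (v - nv) mod (l - 1) + 1"
  have *: "v - nv < me * (l - 1)" using assms False by (auto simp: order_def)
  then have l: "l - 1 > 0" by (cases "l - 1") auto
  have z: "z < me" unfolding z_def using * by (rule less_mult_imp_div_less)
  have p: "0 < p" "p < l" using l mod_less_divisor[OF l, of "v - nv"] unfolding p_def by linarith+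
  have "z * (l - 1) + (p - 1) = v - nv" unfolding z_def p_def by (simp only: add_diff_cancel_right' div_mult_mod_eq)
  then have "v = nv + (z * (l - 1) + (p - 1))" using False by linarith
  then have "v = node z p" using p by (simp add: node_def)
  with z p show ?thesis using that by blast
qed (rule that)

text \<open>For \<open>H\<close> that changes by at most 1 along core edges, this is the largest
  interpolation of \<open>l * H\<close> that changes by at most 1 per step: the smaller of the
  values obtained by walking in from either end. Being a minimum, it keeps every lower bound that
  holds at both ends.\<close>

definition ext :: "(nat \<Rightarrow> nat) \<Rightarrow> nat \<Rightarrow> nat" where
  "ext H v = (if v < nv then l * H v else
     let z = (v - nv) div (l - 1); p = (v - nv) mod (l - 1) + 1
     in min (l * H (U z) + p) (l * H (W z) + (l - p)))"

lemma ext_node: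
  assumes "z < me" "p \<le> l" "H (U z) \<le> H (W z) + 1" "H (W z) \<le> H (U z) + 1"
  shows "ext H (node z p) = min (l * H (U z) + p) (l * H (W z) + (l - p))"
proof -
  have "l * H (U z) \<le> l * (H (W z) + 1)" "l * H (W z) \<le> l * (H (U z) + 1)"
    using assms by (intro mult_left_mono; simp)+
  then have le: "l * H (U z) \<le> l * H (W z) + l" "l * H (W z) \<le> l * H (U z) + l"
    by simp_all
  consider "p = 0" | "p = l" | "0 < p" "p < l" using assms(2) by linarith
  then show ?thesis
  proof cases
    case 1
    then show ?thesis using le assms(1) U_less by (simp add: node_0 ext_def)
  next
    case 2
    then show ?thesis using le assms(1) W_less by (simp add: node_l ext_def)
  next
    case 3
    have "node z p - nv = z * (l - 1) + (p - 1)" "\<not> node z p < nv"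
      using 3 unfolding node_def by simp_all
    then show ?thesis using inner_index[OF 3, of z] 3(1) unfolding ext_def Let_def by simp
  qed
qed

lemma ext_Lipschitz:
  assumes H: "\<And>z. z < me \<Longrightarrow> H (U z) \<le> H (W z) + 1 \<and> H (W z) \<le> H (U z) + 1"
    and "{u, w} \<in> edges_of edge_list"
  shows "ext H w \<le> ext H u + 1"
proof -
  from assms(2) obtain z p where zp: "z < me" "p < l" "{u, w} = {node z p, node z (Suc p)}"
    by (auto simp: edges_of_edge_list)
  have "ext H (node z p) \<le> ext H (node z (Suc p)) + 1" "ext H (node z (Suc p)) \<le> ext H (node z p) + 1"
    using zp H[OF zp(1)] by (simp_all add: ext_node)
  with zp(3) show ?thesis by (auto simp: doubleton_eq_iff)
qed

abbreviation "close \<equiv> near {..<order} (edges_of edge_list)"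

lemma near_along_edge:
  assumes "z < me" "p \<le> l" "close C d (U z)"
  shows "close C (d + p) (node z p)"
  using assms(2)
proof (induction p)
  case 0
  then show ?case using assms(3) by (simp add: node_def)
next
  case (Suc p)
  have "{node z p, node z (Suc p)} \<in> edges_of edge_list"
    using Suc.prems assms(1) by (intro edge_memI) auto
  then have "close C (Suc (d + p)) (node z (Suc p))"
    using Suc assms(1) node_less[of z "Suc p"] by (intro near.step) auto
  then show ?case by simp
qed

lemma near_along_edge_back:
  assumes "z < me" "close C d (W z)"
  shows "close C (d + l) (U z)"
proof -
  have "p \<le> l \<Longrightarrow> close C (d + p) (node z (l - p))" for p
  proof (induction p)
    case 0
    then show ?case using assms(2) l_pos by (simp add: node_def)
  next
    case (Suc p)
    have "Suc (l - Suc p) = l - p" using Suc.prems by simp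
    moreover have "{node z (l - Suc p), node z (Suc (l - Suc p))} \<in> edges_of edge_list"
      using Suc.prems assms(1) by (intro edge_memI) auto
    ultimately have "{node z (l - p), node z (l - Suc p)} \<in> edges_of edge_list"
      by (simp add: insert_commute)
    then have "close C (Suc (d + p)) (node z (l - Suc p))"
      using Suc assms(1) node_less[of z "l - Suc p"] by (intro near.step) auto
    then show ?case by simp
  qed
  from this[of l] show ?thesis by (simp add: node_def)
qed

end

section \<open>A graph that tests coverage\<close>

datatype vert = Root | Leg nat nat | Tip nat | Mid nat nat nat | Gate nat nat | Hub nat

text \<open>
  Element \<open>a\<close> is the vertex \<open>Leg a 3\<close> at distance 4 from the root.  If it covers test \<open>t\<close>, then it
  reaches \<open>Tip t\<close> via \<open>Mid t a n\<close>, \<open>Gate t a\<close>, \<open>Mid t a a\<close> and \<open>Hub t\<close>; otherwise \<open>Gate t a\<close> is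
  connected to the root.  \<open>Mid t a a'\<close> joins the gates of two elements that cover \<open>t\<close>.
\<close>

locale cover_graph =
  fixes n T l :: nat and cov :: "nat \<Rightarrow> nat \<Rightarrow> bool"
  assumes n_pos: "n \<ge> 1" and l_pos: "l \<ge> 1"
begin

definition "mids = T * n * (n + 1)"
definition "mid0 = 1 + 4 * n + T"
definition "gate0 = mid0 + mids"
definition "hub0 = gate0 + T * n"
definition "verts = hub0 + T"
definition "edges = 4 * n + T + 2 * mids"

text \<open>The mixed-radix numbering lets the parts of a vertex be recovered by division, both in
  \<open>dec\<close> and by the SAT algorithm. The last component of a \<open>Mid\<close> vertex has
  the extra value \<open>n\<close>, which stands for the link to the leg.\<close>

fun enc :: "vert \<Rightarrow> nat" where
  "enc Root = 0"
| "enc (Leg a i) = 1 + (a * 4 + i)"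
| "enc (Tip t) = 1 + 4 * n + t"
| "enc (Mid t a a') = mid0 + ((t * n + a) * (n + 1) + a')"
| "enc (Gate t a) = gate0 + (t * n + a)"
| "enc (Hub t) = hub0 + t"

fun valid :: "vert \<Rightarrow> bool" where
  "valid Root \<longleftrightarrow> True"
| "valid (Leg a i) \<longleftrightarrow> a < n \<and> i < 4"
| "valid (Tip t) \<longleftrightarrow> t < T"
| "valid (Mid t a a') \<longleftrightarrow> t < T \<and> a < n \<and> a' \<le> n"
| "valid (Gate t a) \<longleftrightarrow> t < T \<and> a < n"
| "valid (Hub t) \<longleftrightarrow> t < T"

definition dec :: "nat \<Rightarrow> vert" where
  "dec v = (if v = 0 then Root
     else if v < 1 + 4 * n then Leg ((v - 1) div 4) ((v - 1) mod 4)
     else if v < mid0 then Tip (v - (1 + 4 * n))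
     else if v < gate0 then
       Mid ((v - mid0) div (n + 1) div n) ((v - mid0) div (n + 1) mod n) ((v - mid0) mod (n + 1))
     else if v < hub0 then Gate ((v - gate0) div n) ((v - gate0) mod n)
     else Hub (v - hub0))"

lemma mid_index_less: "t < T \<Longrightarrow> a < n \<Longrightarrow> a' \<le> n \<Longrightarrow> (t * n + a) * (n + 1) + a' < mids"
  unfolding mids_def by (intro radix_less) auto

lemma enc_less: "valid x \<Longrightarrow> enc x < verts"
proof (cases x)
  case (Leg a i)
  assume "valid x"
  with Leg radix_less[of a n i 4] show ?thesis
    by (simp add: verts_def hub0_def gate0_def mid0_def)
next
  case (Mid t a a')
  assume "valid x"
  with Mid mid_index_less[of t a a'] show ?thesis by (simp add: verts_def hub0_def gate0_def)
next
  case (Gate t a)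
  assume "valid x"
  with Gate radix_less[of t T a n] show ?thesis by (simp add: verts_def hub0_def)
qed (auto simp: verts_def hub0_def gate0_def mid0_def)

lemma dec_enc: "valid x \<Longrightarrow> dec (enc x) = x"
proof (cases x)
  case (Leg a i)
  assume "valid x"
  with Leg radix_less[of a n i 4] show ?thesis by (simp add: dec_def)
next
  case (Mid t a a')
  assume v: "valid x"
  then have "((t * n + a) * (n + 1) + a') div (n + 1) = t * n + a"
    "((t * n + a) * (n + 1) + a') mod (n + 1) = a'"
    "(t * n + a) div n = t" "(t * n + a) mod n = a"
    using Mid by (auto intro!: radix_div_mod simp del: mult_Suc_right)
  moreover have "enc x = mid0 + ((t * n + a) * (n + 1) + a')" "enc x < gate0"
    using v Mid mid_index_less[of t a a'] by (auto simp: gate0_def)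
  moreover have "1 + 4 * n \<le> mid0" by (simp add: mid0_def)
  ultimately show ?thesis unfolding dec_def Mid by simp
next
  case (Gate t a)
  assume v: "valid x"
  moreover have "1 + 4 * n \<le> mid0" "mid0 \<le> gate0" by (auto simp: mid0_def gate0_def)
  ultimately show ?thesis using Gate radix_less[of t T a n] by (simp add: dec_def hub0_def)
next
  case (Hub t)
  have "1 + 4 * n \<le> mid0" "mid0 \<le> gate0" "gate0 \<le> hub0" by (auto simp: mid0_def gate0_def hub0_def)
  with Hub show ?thesis by (simp add: dec_def)
qed (auto simp: dec_def mid0_def)

lemma mid_index_cases:
  assumes "y < mids"
  obtains t a a' where "t < T" "a < n" "a' \<le> n" "y = (t * n + a) * (n + 1) + a'"
proof
  have 1: "y div (n + 1) < T * n" using assms unfolding mids_def by (rule less_mult_imp_div_less)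
  then show "y div (n + 1) div n < T" by (rule less_mult_imp_div_less)
  show "y div (n + 1) mod n < n" using n_pos by simp
  show "y mod (n + 1) \<le> n" using mod_less_divisor[of "n + 1" y] by linarith
  show "y = (y div (n + 1) div n * n + y div (n + 1) mod n) * (n + 1) + y mod (n + 1)"
    by (simp only: div_mult_mod_eq)
qed

lemma vertE:
  assumes "v < verts" obtains x where "valid x" "v = enc x"
proof -
  consider "v = 0" | "0 < v" "v < 1 + 4 * n" | "1 + 4 * n \<le> v" "v < mid0" | "mid0 \<le> v" "v < gate0"
    | "gate0 \<le> v" "v < hub0" | "hub0 \<le> v" by linarith
  then show ?thesis
  proof cases
    case 1
    then show ?thesis using that[of Root] by simp
  next
    case 2
    then show ?thesis using that[of "Leg ((v - 1) div 4) ((v - 1) mod 4)"] by simp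
  next
    case 3
    then show ?thesis using that[of "Tip (v - (1 + 4 * n))"] by (simp add: mid0_def)
  next
    case 4
    then have "v - mid0 < mids" by (simp add: gate0_def)
    then obtain t a a' where *: "t < T" "a < n" "a' \<le> n" "v - mid0 = (t * n + a) * (n + 1) + a'"
      by (rule mid_index_cases)
    moreover from *(4) 4 have "v = enc (Mid t a a')" by simp
    ultimately show ?thesis using that[of "Mid t a a'"] by simp
  next
    case 5
    then have "v - gate0 < T * n" by (simp add: hub0_def)
    then have "(v - gate0) div n < T" by (rule less_mult_imp_div_less)
    then show ?thesis using that[of "Gate ((v - gate0) div n) ((v - gate0) mod n)"] 5 n_pos by simp
  next
    case 6
    then show ?thesis using that[of "Hub (v - hub0)"] assms by (simp add: verts_def)
  qed
qed

text \<open>The neighbour of \<open>Mid t a a'\<close> other than \<open>Gate t a\<close>. There is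
  a \<open>Mid\<close> vertex for every index triple: where no joint is wanted, its path leads to
  the hub, or to the root if \<open>a\<close> does not cover \<open>t\<close>. This makes the number
  and the order of the edges independent of the coverage.\<close>

definition targ :: "nat \<Rightarrow> nat \<Rightarrow> nat \<Rightarrow> vert" where
  "targ t a a' = (if \<not> cov a t then Root else if a' = n then Leg a 3
     else if a' \<noteq> a \<and> cov a' t then Gate t a' else Hub t)"

text \<open>Edges are numbered by owner: every \<open>Leg\<close> and \<open>Tip\<close> vertex owns
  one edge and every \<open>Mid\<close> vertex two.\<close>

definition own :: "nat \<Rightarrow> nat" where
  "own z = (if z < 4 * n + T then z + 1 else mid0 + (z - (4 * n + T)) div 2)"

definition other :: "nat \<Rightarrow> nat" where
  "other z = (if z < 4 * n then (if z mod 4 = 0 then 0 else z)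
     else if z < 4 * n + T then hub0 + (z - 4 * n)
     else let y = (z - (4 * n + T)) div 2 in
       if (z - (4 * n + T)) mod 2 = 0 then gate0 + y div (n + 1)
       else enc (targ (y div (n + 1) div n) (y div (n + 1) mod n) (y mod (n + 1))))"

text \<open>
  In \<open>edge z x y\<close>, \<open>y\<close> is the endpoint on which the label of the inner vertices of the edge depends,
  and \<open>x\<close> is the endpoint that stays within distance 4 of the intended centers.
\<close>

inductive edge :: "nat \<Rightarrow> vert \<Rightarrow> vert \<Rightarrow> bool" where
  leg0: "a < n \<Longrightarrow> edge (a * 4) Root (Leg a 0)"
| leg: "a < n \<Longrightarrow> i < 3 \<Longrightarrow> edge (a * 4 + Suc i) (Leg a i) (Leg a (Suc i))"
| tail: "t < T \<Longrightarrow> edge (4 * n + t) (Hub t) (Tip t)"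
| gate: "t < T \<Longrightarrow> a < n \<Longrightarrow> a' \<le> n \<Longrightarrow>
    edge (4 * n + T + 2 * ((t * n + a) * (n + 1) + a')) (Gate t a) (Mid t a a')"
| targ: "t < T \<Longrightarrow> a < n \<Longrightarrow> a' \<le> n \<Longrightarrow>
    edge (4 * n + T + 2 * ((t * n + a) * (n + 1) + a') + 1) (targ t a a') (Mid t a a')"

lemma valid_targ: "t < T \<Longrightarrow> a < n \<Longrightarrow> a' \<le> n \<Longrightarrow> valid (targ t a a')"
  by (auto simp: targ_def)

lemma edge_exists: "z < edges \<Longrightarrow> \<exists>x y. edge z x y"
proof -
  assume z: "z < edges"
  consider "z < 4 * n" | "4 * n \<le> z" "z < 4 * n + T" | "4 * n + T \<le> z" by linarith
  then show ?thesis
  proof cases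
    case 1
    define a i where "a = z div 4" and "i = z mod 4"
    have a: "a < n" "z = a * 4 + i" "i < 4" using 1 by (auto simp: a_def i_def)
    then show ?thesis using edge.leg0[of a] edge.leg[of a "i - 1"] by (cases i) auto
  next
    case 2
    then have "edge z (Hub (z - 4 * n)) (Tip (z - 4 * n))" using edge.tail[of "z - 4 * n"] by simp
    then show ?thesis by blast
  next
    case 3
    define y where "y = (z - (4 * n + T)) div 2"
    have "y < mids" using z 3 by (auto simp: y_def edges_def)
    then obtain t a a' where *: "t < T" "a < n" "a' \<le> n" "y = (t * n + a) * (n + 1) + a'"
      by (rule mid_index_cases)
    have "z = 4 * n + T + 2 * y \<or> z = 4 * n + T + 2 * y + 1" using 3 unfolding y_def by presburger
    then show ?thesis using edge.gate[OF *(1-3)] edge.targ[OF *(1-3)] unfolding *(4) by blast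
  qed
qed

lemma mid_edge_ends:
  assumes "t < T" "a < n" "a' \<le> n" and y: "y = (t * n + a) * (n + 1) + a'"
  shows "own (4 * n + T + 2 * y) = enc (Mid t a a')" "own (4 * n + T + 2 * y + 1) = enc (Mid t a a')"
    "other (4 * n + T + 2 * y) = enc (Gate t a)" "other (4 * n + T + 2 * y + 1) = enc (targ t a a')"
proof -
  have "y div (n + 1) = t * n + a" "y mod (n + 1) = a'" "(t * n + a) div n = t" "(t * n + a) mod n = a"
    unfolding y using assms(1-3) by (auto intro!: radix_div_mod simp del: mult_Suc_right)
  moreover have "enc (Mid t a a') = mid0 + y" by (simp add: y)
  ultimately show "own (4 * n + T + 2 * y) = enc (Mid t a a')" "own (4 * n + T + 2 * y + 1) = enc (Mid t a a')"
    "other (4 * n + T + 2 * y) = enc (Gate t a)" "other (4 * n + T + 2 * y + 1) = enc (targ t a a')"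
    by (simp_all add: own_def other_def Let_def del: enc.simps(4))
qed

lemma edge_ends:
  assumes "edge z x y"
  shows "valid x" "valid y" "other z = enc x" "own z = enc y" "z < edges"
proof -
  have "valid x \<and> valid y \<and> other z = enc x \<and> own z = enc y \<and> z < edges"
    using assms
  proof cases
    case (leg a i)
    moreover have "a * 4 + Suc i < n * 4" using leg by (intro radix_less) auto
    moreover have "(a * 4 + Suc i) mod 4 = Suc i" using leg by (intro radix_div_mod) auto
    ultimately show ?thesis by (auto simp: own_def other_def edges_def)
  next
    case (gate t a a')
    then show ?thesis
      using mid_edge_ends(1,3)[OF gate(4-6) refl] mid_index_less[OF gate(4-6)] by (auto simp: edges_def)
  next
    case (targ t a a')
    then show ?thesis
      using mid_edge_ends(2,4)[OF targ(4-6) refl] mid_index_less[OF targ(4-6)] valid_targ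
      by (auto simp: edges_def)
  qed (auto simp: own_def other_def edges_def)
  then show "valid x" "valid y" "other z = enc x" "own z = enc y" "z < edges" by auto
qed

lemma enc_inj: "valid x \<Longrightarrow> valid y \<Longrightarrow> enc x = enc y \<Longrightarrow> x = y"
  by (metis dec_enc)

lemma edge_unique:
  assumes "edge z x y" "edge z' x' y'" "{x, y} = {x', y'}"
  shows "z = z'"
proof -
  have "edge z x y \<Longrightarrow> edge z' x y \<Longrightarrow> z = z'" for z z' x y
    by (auto elim!: edge.cases simp: targ_def split: if_splits)
  moreover have False if "edge z x y" "edge z' y x"
    using that by (auto elim!: edge.cases simp: targ_def split: if_splits)
  ultimately show ?thesis using assms by (auto simp: doubleton_eq_iff)
qed

sublocale core_graph verts edges l other own
proof
  fix z assume z: "z < edges"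
  then obtain x y where e: "edge z x y" using edge_exists by blast
  note ends = edge_ends[OF e]
  show "other z < verts" "own z < verts" using ends enc_less by auto
  have "x \<noteq> y" using e by (auto elim!: edge.cases simp: targ_def split: if_splits)
  then show "other z \<noteq> own z" using ends enc_inj by auto
  fix z' assume "z' < edges" and eq: "{other z, own z} = {other z', own z'}"
  then obtain x' y' where e': "edge z' x' y'" using edge_exists by blast
  note ends' = edge_ends[OF e']
  have "{x, y} = {x', y'}"
    using eq ends ends' enc_inj by (auto simp: doubleton_eq_iff)
  then show "z = z'" using edge_unique[OF e e'] by blast
next
  \<comment> \<open>Gates and hubs own no edge; the second edges of the \<open>Mid\<close> vertices
    make up for them.\<close>
  have "T * (n + 1) * 1 \<le> T * (n + 1) * n" using n_pos by (intro mult_left_mono) auto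
  then have "T * n + T \<le> mids" by (simp add: mids_def algebra_simps)
  then show "verts \<le> edges + 1" by (simp add: verts_def edges_def hub0_def gate0_def mid0_def)
qed (rule l_pos)

section \<open>Upper and lower bounds on the radius of the cover graph\<close>

abbreviation "radius k \<equiv> k_radius k {..<order} (edges_of edge_list)"

lemma verts_le_order: "verts \<le> order" by (simp add: order_def)

text \<open>The centers are the root and the leg ends of \<open>A\<close>. If \<open>a\<close> in
  \<open>A\<close> covers \<open>t\<close>, then the gate of \<open>a\<close> is at distance 2 and
  its \<open>Mid\<close> vertices at 3, so the hub of \<open>t\<close> and the gates joined to that
  of \<open>a\<close> are at 4 and the tip is at 5. Gates of elements that do not cover
  \<open>t\<close> are 2 away from the root.\<close>

theorem radius_le:
  assumes "A \<subseteq> {..<n}" and covered: "\<And>t. t < T \<Longrightarrow> \<exists>a\<in>A. cov a t"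
  shows "radius (card A + 1) \<le> enat (5 * l)"
proof (rule k_radius_le_near)
  define C where "C = insert (enc Root) ((\<lambda>a. enc (Leg a 3)) ` A)"
  define nr where "nr d x \<longleftrightarrow> close C (d * l) (enc x)" for d x
  have "finite A" using assms(1) finite_subset by blast
  moreover have "inj_on (\<lambda>a. enc (Leg a 3)) A" by (auto simp: inj_on_def)
  ultimately show "card C = card A + 1" by (simp add: C_def card_image card_insert_if image_iff)
  have "enc x \<in> {..<order}" if "valid x" for x using enc_less[OF that] verts_le_order by simp
  moreover have valid: "valid (Leg a 3)" if "a \<in> A" for a using that assms(1) by auto
  moreover have "valid Root" by simp
  ultimately show "C \<subseteq> {..<order}" unfolding C_def by (blast intro: valid)
  have mono: "nr d' x" if "nr d x" "d \<le> d'" for d d' x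
    using that unfolding nr_def by (elim near_mono) simp
  have own: "nr d' y" if "edge z x y" "nr d x" "d < d'" for z x y d d'
  proof -
    have "nr (Suc d) y"
      using near_along_edge[of z l C "d * l"] that edge_ends[OF that(1)]
      by (simp add: nr_def node_l add.commute[of l])
    then show ?thesis using that(3) by (rule mono[OF _ Suc_leI])
  qed
  have other: "nr d' x" if "edge z x y" "nr d y" "d < d'" for z x y d d'
  proof -
    have "nr (Suc d) x"
      using near_along_edge_back[of z C "d * l"] that edge_ends[OF that(1)]
      by (simp add: nr_def add.commute[of l])
    then show ?thesis using that(3) by (rule mono[OF _ Suc_leI])
  qed
  have C: "nr 0 x" if "enc x \<in> C" for x
    using that \<open>C \<subseteq> {..<order}\<close> by (auto simp: nr_def intro: near.center)
  have root: "nr 0 Root" by (rule C) (simp add: C_def)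
  have leg: "nr (Suc i) (Leg a i)" if "a < n" "i < 4" for a i
    using that(2)
  proof (induction i)
    case 0
    show ?case by (rule own[OF edge.leg0[OF that(1)] root]) simp
  next
    case (Suc i)
    then have "i < 3" "nr (Suc i) (Leg a i)" by simp_all
    from own[OF edge.leg[OF that(1) this(1)] this(2)] show ?case by simp
  qed
  have gate_hub: "nr 4 (Gate t a')" "nr 4 (Hub t)" if t: "t < T" and a': "a' < n" for t a'
  proof -
    obtain a where a: "a \<in> A" "cov a t" "a < n" using covered[OF t] assms(1) by auto
    have "nr 0 (targ t a n)" using a by (intro C) (simp add: C_def targ_def)
    from own[OF edge.targ[OF t a(3) order.refl] this, of 1] have "nr 1 (Mid t a n)" by simp
    from other[OF edge.gate[OF t a(3) order.refl] this, of 2] have gate: "nr 2 (Gate t a)" by simp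
    have mid: "nr 3 (Mid t a b)" if "b \<le> n" for b
      by (rule own[OF edge.gate[OF t a(3) that] gate]) simp
    have targ: "nr 4 (targ t a b)" if "b \<le> n" for b
      by (rule other[OF edge.targ[OF t a(3) that] mid[OF that]]) simp
    show "nr 4 (Hub t)" using targ[of a] a by (simp add: targ_def)
    consider "a' = a" | "a' \<noteq> a" "cov a' t" | "\<not> cov a' t" using a by blast
    then show "nr 4 (Gate t a')"
    proof cases
      case 1
      then show ?thesis using mono[OF gate, of 4] by simp
    next
      case 2
      then show ?thesis using targ[of a'] a a' by (simp add: targ_def)
    next
      case 3
      then have "nr 0 (targ t a' n)" using root by (simp add: targ_def)
      from own[OF edge.targ[OF t a' order.refl] this, of 1] have "nr 1 (Mid t a' n)" by simp
      from other[OF edge.gate[OF t a' order.refl] this, of 4] show ?thesis by simp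
    qed
  qed
  have root4: "nr 4 Root" using root by (rule mono) simp
  have leg4: "nr 4 (Leg a i)" if "a < n" "i < 4" for a i
    using leg[OF that] that(2) by (elim mono) simp
  \<comment> \<open>This is what the orientation of the edges is for: with one end within
    \<open>4 * l\<close>, the whole path that replaces the edge lies within
    \<open>5 * l\<close>.\<close>
  have other4: "nr 4 x" if "edge z x y" for z x y
    using that by cases (auto simp: targ_def root4 leg4 gate_hub gate_hub(2)[OF _ n_pos[unfolded One_nat_def Suc_le_eq]])
  show "close C (5 * l) v" if "v \<in> {..<order}" for v
  proof -
    from that have "v < order" by simp
    then show ?thesis
    proof (cases rule: vertex_cases)
      case 1
      then obtain x where x: "valid x" "v = enc x" by (rule vertE)
      have "nr 5 x"
      proof (cases x)
        case (Mid t a a')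
        then have v: "t < T" "a < n" "a' \<le> n" using x by simp_all
        show ?thesis unfolding Mid by (rule own[OF edge.gate[OF v] gate_hub(1)[OF v(1,2)]]) simp
      next
        case (Tip t)
        then have v: "t < T" "0 < n" using x n_pos by simp_all
        show ?thesis unfolding Tip by (rule own[OF edge.tail[OF v(1)] gate_hub(2)[OF v]]) simp
      next
        case (Gate t a)
        then show ?thesis using gate_hub(1)[of t a, THEN mono, of 5] x by simp
      next
        case (Hub t)
        then show ?thesis using gate_hub(2)[of t 0, THEN mono, of 5] n_pos x by simp
      next
        case (Leg a i)
        then show ?thesis using leg4[of a i, THEN mono, of 5] x by simp
      next
        case Root
        then show ?thesis using root4[THEN mono, of 5] by simp
      qed
      then show ?thesis using x by (simp add: nr_def)
    next
      case (2 z p)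
      then obtain x y where e: "edge z x y" using edge_exists by blast
      have "close C (4 * l + p) (node z p)"
        using other4[OF e] edge_ends[OF e] 2 by (intro near_along_edge) (auto simp: nr_def)
      then show ?thesis unfolding 2(3) by (rule near_mono) (use 2 in simp)
    qed
  qed
qed

text \<open>
  The neighbours of a \<open>Mid\<close> vertex have odd potentials that differ by at most 2, so that their average
  is exact.
\<close>

fun pot0 :: "nat \<Rightarrow> vert \<Rightarrow> nat" where
  "pot0 t0 Root = 9"
| "pot0 t0 (Leg a i) = (if cov a t0 then 8 - i else 9)"
| "pot0 t0 (Tip t) = (if t = t0 then 0 else 9)"
| "pot0 t0 (Hub t) = (if t = t0 then 1 else 9)"
| "pot0 t0 (Gate t a) =
    (if \<not> cov a t then 9 else if t = t0 then 3 else if cov a t0 then 7 else 9)"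
| "pot0 t0 (Mid t a a') = 0"

fun pot :: "nat \<Rightarrow> vert \<Rightarrow> nat" where
  "pot t0 (Mid t a a') = (pot0 t0 (Gate t a) + pot0 t0 (targ t a a')) div 2"
| "pot t0 x = pot0 t0 x"

text \<open>The potential bounds the distance to \<open>Tip t0\<close> from below, capped at 9: it
  is 1 at the hub of \<open>t0\<close>, 3 at the gates and 5 to 8 along the legs of elements
  covering \<open>t0\<close>, whence 9 at the root. If such an element also covers another test, its
  gate there is two steps beyond its leg end and gets 7.\<close>

lemma pot_Lipschitz: "edge z x y \<Longrightarrow> pot t0 x \<le> pot t0 y + 1 \<and> pot t0 y \<le> pot t0 x + 1"
  by (erule edge.cases) (auto simp: targ_def)

text \<open>What a center at this vertex chooses: a test and up to two elements. \<open>T\<close>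
  stands for no test. Missing elements are filled in by repetition or by element 0, which only asks
  more of the test that has to escape.\<close>

fun label :: "vert \<Rightarrow> nat \<times> nat \<times> nat" where
  "label Root = (T, 0, 0)"
| "label (Leg a i) = (T, a, a)"
| "label (Tip t) = (t, 0, 0)"
| "label (Hub t) = (t, 0, 0)"
| "label (Gate t a) = (t, a, a)"
| "label (Mid t a a') = (t, a, if a' < n then a' else a)"

definition apart :: "nat \<Rightarrow> nat \<times> nat \<times> nat \<Rightarrow> bool" where
  "apart t0 = (\<lambda>(t, a, a'). t \<noteq> t0 \<and> \<not> cov a t0 \<and> \<not> cov a' t0)"

lemma pot_apart: "valid x \<Longrightarrow> apart t0 (label x) \<Longrightarrow> 9 \<le> pot t0 x"
  by (cases x) (auto simp: apart_def targ_def)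

text \<open>The label of the owner also controls the other end, so one label serves the whole path
  between them.\<close>

lemma pot_apart_other: "edge z x y \<Longrightarrow> apart t0 (label y) \<Longrightarrow> 9 \<le> pot t0 x"
  by (erule edge.cases) (auto simp: apart_def targ_def split: if_splits)

text \<open>The order of quantifiers matters: the label depends on \<open>v\<close> alone, since
  \<open>t0\<close> is picked only after the labels of all centers are known.\<close>

lemma exists_label:
  assumes "v < order"
  shows "\<exists>L. fst (snd L) < n \<and> snd (snd L) < n \<and>
     (\<forall>t0. apart t0 L \<longrightarrow> 9 * l \<le> ext (\<lambda>v. pot t0 (dec v)) v)"
proof -
  have label: "fst (snd (label x)) < n \<and> snd (snd (label x)) < n" if "valid x" for x
    using that n_pos by (cases x) auto
  show ?thesis
    using assms
  proof (cases rule: vertex_cases)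
    case 1
    then obtain x where x: "valid x" "v = enc x" by (rule vertE)
    show ?thesis
      using label[OF x(1)] pot_apart[OF x(1)] 1 dec_enc[OF x(1)] unfolding x
      by (intro exI[of _ "label x"]) (auto simp: ext_def)
  next
    case (2 z p)
    then obtain x y where e: "edge z x y" using edge_exists by blast
    note ends = edge_ends[OF e]
    have "9 * l \<le> ext (\<lambda>v. pot t0 (dec v)) v" if "apart t0 (label y)" for t0
    proof -
      have "l * 9 \<le> l * pot t0 x" "l * 9 \<le> l * pot t0 y"
        using pot_apart[OF ends(2) that] pot_apart_other[OF e that] by (intro mult_left_mono; simp)+
      moreover have "ext (\<lambda>v. pot t0 (dec v)) v = min (l * pot t0 x + p) (l * pot t0 y + (l - p))"
        using 2 ends pot_Lipschitz[OF e, of t0] by (simp add: ext_node dec_enc)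
      ultimately show ?thesis by linarith
    qed
    then show ?thesis using label[OF ends(2)] by blast
  qed
qed

text \<open>The labels of \<open>k\<close> centers name at most \<open>2 * k\<close> elements and
  \<open>k\<close> tests. For a test that avoids all of them, the potential is 0 at its tip and at
  least \<open>9 * l\<close> at every center.\<close>

theorem radius_ge:
  assumes escape: "\<And>A X. A \<subseteq> {..<n} \<Longrightarrow> card A \<le> 2 * k \<Longrightarrow> finite X \<Longrightarrow> card X \<le> k \<Longrightarrow>
     \<exists>t<T. t \<notin> X \<and> (\<forall>a\<in>A. \<not> cov a t)"
  shows "enat (9 * l) \<le> radius k"
proof (rule k_radius_ge_potential)
  fix C :: "nat set" assume C: "C \<subseteq> {..<order}" "card C = k"
  then have fin: "finite C" using finite_subset by blast
  have "\<forall>c\<in>C. \<exists>L. fst (snd L) < n \<and> snd (snd L) < n \<and>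
     (\<forall>t0. apart t0 L \<longrightarrow> 9 * l \<le> ext (\<lambda>v. pot t0 (dec v)) c)"
    using C(1) exists_label by (metis lessThan_iff subsetD)
  then obtain L where L: "\<And>c. c \<in> C \<Longrightarrow> fst (snd (L c)) < n" "\<And>c. c \<in> C \<Longrightarrow> snd (snd (L c)) < n"
    "\<And>c t0. c \<in> C \<Longrightarrow> apart t0 (L c) \<Longrightarrow> 9 * l \<le> ext (\<lambda>v. pot t0 (dec v)) c"
    by metis
  define A where "A = (\<lambda>c. fst (snd (L c))) ` C \<union> (\<lambda>c. snd (snd (L c))) ` C"
  have "card A \<le> card C + card C"
    unfolding A_def using fin by (intro order.trans[OF card_Un_le] add_mono card_image_le)
  then have "\<exists>t<T. t \<notin> (fst \<circ> L) ` C \<and> (\<forall>a\<in>A. \<not> cov a t)"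
    using L(1,2) C(2) fin card_image_le[OF fin, of "fst \<circ> L"] by (intro escape) (auto simp: A_def)
  then obtain t0 where t0: "t0 < T" "t0 \<notin> (fst \<circ> L) ` C" "\<And>a. a \<in> A \<Longrightarrow> \<not> cov a t0"
    by blast
  have apart: "apart t0 (L c)" if "c \<in> C" for c
    using that t0(2) t0(3)[of "fst (snd (L c))"] t0(3)[of "snd (snd (L c))"]
    by (auto simp: apart_def A_def case_prod_unfold)
  let ?h = "ext (\<lambda>v. pot t0 (dec v))"
  show "\<exists>v\<in>{..<order}. \<exists>h. h v = 0 \<and> (\<forall>u w. {u, w} \<in> edges_of edge_list \<longrightarrow> h w \<le> h u + 1) \<and>
     (\<forall>c\<in>C. 9 * l \<le> h c)"
  proof (intro bexI exI conjI allI impI ballI)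
    have "valid (Tip t0)" using t0(1) by simp
    from enc_less[OF this] dec_enc[OF this] verts_le_order
    show "?h (enc (Tip t0)) = 0" "enc (Tip t0) \<in> {..<order}" by (auto simp: ext_def)
    show "?h w \<le> ?h u + 1" if "{u, w} \<in> edges_of edge_list" for u w
    proof (rule ext_Lipschitz[OF _ that])
      fix z assume "z < edges"
      then obtain x y where e: "edge z x y" using edge_exists by blast
      show "pot t0 (dec (other z)) \<le> pot t0 (dec (own z)) + 1 \<and>
          pot t0 (dec (own z)) \<le> pot t0 (dec (other z)) + 1"
        using pot_Lipschitz[OF e] edge_ends[OF e] by (simp add: dec_enc)
    qed
    show "9 * l \<le> ?h c" if "c \<in> C" for c using L(3) apart that by blast
  qed
qed

end

section \<open>Tests for satisfiability\<close>

lemma digit_add_multiple: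
  fixes t r R :: nat
  assumes "i < k" shows "(t + r * R ^ k) div R ^ i mod R = t div R ^ i mod R"
proof (cases "R = 0")
  case False
  obtain j where k: "k = i + Suc j" using assms less_iff_Suc_add by auto
  have "(t + r * R ^ k) div R ^ i = t div R ^ i + r * R ^ Suc j"
    using False div_mult_self2[of "R ^ i" t "r * R ^ Suc j"] by (simp add: k power_add mult_ac)
  then show ?thesis by (simp add: mult.left_commute[of r R])
qed (use assms in \<open>auto simp: power_0_left\<close>)

text \<open>Functions into \<open>{..<R}\<close> are coded by the digits of a number: slot choices
  for the blocks, families of clauses and, with \<open>R = 2\<close>, assignments.\<close>

lemma exists_digits:
  fixes d :: "nat \<Rightarrow> nat"
  assumes "\<And>i. i < k \<Longrightarrow> d i < R"
  shows "\<exists>t < R ^ k. \<forall>i<k. t div R ^ i mod R = d i"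
  using assms
proof (induction k)
  case (Suc k)
  then obtain t where t: "t < R ^ k" "\<And>i. i < k \<Longrightarrow> t div R ^ i mod R = d i" by fastforce
  have "d k * R ^ k + t < R * R ^ k" using Suc.prems[of k] t(1) by (intro radix_less) auto
  moreover have "(t + d k * R ^ k) div R ^ i mod R = d i" if "i < Suc k" for i
  proof (cases "i = k")
    case True
    then show ?thesis using t(1) Suc.prems[of k] radix_div_mod[OF t(1), of "d k"] by (simp add: add.commute)
  next
    case False
    then show ?thesis using that t(2)[of i] by (simp add: digit_add_multiple)
  qed
  ultimately show ?case by (intro exI[of _ "t + d k * R ^ k"]) (simp add: add.commute)
qed simp

definition part_sat :: "nat \<Rightarrow> nat \<Rightarrow> nat \<Rightarrow> (nat \<times> bool) list \<Rightarrow> bool" where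
  "part_sat b i x C \<longleftrightarrow> (\<exists>(v, s)\<in>set C. v div b = i \<and> odd (x div 2 ^ (v mod b)) = s)"

text \<open>An element \<open>a\<close> is a block \<open>a div 2 ^ b\<close> with an assignment
  \<open>a mod 2 ^ b\<close> of its variables. The digits of \<open>c\<close> map blocks to slots,
  and the digits of \<open>t\<close> map every such \<open>c\<close> to a clause. Further digits of
  \<open>t\<close> are ignored, which provides the copies of a test.\<close>

definition covers :: "cnf \<Rightarrow> nat \<Rightarrow> nat \<Rightarrow> nat \<Rightarrow> nat \<Rightarrow> nat \<Rightarrow> bool" where
  "covers F b R k a t \<longleftrightarrow> (\<forall>e<R. \<exists>c < R ^ k. c div R ^ (a div 2 ^ b) mod R = e \<and>
     part_sat b (a div 2 ^ b) (a mod 2 ^ b) (F ! (t div length F ^ c mod length F)))"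

text \<open>\<open>A\<close> consists of the restrictions of a satisfying assignment to the blocks.
  If each of them failed the test in some slot \<open>e i\<close>, these slots would be the digits
  of some \<open>c\<close>. But the clause of \<open>c\<close> has a satisfied literal in some block
  \<open>i\<close>, so the restriction to that block does not fail in slot
  \<open>e i\<close>.\<close>

lemma covers_of_satisfiable:
  assumes sat: "satisfiable F" and vars: "\<And>C v s. C \<in> set F \<Longrightarrow> (v, s) \<in> set C \<Longrightarrow> v < k * b"
  shows "\<exists>A \<subseteq> {..<k * 2 ^ b}. card A = k \<and> (\<forall>t. F \<noteq> [] \<longrightarrow> (\<exists>a\<in>A. covers F b R k a t))"
proof -
  obtain \<sigma> :: "nat \<Rightarrow> bool" where \<sigma>: "\<And>C. C \<in> set F \<Longrightarrow> \<exists>(v, s)\<in>set C. \<sigma> v = s"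
    using sat unfolding satisfiable_def by blast
  have "\<exists>x < (2::nat) ^ b. \<forall>j<b. x div 2 ^ j mod 2 = of_bool (\<sigma> (i * b + j))" for i
    by (rule exists_digits) simp
  then have "\<forall>i. \<exists>x. x < (2::nat) ^ b \<and> (\<forall>j<b. x div 2 ^ j mod 2 = of_bool (\<sigma> (i * b + j)))" by blast
  from choice[OF this] obtain x where x: "\<And>i. x i < (2::nat) ^ b" "\<And>i j. j < b \<Longrightarrow> x i div 2 ^ j mod 2 = of_bool (\<sigma> (i * b + j))"
    by blast
  define a where "a i = i * 2 ^ b + x i" for i
  have a: "a i div 2 ^ b = i" "a i mod 2 ^ b = x i" for i
    unfolding a_def using x(1) by (simp_all add: radix_div_mod)
  have "inj_on a {..<k}" by (rule inj_onI) (metis a(1))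
  moreover have "a i < k * 2 ^ b" if "i < k" for i
    unfolding a_def using that x(1) by (rule radix_less)
  moreover have "\<exists>i<k. covers F b R k (a i) t" if "F \<noteq> []" for t
  proof (rule ccontr)
    assume no: "\<not> ?thesis"
    let ?C = "\<lambda>c. F ! (t div length F ^ c mod length F)"
    have "\<forall>i. \<exists>e. i < k \<longrightarrow> e < R \<and> (\<forall>c < R ^ k. c div R ^ i mod R = e \<longrightarrow> \<not> part_sat b i (x i) (?C c))"
      using no unfolding covers_def a by blast
    from choice[OF this] obtain e where e: "\<And>i. i < k \<Longrightarrow> e i < R"
      "\<And>i c. i < k \<Longrightarrow> c < R ^ k \<Longrightarrow> c div R ^ i mod R = e i \<Longrightarrow> \<not> part_sat b i (x i) (?C c)"
      by blast
    obtain c where c: "c < R ^ k" "\<And>i. i < k \<Longrightarrow> c div R ^ i mod R = e i"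
      using exists_digits[of k e R] e(1) by blast
    have mem: "?C c \<in> set F" using that by simp
    then obtain v s where v: "(v, s) \<in> set (?C c)" "\<sigma> v = s" using \<sigma> by blast
    then have "v < k * b" using vars mem by blast
    then have "b > 0" "v div b < k" by (auto simp: less_mult_imp_div_less intro!: Nat.gr0I)
    then have "x (v div b) div 2 ^ (v mod b) mod 2 = of_bool s" using x(2)[of "v mod b" "v div b"] v(2) by simp
    then have "part_sat b (v div b) (x (v div b)) (?C c)"
      unfolding part_sat_def using v(1) by (intro bexI[of _ "(v, s)"]) (auto simp: odd_iff_mod_2_eq_one split: if_splits)
    then show False using e(2)[OF \<open>v div b < k\<close> c(1) c(2)[OF \<open>v div b < k\<close>]] by blast
  qed
  ultimately show ?thesis
    by (intro exI[of _ "a ` {..<k}"]) (auto simp: card_image)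
qed

text \<open>The slots enumerate \<open>A\<close>. For every \<open>c\<close>, the assignment that
  takes block \<open>i\<close> from the element in slot \<open>c i\<close> falsifies some clause,
  and the test consists of these clauses. A literal satisfied by an element of block
  \<open>i\<close> in slot \<open>e\<close> would be true under the assignments of all
  \<open>c\<close> with \<open>c i = e\<close>, so the element fails in its own slot. One of the
  \<open>r\<close> copies of the test avoids \<open>X\<close>.\<close>

lemma escape_of_unsatisfiable:
  assumes unsat: "\<not> satisfiable F" and "finite A" "card A \<le> R" "finite X" "card X < r"
  shows "\<exists>t < length F ^ (R ^ k) * r. t \<notin> X \<and>
     (\<forall>a\<in>A. a div 2 ^ b < k \<longrightarrow> \<not> covers F b R k a t)"
proof -
  define M where "M = length F"
  define u where "u = (\<lambda>e. sorted_list_of_set A ! e)"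
  have u: "\<exists>e<R. u e = a" if "a \<in> A" for a
  proof -
    have "a \<in> set (sorted_list_of_set A)" using that assms(2) by simp
    then obtain e where "e < length (sorted_list_of_set A)" "u e = a" by (auto simp: in_set_conv_nth u_def)
    then show ?thesis using assms(3) by (intro exI[of _ e]) auto
  qed
  \<comment> \<open>The element in a slot lends its bits to whatever block asks for them, even to
    one that it does not belong to. Slots beyond the size of \<open>A\<close> hold unspecified
    numbers; this is harmless, as every assignment falsifies a clause.\<close>
  define \<sigma> where "\<sigma> = (\<lambda>c v. odd (u (c div R ^ (v div b) mod R) mod 2 ^ b div 2 ^ (v mod b)))"
  have "\<exists>j<M. \<forall>(v, s)\<in>set (F ! j). \<sigma> c v \<noteq> s" for c
  proof -
    have "\<not> (\<forall>C\<in>set F. \<exists>(v, s)\<in>set C. \<sigma> c v = s)" using unsat unfolding satisfiable_def by blast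
    then obtain C where "C \<in> set F" "\<forall>(v, s)\<in>set C. \<sigma> c v \<noteq> s" by blast
    then show ?thesis unfolding M_def in_set_conv_nth by blast
  qed
  then have "\<forall>c. \<exists>j. j < M \<and> (\<forall>v s. (v, s) \<in> set (F ! j) \<longrightarrow> \<sigma> c v \<noteq> s)" by fast
  then obtain j where j: "\<And>c. j c < M" "\<And>c v s. (v, s) \<in> set (F ! j c) \<Longrightarrow> \<sigma> c v \<noteq> s"
    by (auto dest!: choice)
  obtain t where t: "t < M ^ (R ^ k)" "\<And>c. c < R ^ k \<Longrightarrow> t div M ^ c mod M = j c"
    using exists_digits[of "R ^ k" j M] j(1) by blast
  have "\<not> (\<lambda>i. t + i * M ^ (R ^ k)) ` {..<r} \<subseteq> X"
  proof
    assume "(\<lambda>i. t + i * M ^ (R ^ k)) ` {..<r} \<subseteq> X"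
    then have "card ((\<lambda>i. t + i * M ^ (R ^ k)) ` {..<r}) \<le> card X" using assms(4) by (rule card_mono[rotated])
    moreover have "inj_on (\<lambda>i. t + i * M ^ (R ^ k)) {..<r}" using t(1) by (cases "M ^ (R ^ k) = 0") (auto simp: inj_on_def)
    ultimately show False using assms(5) by (simp add: card_image)
  qed
  then obtain i where i: "i < r" "t + i * M ^ (R ^ k) \<notin> X" by blast
  define t' where "t' = t + i * M ^ (R ^ k)"
  have digits: "t' div M ^ c mod M = j c" if "c < R ^ k" for c
    unfolding t'_def using that t(2) by (simp add: digit_add_multiple)
  have "\<not> covers F b R k a t'" if a: "a \<in> A" "a div 2 ^ b < k" for a
  proof -
    obtain e where e: "e < R" "u e = a" using u[OF a(1)] by blast
    have "\<not> part_sat b (a div 2 ^ b) (a mod 2 ^ b) (F ! j c)" if "c div R ^ (a div 2 ^ b) mod R = e" for c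
    proof
      assume "part_sat b (a div 2 ^ b) (a mod 2 ^ b) (F ! j c)"
      then obtain v s where v: "(v, s) \<in> set (F ! j c)" "v div b = a div 2 ^ b"
        "odd (a mod 2 ^ b div 2 ^ (v mod b)) = s" unfolding part_sat_def by blast
      then have "\<sigma> c v = s" using that e(2) by (simp add: \<sigma>_def)
      then show False using j(2) v(1) by blast
    qed
    then have "\<not> (\<exists>c < R ^ k. c div R ^ (a div 2 ^ b) mod R = e \<and>
        part_sat b (a div 2 ^ b) (a mod 2 ^ b) (F ! (t' div M ^ c mod M)))"
      using digits by auto
    then show ?thesis using e(1) unfolding covers_def M_def by blast
  qed
  moreover have "t' < M ^ (R ^ k) * r"
    using radix_less[OF i(1) t(1)] unfolding t'_def by (simp add: algebra_simps)
  ultimately show ?thesis using i(2) unfolding t'_def M_def by blast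
qed

section \<open>Compiling expressions to the word-RAM\<close>

abbreviation cfg :: "nat \<Rightarrow> (nat \<Rightarrow> nat) \<Rightarrow> (nat \<Rightarrow> nat) \<Rightarrow> config" where
  "cfg p R M \<equiv> \<lparr>pc = p, regs = R, mem = M\<rparr>"

section \<open>Bounded runs and jump-free code\<close>

definition reach :: "nat \<Rightarrow> instr list \<Rightarrow> nat \<Rightarrow> config \<Rightarrow> config \<Rightarrow> bool" where
  "reach w P t s s' \<longleftrightarrow> (\<exists>n\<le>t. (step w P ^^ n) s = s')"

lemma reach_refl: "reach w P t s s"
  unfolding reach_def by (intro exI[of _ 0]) simp

lemma reach_trans: "reach w P t s s' \<Longrightarrow> reach w P u s' s'' \<Longrightarrow> reach w P (t + u) s s''"
proof -
  assume "reach w P t s s'" "reach w P u s' s''"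
  then obtain n n' where "n \<le> t" "(step w P ^^ n) s = s'" "n' \<le> u" "(step w P ^^ n') s' = s''"
    unfolding reach_def by blast
  then show ?thesis
    unfolding reach_def by (intro exI[of _ "n' + n"]) (simp add: funpow_add)
qed

lemma reach_mono: "reach w P t s s' \<Longrightarrow> t \<le> u \<Longrightarrow> reach w P u s s'"
  unfolding reach_def using le_trans by blast

definition code_at :: "instr list \<Rightarrow> nat \<Rightarrow> instr list \<Rightarrow> bool" where
  "code_at P p c \<longleftrightarrow> (\<exists>as bs. P = as @ c @ bs \<and> length as = p)"

lemma code_at_append: "code_at P p (c @ c') \<longleftrightarrow> code_at P p c \<and> code_at P (p + length c) c'"
proof
  assume "code_at P p (c @ c')"
  then obtain as bs where P: "P = as @ c @ c' @ bs" "length as = p" by (auto simp: code_at_def)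
  then show "code_at P p c \<and> code_at P (p + length c) c'"
    unfolding code_at_def by (metis append_assoc length_append)
next
  assume "code_at P p c \<and> code_at P (p + length c) c'"
  then obtain as bs as' bs' where P: "P = as @ c @ bs" "length as = p"
    "P = as' @ c' @ bs'" "length as' = p + length c" unfolding code_at_def by blast
  then have "(as @ c) @ bs = as' @ (c' @ bs')" "length (as @ c) = length as'" by auto
  then have "bs = c' @ bs'" using append_eq_append_conv by blast
  then show "code_at P p (c @ c')" using P unfolding code_at_def by auto
qed

lemma code_at_Cons: "code_at P p (i # c) \<longleftrightarrow> code_at P p [i] \<and> code_at P (Suc p) c"
  using code_at_append[of P p "[i]" c] by simp

lemma code_at_nth: "code_at P p [i] \<Longrightarrow> p < length P \<and> P ! p = i"
  by (auto simp: code_at_def)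

lemma reach_instr:
  assumes "code_at P p [i]" "i \<noteq> Halt" "reach w P t (exec_instr w i (cfg p R M)) s"
  shows "reach w P (Suc t) (cfg p R M) s"
proof -
  have "step w P (cfg p R M) = exec_instr w i (cfg p R M)"
    using code_at_nth[OF assms(1)] assms(2) by (simp add: step_def halted_def)
  then have "reach w P 1 (cfg p R M) (exec_instr w i (cfg p R M))"
    unfolding reach_def by (intro exI[of _ 1]) simp
  from reach_trans[OF this assms(3)] show ?thesis by simp
qed

fun straight :: "instr \<Rightarrow> bool" where
  "straight (JumpIfZero a l) \<longleftrightarrow> False"
| "straight Halt \<longleftrightarrow> False"
| "straight _ \<longleftrightarrow> True"

fun exec_regs :: "nat \<Rightarrow> instr \<Rightarrow> (nat \<Rightarrow> nat) \<times> (nat \<Rightarrow> nat) \<Rightarrow> (nat \<Rightarrow> nat) \<times> (nat \<Rightarrow> nat)" where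
  "exec_regs w (Const d x) (R, M) = (R(d := x mod 2 ^ w), M)"
| "exec_regs w (Alu f d a b) (R, M) = (R(d := alu w f (R a) (R b)), M)"
| "exec_regs w (Load d a) (R, M) = (R(d := M (R a)), M)"
| "exec_regs w (Store a b) (R, M) = (R, M(R a := R b))"
| "exec_regs w _ s = s"

lemma reach_straight:
  assumes "code_at P p c" "\<forall>i\<in>set c. straight i"
  shows "reach w P (length c) (cfg p R M)
    (cfg (p + length c) (fst (fold (exec_regs w) c (R, M))) (snd (fold (exec_regs w) c (R, M))))"
  using assms
proof (induction c arbitrary: p R M)
  case Nil
  then show ?case by (simp add: reach_refl)
next
  case (Cons i c)
  have "code_at P p [i]" and c: "code_at P (Suc p) c" using Cons.prems(1) by (metis code_at_Cons)+
  obtain R' M' where RM: "exec_regs w i (R, M) = (R', M')" by fastforce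
  have "exec_instr w i (cfg p R M) = cfg (Suc p) R' M'" "i \<noteq> Halt"
    using Cons.prems(2) RM by (cases i; auto)+
  moreover have "reach w P (length c) (cfg (Suc p) R' M')
      (cfg (Suc p + length c) (fst (fold (exec_regs w) c (R', M'))) (snd (fold (exec_regs w) c (R', M'))))"
    using Cons.IH[OF c] Cons.prems(2) by simp
  ultimately show ?case using reach_instr[OF \<open>code_at P p [i]\<close>] RM by simp
qed

lemma reach_block:
  assumes "code_at P p c" "\<forall>i\<in>set c. straight i" "fold (exec_regs w) c (R, M) = (R', M')"
    "t = length c" "p' = p + length c"
  shows "reach w P t (cfg p R M) (cfg p' R' M')"
  using reach_straight[OF assms(1,2), of w R M] assms(3-) by simp

text \<open>
  Odd registers hold the data of the reduction, the even register \<open>2 * r\<close> holds register \<open>r\<close> of the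
  simulated program.
\<close>

abbreviation (input) "rB \<equiv> (3::nat)"
abbreviation (input) "rW \<equiv> (5::nat)"
abbreviation (input) "rZ \<equiv> (7::nat)"
abbreviation (input) "rL \<equiv> (9::nat)"
abbreviation (input) "rA \<equiv> (11::nat)"

definition rx :: "nat \<Rightarrow> nat" where "rx i = 2 * i + 13"

text \<open>
  Variables are de Bruijn levels.  \<open>Get\<close> reduces the address and \<open>Loop\<close> the number of iterations modulo
  the contents of \<open>rB\<close>: this makes reads independent of the memory from that address on, and it
  makes the running time of every expression polynomial in that number.
  As in \<open>LetIn\<close>, the second argument of \<open>Op\<close> sees the value of the first one as a new variable.
  In \<open>Loop c i e\<close> the body \<open>e\<close> sees three new variables: iteration count, accumulator, index; the
  initial value \<open>i\<close> only sees the first one.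
\<close>

datatype exp = Lit nat | Var nat | Op alu_op exp exp | Get exp | Ite exp exp exp | LetIn exp exp
  | Loop exp exp exp

fun eval :: "nat \<Rightarrow> nat \<Rightarrow> (nat \<Rightarrow> nat) \<Rightarrow> exp \<Rightarrow> nat list \<Rightarrow> nat" where
  "eval w B M (Lit x) env = x mod 2 ^ w"
| "eval w B M (Var i) env = env ! i"
| "eval w B M (Op f a b) env = (let x = eval w B M a env in alu w f x (eval w B M b (env @ [x])))"
| "eval w B M (Get a) env = M (eval w B M a env mod B)"
| "eval w B M (Ite c a b) env = (if eval w B M c env \<noteq> 0 then eval w B M a env else eval w B M b env)"
| "eval w B M (LetIn a b) env = eval w B M b (env @ [eval w B M a env])"
| "eval w B M (Loop c i e) env = (let n = eval w B M c env mod B in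
     rec_nat (eval w B M i (env @ [n])) (\<lambda>j x. eval w B M e (env @ [n, x, j])) n)"

fun wf_exp :: "nat \<Rightarrow> exp \<Rightarrow> bool" where
  "wf_exp d (Lit x) \<longleftrightarrow> True"
| "wf_exp d (Var i) \<longleftrightarrow> i < d"
| "wf_exp d (Op f a b) \<longleftrightarrow> wf_exp d a \<and> wf_exp (d + 1) b"
| "wf_exp d (Get a) \<longleftrightarrow> wf_exp d a"
| "wf_exp d (Ite c a b) \<longleftrightarrow> wf_exp d c \<and> wf_exp d a \<and> wf_exp d b"
| "wf_exp d (LetIn a b) \<longleftrightarrow> wf_exp d a \<and> wf_exp (d + 1) b"
| "wf_exp d (Loop c i e) \<longleftrightarrow> wf_exp d c \<and> wf_exp (d + 1) i \<and> wf_exp (d + 3) e"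

text \<open>The code is meant for the absolute address \<open>p\<close>; it leaves the value in
  \<open>rx d\<close> and overwrites only \<open>rZ\<close> and registers \<open>rx j\<close> with
  \<open>d \<le> j\<close>. A register is copied by \<open>OpOr\<close> with itself, and an
  unconditional jump tests \<open>rZ\<close> after setting it to 0.\<close>

fun compile :: "nat \<Rightarrow> nat \<Rightarrow> exp \<Rightarrow> instr list" where
  "compile d p (Lit x) = [Const (rx d) x]"
| "compile d p (Var i) = [Alu OpOr (rx d) (rx i) (rx i)]"
| "compile d p (Op f a b) = (let ca = compile d p a; cb = compile (d + 1) (p + length ca) b in
     ca @ cb @ [Alu f (rx d) (rx d) (rx (d + 1))])"
| "compile d p (Get a) = compile d p a @ [Alu OpMod (rx d) (rx d) rB, Load (rx d) (rx d)]"
| "compile d p (Ite c a b) = (let cc = compile d p c; p1 = p + length cc;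
     ca = compile d (p1 + 1) a; p2 = p1 + 1 + length ca + 2; cb = compile d p2 b in
     cc @ JumpIfZero (rx d) p2 # ca @ [Const rZ 0, JumpIfZero rZ (p2 + length cb)] @ cb)"
| "compile d p (LetIn a b) = (let ca = compile d p a; cb = compile (d + 1) (p + length ca) b in
     ca @ cb @ [Alu OpOr (rx d) (rx (d + 1)) (rx (d + 1))])"
| "compile d p (Loop c i e) = (let cc = compile d p c; ci = compile (d + 1) (p + length cc + 1) i;
     p1 = p + length cc + 1 + length ci + 1; ce = compile (d + 3) (p1 + 2) e;
     p2 = p1 + 2 + length ce + 5 in
     cc @ [Alu OpMod (rx d) (rx d) rB] @ ci @ [Const (rx (d + 2)) 0] @
     [Alu OpLess rZ (rx (d + 2)) (rx d), JumpIfZero rZ p2] @ ce @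
     [Alu OpOr (rx (d + 1)) (rx (d + 3)) (rx (d + 3)), Const rZ 1,
      Alu OpAdd (rx (d + 2)) (rx (d + 2)) rZ, Const rZ 0, JumpIfZero rZ p1] @
     [Alu OpOr (rx d) (rx (d + 1)) (rx (d + 1))])"

fun cost :: "nat \<Rightarrow> exp \<Rightarrow> nat" where
  "cost B (Lit x) = 1"
| "cost B (Var i) = 1"
| "cost B (Op f a b) = cost B a + cost B b + 1"
| "cost B (Get a) = cost B a + 2"
| "cost B (Ite c a b) = cost B c + cost B a + cost B b + 3"
| "cost B (LetIn a b) = cost B a + cost B b + 1"
| "cost B (Loop c i e) = cost B c + cost B i + B * (cost B e + 7) + 5"

definition env_ok :: "nat \<Rightarrow> nat list \<Rightarrow> (nat \<Rightarrow> nat) \<Rightarrow> bool" where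
  "env_ok B env R \<longleftrightarrow> R rB = B \<and> (\<forall>i<length env. R (rx i) = env ! i)"

definition frame :: "nat \<Rightarrow> (nat \<Rightarrow> nat) \<Rightarrow> (nat \<Rightarrow> nat) \<Rightarrow> bool" where
  "frame d R R' \<longleftrightarrow> (\<forall>r. r \<noteq> rZ \<and> (\<forall>j\<ge>d. r \<noteq> rx j) \<longrightarrow> R' r = R r)"

lemma rx_neq [simp]: "rx i \<noteq> rZ" "rx i \<noteq> rB" "rB \<noteq> rx i" "rZ \<noteq> rx i" "rx i = rx j \<longleftrightarrow> i = j"
  by (auto simp: rx_def)

lemma frameD: "frame d R R' \<Longrightarrow> i < d \<Longrightarrow> R' (rx i) = R (rx i)" "frame d R R' \<Longrightarrow> R' rB = R rB"
  by (auto simp: frame_def)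

lemma frame_refl: "frame d R R" by (simp add: frame_def)

lemma frame_trans: "frame d R R' \<Longrightarrow> frame d' R' R'' \<Longrightarrow> d \<le> d' \<Longrightarrow> frame d R R''"
  by (auto simp: frame_def)

lemma frame_upd: "frame d R R' \<Longrightarrow> d \<le> i \<Longrightarrow> frame d R (R'(rx i := v))"
  "frame d R R' \<Longrightarrow> frame d R (R'(rZ := v))"
  by (auto simp: frame_def)

lemma env_ok_frame: "env_ok B env R \<Longrightarrow> frame d R R' \<Longrightarrow> length env \<le> d \<Longrightarrow> env_ok B env R'"
  by (auto simp: env_ok_def frameD)

lemma env_ok_snoc: "env_ok B (env @ [v]) R \<longleftrightarrow> env_ok B env R \<and> R (rx (length env)) = v"
  by (auto simp: env_ok_def nth_append less_Suc_eq)

lemma env_ok_upd: "env_ok B env R \<Longrightarrow> length env \<le> i \<Longrightarrow> env_ok B env (R(rx i := v))"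
  "env_ok B env R \<Longrightarrow> env_ok B env (R(rZ := v))"
  by (auto simp: env_ok_def)

definition computes :: "nat \<Rightarrow> nat \<Rightarrow> (nat \<Rightarrow> nat) \<Rightarrow> instr list \<Rightarrow> nat \<Rightarrow> exp \<Rightarrow> nat list \<Rightarrow> (nat \<Rightarrow> nat) \<Rightarrow> bool" where
  "computes w B M P p e env R \<longleftrightarrow> (\<exists>R'. reach w P (cost B e) (cfg p R M)
       (cfg (p + length (compile (length env) p e)) R' M) \<and>
     R' (rx (length env)) = eval w B M e env \<and> frame (length env) R R')"

text \<open>The common part of \<open>Op\<close> and \<open>LetIn\<close>: the first value stays in
  its register and is a variable of the second expression.\<close>

lemma computes_two:
  assumes "computes w B M P p a env R" "env_ok B env R"
    and "\<And>R\<^sub>1. env_ok B (env @ [eval w B M a env]) R\<^sub>1 \<Longrightarrow>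
      computes w B M P (p + length (compile (length env) p a)) b (env @ [eval w B M a env]) R\<^sub>1"
  defines "q \<equiv> p + length (compile (length env) p a)"
  shows "\<exists>R'. reach w P (cost B a + cost B b) (cfg p R M)
      (cfg (q + length (compile (length env + 1) q b)) R' M) \<and> R' (rx (length env)) = eval w B M a env \<and>
      R' (rx (length env + 1)) = eval w B M b (env @ [eval w B M a env]) \<and> frame (length env) R R'"
proof -
  let ?d = "length env" and ?x = "eval w B M a env"
  obtain R1 where R1: "reach w P (cost B a) (cfg p R M) (cfg q R1 M)" "R1 (rx ?d) = ?x" "frame ?d R R1"
    using assms(1) unfolding computes_def q_def by blast
  then have "env_ok B (env @ [?x]) R1" using assms(2) by (simp add: env_ok_snoc env_ok_frame)
  from assms(3)[OF this] obtain R2 where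
    R2: "reach w P (cost B b) (cfg q R1 M) (cfg (q + length (compile (?d + 1) q b)) R2 M)"
    "R2 (rx (?d + 1)) = eval w B M b (env @ [?x])" "frame (?d + 1) R1 R2"
    unfolding computes_def q_def by auto
  have "R2 (rx ?d) = ?x" using R1(2) frameD(1)[OF R2(3)] by simp
  then show ?thesis using reach_trans[OF R1(1) R2(1)] R2(2) frame_trans[OF R1(3) R2(3)] by auto
qed

lemma compile_correct:
  assumes B: "0 < B" "B < 2 ^ w"
    and "code_at P p (compile (length env) p e)" "wf_exp (length env) e" "env_ok B env R"
  shows "computes w B M P p e env R"
  using assms(3-)
proof (induction e arbitrary: p env R)
  case (Lit x)
  have "reach w P 1 (cfg p R M) (cfg (p + 1) (R(rx (length env) := x mod 2 ^ w)) M)"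
    using reach_straight[OF Lit(1), of w R M] by simp
  then show ?case
    unfolding computes_def by (intro exI[of _ "R(rx (length env) := x mod 2 ^ w)"]) (simp add: frame_upd frame_refl)
next
  case (Var i)
  have "reach w P 1 (cfg p R M) (cfg (p + 1) (R(rx (length env) := R (rx i))) M)"
    using reach_straight[OF Var(1), of w R M] by simp
  moreover have "R (rx i) = env ! i" using Var by (simp add: env_ok_def)
  ultimately show ?case
    unfolding computes_def by (intro exI[of _ "R(rx (length env) := R (rx i))"]) (simp add: frame_upd frame_refl)
next
  case (Op f a b)
  let ?d = "length env"
  define ca where "ca = compile ?d p a"
  define cb where "cb = compile (?d + 1) (p + length ca) b"
  have code: "code_at P p ca" "code_at P (p + length ca) cb" "code_at P (p + length ca + length cb) [Alu f (rx ?d) (rx ?d) (rx (?d + 1))]"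
    using Op.prems(1) by (simp_all add: Let_def code_at_append ca_def cb_def add.assoc)
  obtain R2 where R2: "reach w P (cost B a + cost B b) (cfg p R M) (cfg (p + length ca + length cb) R2 M)"
    "R2 (rx ?d) = eval w B M a env" "R2 (rx (?d + 1)) = eval w B M b (env @ [eval w B M a env])" "frame ?d R R2"
    using computes_two[OF Op.IH(1) Op.prems(3) Op.IH(2)] Op.prems code(1,2) unfolding ca_def cb_def by auto
  let ?R = "R2(rx ?d := alu w f (R2 (rx ?d)) (R2 (rx (?d + 1))))"
  have "reach w P 1 (cfg (p + length ca + length cb) R2 M) (cfg (p + length ca + length cb + 1) ?R M)"
    using reach_straight[OF code(3), of w R2 M] by simp
  from reach_trans[OF R2(1) this] show ?case
    using R2(2-) unfolding computes_def
    by (intro exI[of _ ?R]) (simp add: Let_def ca_def cb_def add.assoc frame_upd)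
next
  case (Get a)
  let ?d = "length env"
  define ca where "ca = compile ?d p a"
  have code: "code_at P p ca" "code_at P (p + length ca) [Alu OpMod (rx ?d) (rx ?d) rB, Load (rx ?d) (rx ?d)]"
    using Get.prems(1) by (simp_all add: code_at_append ca_def)
  obtain R1 where R1: "reach w P (cost B a) (cfg p R M) (cfg (p + length ca) R1 M)"
    "R1 (rx ?d) = eval w B M a env" "frame ?d R R1"
    using Get.IH[of p env R] Get.prems code(1) unfolding computes_def ca_def by auto
  let ?R = "R1(rx ?d := M (R1 (rx ?d) mod B))"
  have "R1 rB = B" using Get.prems(3) frameD(2)[OF R1(3)] by (simp add: env_ok_def)
  then have "reach w P 2 (cfg (p + length ca) R1 M) (cfg (p + length ca + 2) ?R M)"
    using reach_straight[OF code(2), of w R1 M] by (simp add: numeral_2_eq_2)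
  from reach_trans[OF R1(1) this] show ?case
    using R1(2,3) unfolding computes_def
    by (intro exI[of _ ?R]) (simp add: ca_def add.assoc frame_upd)
next
  case (Ite c a b)
  let ?d = "length env"
  define cc where "cc = compile ?d p c"
  define p1 where "p1 = p + length cc"
  define ca where "ca = compile ?d (p1 + 1) a"
  define p2 where "p2 = p1 + 1 + length ca + 2"
  define cb where "cb = compile ?d p2 b"
  have all: "compile ?d p (Ite c a b) =
      cc @ [JumpIfZero (rx ?d) p2] @ ca @ [Const rZ 0] @ [JumpIfZero rZ (p2 + length cb)] @ cb"
    by (simp add: Let_def cc_def p1_def ca_def p2_def cb_def)
  have code: "code_at P p cc" "code_at P p1 [JumpIfZero (rx ?d) p2]" "code_at P (p1 + 1) ca"
    "code_at P (p1 + 1 + length ca) [Const rZ 0]"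
    "code_at P (p1 + 1 + length ca + 1) [JumpIfZero rZ (p2 + length cb)]" "code_at P p2 cb"
    using Ite.prems(1) unfolding all code_at_append
    by (simp_all add: p1_def p2_def numeral_eq_Suc)
  have len: "p + length (compile ?d p (Ite c a b)) = p2 + length cb"
    unfolding all by (simp add: p1_def p2_def)
  obtain R1 where R1: "reach w P (cost B c) (cfg p R M) (cfg p1 R1 M)"
    "R1 (rx ?d) = eval w B M c env" "frame ?d R R1"
    using Ite.IH(1)[of p env R] Ite.prems code(1) unfolding computes_def cc_def p1_def by auto
  have ok: "env_ok B env R1" using Ite.prems(3) R1(3) by (rule env_ok_frame) simp
  show ?case
  proof (cases "eval w B M c env = 0")
    case True
    obtain R2 where R2: "reach w P (cost B b) (cfg p2 R1 M) (cfg (p2 + length cb) R2 M)"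
      "R2 (rx ?d) = eval w B M b env" "frame ?d R1 R2"
      using Ite.IH(3)[of p2 env R1] Ite.prems code(6) ok unfolding computes_def cb_def by auto
    have "reach w P (Suc (cost B b)) (cfg p1 R1 M) (cfg (p2 + length cb) R2 M)"
      using R2(1) R1(2) True by (intro reach_instr[OF code(2)]) simp_all
    from reach_trans[OF R1(1) this]
    have "reach w P (cost B (Ite c a b)) (cfg p R M) (cfg (p2 + length cb) R2 M)"
      by (rule reach_mono) simp
    then show ?thesis
      using R2(2) True frame_trans[OF R1(3) R2(3)] unfolding computes_def len by (intro exI[of _ R2]) simp
  next
    case False
    obtain R2 where R2: "reach w P (cost B a) (cfg (p1 + 1) R1 M) (cfg (p1 + 1 + length ca) R2 M)"
      "R2 (rx ?d) = eval w B M a env" "frame ?d R1 R2"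
      using Ite.IH(2)[of "p1 + 1" env R1] Ite.prems code(3) ok unfolding computes_def ca_def by auto
    have "reach w P (Suc (Suc 0)) (cfg (p1 + 1 + length ca) R2 M) (cfg (p2 + length cb) (R2(rZ := 0)) M)"
      using code(5) by (intro reach_instr[OF code(4)]; simp; intro reach_instr[OF code(5)[simplified]])
        (simp_all add: reach_refl)
    from reach_trans[OF R2(1) this]
    have "reach w P (Suc (cost B a + 2)) (cfg p1 R1 M) (cfg (p2 + length cb) (R2(rZ := 0)) M)"
      using R1(2) False by (intro reach_instr[OF code(2)]) simp_all
    from reach_trans[OF R1(1) this]
    have "reach w P (cost B (Ite c a b)) (cfg p R M) (cfg (p2 + length cb) (R2(rZ := 0)) M)"
      by (rule reach_mono) simp
    then show ?thesis
      using R2(2) False frame_trans[OF R1(3) R2(3)] unfolding computes_def len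
      by (intro exI[of _ "R2(rZ := 0)"]) (simp add: frame_upd)
  qed
next
  case (LetIn a b)
  let ?d = "length env"
  define ca where "ca = compile ?d p a"
  define cb where "cb = compile (?d + 1) (p + length ca) b"
  have code: "code_at P p ca" "code_at P (p + length ca) cb" "code_at P (p + length ca + length cb) [Alu OpOr (rx ?d) (rx (?d + 1)) (rx (?d + 1))]"
    using LetIn.prems(1) by (simp_all add: Let_def code_at_append ca_def cb_def add.assoc)
  obtain R2 where R2: "reach w P (cost B a + cost B b) (cfg p R M) (cfg (p + length ca + length cb) R2 M)"
    "R2 (rx ?d) = eval w B M a env" "R2 (rx (?d + 1)) = eval w B M b (env @ [eval w B M a env])" "frame ?d R R2"
    using computes_two[OF LetIn.IH(1) LetIn.prems(3) LetIn.IH(2)] LetIn.prems code(1,2) unfolding ca_def cb_def by auto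
  let ?R = "R2(rx ?d := R2 (rx (?d + 1)))"
  have "reach w P 1 (cfg (p + length ca + length cb) R2 M) (cfg (p + length ca + length cb + 1) ?R M)"
    using reach_straight[OF code(3), of w R2 M] by simp
  from reach_trans[OF R2(1) this] show ?case
    using R2(2-) unfolding computes_def
    by (intro exI[of _ ?R]) (simp add: Let_def ca_def cb_def add.assoc frame_upd)
next
  case (Loop c i e)
  let ?d = "length env"
  define cc where "cc = compile ?d p c"
  define ci where "ci = compile (?d + 1) (p + length cc + 1) i"
  define p0 where "p0 = p + length cc + 1 + length ci"
  define p1 where "p1 = p0 + 1"
  define ce where "ce = compile (?d + 3) (p1 + 2) e"
  define p2 where "p2 = p1 + 2 + length ce + 5"
  define pe where "pe = p1 + 2 + length ce"
  have all: "compile ?d p (Loop c i e) = cc @ [Alu OpMod (rx ?d) (rx ?d) rB] @ ci @ [Const (rx (?d + 2)) 0] @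
     [Alu OpLess rZ (rx (?d + 2)) (rx ?d)] @ [JumpIfZero rZ p2] @ ce @
     [Alu OpOr (rx (?d + 1)) (rx (?d + 3)) (rx (?d + 3)), Const rZ 1,
      Alu OpAdd (rx (?d + 2)) (rx (?d + 2)) rZ, Const rZ 0] @ [JumpIfZero rZ p1] @
     [Alu OpOr (rx ?d) (rx (?d + 1)) (rx (?d + 1))]"
    by (simp add: Let_def cc_def ci_def p0_def p1_def ce_def p2_def)
  have code: "code_at P p cc" "code_at P (p + length cc) [Alu OpMod (rx ?d) (rx ?d) rB]"
    "code_at P (p + length cc + 1) ci" "code_at P p0 [Const (rx (?d + 2)) 0]"
    "code_at P p1 [Alu OpLess rZ (rx (?d + 2)) (rx ?d)]" "code_at P (p1 + 1) [JumpIfZero rZ p2]"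
    "code_at P (p1 + 2) ce"
    "code_at P pe [Alu OpOr (rx (?d + 1)) (rx (?d + 3)) (rx (?d + 3)), Const rZ 1,
      Alu OpAdd (rx (?d + 2)) (rx (?d + 2)) rZ, Const rZ 0]"
    "code_at P (pe + 4) [JumpIfZero rZ p1]" "code_at P p2 [Alu OpOr (rx ?d) (rx (?d + 1)) (rx (?d + 1))]"
    using Loop.prems(1) unfolding all code_at_append
    by (simp_all add: p0_def p1_def p2_def pe_def numeral_eq_Suc)
  have len: "p + length (compile ?d p (Loop c i e)) = p2 + 1"
    unfolding all by (simp add: p0_def p1_def p2_def)
  define n where "n = eval w B M c env mod B"
  define x where "x j = rec_nat (eval w B M i (env @ [n])) (\<lambda>j x. eval w B M e (env @ [n, x, j])) j" for j
  have n: "n < B" using B by (simp add: n_def)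
  obtain R1 where R1: "reach w P (cost B c) (cfg p R M) (cfg (p + length cc) R1 M)"
    "R1 (rx ?d) = eval w B M c env" "frame ?d R R1"
    using Loop.IH(1)[of p env R] Loop.prems code(1) unfolding computes_def cc_def by auto
  define R2 where "R2 = R1(rx ?d := n)"
  have "R1 rB = B" using Loop.prems(3) frameD(2)[OF R1(3)] by (simp add: env_ok_def)
  then have r2: "reach w P 1 (cfg (p + length cc) R1 M) (cfg (p + length cc + 1) R2 M)"
    using reach_straight[OF code(2), of w R1 M] R1(2) by (simp add: R2_def n_def)
  have f2: "frame ?d R R2" using R1(3) by (simp add: R2_def frame_upd)
  have ok2: "env_ok B (env @ [n]) R2"
    using env_ok_frame[OF Loop.prems(3) f2] by (simp add: env_ok_snoc) (simp add: R2_def)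
  then obtain R3 where R3: "reach w P (cost B i) (cfg (p + length cc + 1) R2 M) (cfg p0 R3 M)"
    "R3 (rx (?d + 1)) = eval w B M i (env @ [n])" "frame (?d + 1) R2 R3"
    using Loop.IH(2)[of "p + length cc + 1" "env @ [n]" R2] Loop.prems code(3)
    unfolding computes_def ci_def p0_def by auto
  define R4 where "R4 = R3(rx (?d + 2) := 0)"
  have r4: "reach w P 1 (cfg p0 R3 M) (cfg p1 R4 M)"
    using reach_straight[OF code(4), of w R3 M] by (simp add: R4_def p1_def)
  have f4: "frame (?d + 1) R2 R4" using R3(3) by (simp add: R4_def frame_upd)
  have ok4: "env_ok B (env @ [n]) R4" using ok2 f4 by (rule env_ok_frame) simp
  \<comment> \<open>Invariant at the loop head \<open>p1\<close>: the three registers that the body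
    sees hold the count, the accumulator and the index.\<close>
  have "j \<le> n \<Longrightarrow> \<exists>R5. reach w P (j * (cost B e + 7)) (cfg p1 R4 M) (cfg p1 R5 M) \<and>
      env_ok B (env @ [n, x j, j]) R5 \<and> frame (?d + 1) R4 R5" for j
  proof (induction j)
    case 0
    have "env_ok B (env @ [n, x 0, 0]) R4"
      using ok4 R3(2) env_ok_snoc[of B "env @ [n, x 0]" 0 R4] env_ok_snoc[of B "env @ [n]" "x 0" R4]
      by (simp add: x_def R4_def)
    then show ?case by (auto simp: reach_refl frame_refl intro!: exI[of _ R4])
  next
    case (Suc j)
    then obtain R5 where R5: "reach w P (j * (cost B e + 7)) (cfg p1 R4 M) (cfg p1 R5 M)"
      "env_ok B (env @ [n, x j, j]) R5" "frame (?d + 1) R4 R5" by auto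
    have vals: "R5 (rx ?d) = n" "R5 (rx (?d + 2)) = j"
      using R5(2) by (auto simp: env_ok_def nth_append dest!: spec[of _ ?d] spec[of _ "?d + 2"])
    define R6 where "R6 = R5(rZ := 1)"
    have ok6: "env_ok B (env @ [n, x j, j]) R6" using R5(2) by (simp add: R6_def env_ok_upd)
    have r6: "reach w P 2 (cfg p1 R5 M) (cfg (p1 + 2) R6 M)"
      using code(6) vals Suc.prems
      by (simp add: numeral_2_eq_2, intro reach_instr[OF code(5)]; simp; intro reach_instr[OF code(6)[simplified]])
        (simp_all add: reach_refl R6_def)
    obtain R7 where R7: "reach w P (cost B e) (cfg (p1 + 2) R6 M) (cfg pe R7 M)"
      "R7 (rx (?d + 3)) = eval w B M e (env @ [n, x j, j])" "frame (?d + 3) R6 R7"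
      using Loop.IH(3)[of "p1 + 2" "env @ [n, x j, j]" R6] Loop.prems code(7) ok6
      unfolding computes_def ce_def pe_def by (auto simp: eval_nat_numeral)
    have v7: "R7 (rx (?d + 2)) = j" using frameD(1)[OF R7(3), of "?d + 2"] vals by (simp add: R6_def)
    have j: "Suc j < 2 ^ w" using Suc.prems n B by linarith
    have "w > 0" using B by (cases w) auto
    then have w1: "1 mod 2 ^ w = (1::nat)" by simp
    define R8 where "R8 = R7(rx (?d + 1) := R7 (rx (?d + 3)), rx (?d + 2) := Suc j, rZ := 0)"
    have "reach w P 4 (cfg pe R7 M) (cfg (pe + 4) R8 M)"
    proof -
      have "fold (exec_regs w) [Alu OpOr (rx (?d + 1)) (rx (?d + 3)) (rx (?d + 3)), Const rZ 1,
          Alu OpAdd (rx (?d + 2)) (rx (?d + 2)) rZ, Const rZ 0] (R7, M) = (R8, M)"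
        using j v7 \<open>w > 0\<close> by (auto simp: R8_def fun_eq_iff)
      then show ?thesis by (intro reach_block[OF code(8)]) simp_all
    qed
    moreover have "reach w P 1 (cfg (pe + 4) R8 M) (cfg p1 R8 M)"
      unfolding One_nat_def by (intro reach_instr[OF code(9)]) (simp_all add: reach_refl R8_def)
    ultimately have "reach w P (4 + 1) (cfg pe R7 M) (cfg p1 R8 M)" by (rule reach_trans)
    from reach_trans[OF R5(1) reach_trans[OF r6 reach_trans[OF R7(1) this]]]
    have "reach w P (Suc j * (cost B e + 7)) (cfg p1 R4 M) (cfg p1 R8 M)"
      by (rule reach_mono) simp
    moreover have "frame (?d + 1) R5 R8"
      using R7(3) unfolding R8_def R6_def frame_def by auto
    moreover have "env_ok B (env @ [n]) R8"
      using frame_trans[OF R5(3) \<open>frame (?d + 1) R5 R8\<close>] ok4 env_ok_frame by fastforce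
    then have "env_ok B (env @ [n, x (Suc j), Suc j]) R8"
      using R7(2) env_ok_snoc[of B "env @ [n, x (Suc j)]" "Suc j" R8] env_ok_snoc[of B "env @ [n]" "x (Suc j)" R8]
      by (simp add: x_def R8_def)
    ultimately show ?case using frame_trans[OF R5(3)] by blast
  qed
  from this[of n] obtain R5 where R5: "reach w P (n * (cost B e + 7)) (cfg p1 R4 M) (cfg p1 R5 M)"
    "env_ok B (env @ [n, x n, n]) R5" "frame (?d + 1) R4 R5" by auto
  have vals: "R5 (rx ?d) = n" "R5 (rx (?d + 1)) = x n" "R5 (rx (?d + 2)) = n"
    using R5(2) by (auto simp: env_ok_def nth_append dest!: spec[of _ ?d] spec[of _ "?d + 1"] spec[of _ "?d + 2"])
  define R6 where "R6 = R5(rZ := 0)"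
  have r6: "reach w P 2 (cfg p1 R5 M) (cfg p2 R6 M)"
    using code(6) vals
    by (simp add: numeral_2_eq_2, intro reach_instr[OF code(5)]; simp; intro reach_instr[OF code(6)[simplified]])
      (simp_all add: reach_refl R6_def)
  define R7 where "R7 = R6(rx ?d := x n)"
  have r7: "reach w P 1 (cfg p2 R6 M) (cfg (p2 + 1) R7 M)"
    using reach_straight[OF code(10), of w R6 M] vals by (simp add: R6_def R7_def)
  have "n * (cost B e + 7) \<le> B * (cost B e + 7)" using n by (intro mult_right_mono) auto
  with reach_trans[OF R1(1) reach_trans[OF r2 reach_trans[OF R3(1) reach_trans[OF r4
    reach_trans[OF R5(1) reach_trans[OF r6 r7]]]]]]
  have "reach w P (cost B (Loop c i e)) (cfg p R M) (cfg (p2 + 1) R7 M)"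
    by (elim reach_mono) simp
  moreover have "frame ?d R R7"
    using frame_trans[OF f2 frame_trans[OF f4 R5(3)]] by (simp add: R7_def R6_def frame_upd)
  moreover have "R7 (rx ?d) = eval w B M (Loop c i e) env" by (simp add: R7_def x_def n_def Let_def)
  ultimately show ?case unfolding computes_def len by blast
qed

section \<open>Simulation on a longer word length\<close>

lemma exI2: "P a b \<Longrightarrow> \<exists>x y. P x y" by blast

text \<open>Truncation commutes with addition, subtraction, multiplication and left shift because
  \<open>2 ^ v\<close> divides \<open>2 ^ w\<close>. On truncated operands the other operations
  return truncated results; \<open>0 < v\<close> makes room for the truth value 1.\<close>

lemma alu_mod:
  assumes "x < 2 ^ v" "y < 2 ^ v" "v \<le> w" "0 < v"
  shows "alu w f x y mod 2 ^ v = alu v f x y \<and> alu v f x y < 2 ^ v"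
proof -
  obtain u where w: "w = v + u" using assms(3) le_Suc_ex by blast
  have dvd: "(2::nat) ^ v dvd 2 ^ w" by (simp add: w power_add)
  have 1: "1 < (2::nat) ^ v" using assms(4) one_less_power[of "2::nat" v] by simp
  show ?thesis
  proof (cases f)
    case OpSub
    have "(2::nat) ^ w = 2 ^ v + (2 ^ u - 1) * 2 ^ v" by (simp add: w power_add algebra_simps)
    then have "x + 2 ^ w - y = (x + 2 ^ v - y) + (2 ^ u - 1) * 2 ^ v" using assms(2) by linarith
    then have "(x + 2 ^ w - y) mod 2 ^ v = (x + 2 ^ v - y) mod 2 ^ v" by (metis mod_mult_self1)
    then show ?thesis using OpSub dvd by (simp add: mod_mod_cancel)
  next
    case OpDiv
    then show ?thesis using assms(1) by (simp add: le_less_trans[OF div_le_dividend])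
  next
    case OpMod
    then show ?thesis using assms(1) by (simp add: le_less_trans[OF mod_less_eq_dividend])
  next
    case OpShr
    then show ?thesis using assms(1) by (simp add: le_less_trans[OF div_le_dividend])
  next
    case OpAnd
    have "take_bit v (and x y) = and x y" using assms by (simp add: take_bit_and take_bit_nat_eq_self)
    then show ?thesis using OpAnd by (metis alu.simps(6) take_bit_eq_mod take_bit_nat_less_exp)
  next
    case OpOr
    have "take_bit v (or x y) = or x y" using assms by (simp add: take_bit_or take_bit_nat_eq_self)
    then show ?thesis using OpOr by (metis alu.simps(7) take_bit_eq_mod take_bit_nat_less_exp)
  next
    case OpXor
    have "take_bit v (xor x y) = xor x y" using assms by (simp add: take_bit_xor take_bit_nat_eq_self)
    then show ?thesis using OpXor by (metis alu.simps(8) take_bit_eq_mod take_bit_nat_less_exp)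
  qed (use dvd 1 in \<open>auto simp: mod_mod_cancel\<close>)
qed

text \<open>Every instruction becomes exactly two, padded if necessary, so that jump targets are
  simply doubled. Jumps out of the program are redirected by \<open>min\<close> to the first address
  behind the simulating code, and so is \<open>Halt\<close>.\<close>

fun sim_instr :: "nat \<Rightarrow> nat \<Rightarrow> instr \<Rightarrow> instr list" where
  "sim_instr q n (Const d x) = [Const (2 * d) x, Alu OpMod (2 * d) (2 * d) rW]"
| "sim_instr q n (Alu f d a b) = [Alu f (2 * d) (2 * a) (2 * b), Alu OpMod (2 * d) (2 * d) rW]"
| "sim_instr q n (Load d a) = [Alu OpAdd rA (2 * a) rB, Load (2 * d) rA]"
| "sim_instr q n (Store a b) = [Alu OpAdd rA (2 * a) rB, Store rA (2 * b)]"
| "sim_instr q n (JumpIfZero a l) = [JumpIfZero (2 * a) (q + 2 * min l n), Const rA 0]"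
| "sim_instr q n Halt = [Const rA 0, JumpIfZero rA (q + 2 * n)]"

definition simulate :: "nat \<Rightarrow> instr list \<Rightarrow> instr list" where
  "simulate q P = concat (map (sim_instr q (length P)) P)"

lemma length_sim_instr [simp]: "length (sim_instr q n i) = 2" by (cases i) auto

lemma length_simulate [simp]: "length (simulate q P) = 2 * length P"
  by (simp add: simulate_def length_concat comp_def sum_list_triv)

lemma code_at_simulate:
  assumes "code_at Q q (simulate q P)" "j < length P"
  shows "code_at Q (q + 2 * j) (sim_instr q (length P) (P ! j))"
proof -
  have "P = take j P @ P ! j # drop (Suc j) P" using assms(2) by (rule id_take_nth_drop)
  then have "simulate q P = concat (map (sim_instr q (length P)) (take j P)) @
      sim_instr q (length P) (P ! j) @ concat (map (sim_instr q (length P)) (drop (Suc j) P))"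
    unfolding simulate_def by (metis concat.simps(2) concat_append list.simps(9) map_append)
  moreover have "length (concat (map (sim_instr q (length P)) (take j P))) = 2 * j"
    using assms(2) by (simp add: length_concat comp_def sum_list_triv)
  ultimately show ?thesis using assms(1) by (simp add: code_at_append)
qed

text \<open>The simulated memory starts at address \<open>B\<close>. Agreement below
  \<open>2 ^ v\<close> suffices, since all addresses come from simulated registers.\<close>

definition sim_rel :: "nat \<Rightarrow> nat \<Rightarrow> config \<Rightarrow> (nat \<Rightarrow> nat) \<Rightarrow> (nat \<Rightarrow> nat) \<Rightarrow> bool" where
  "sim_rel v B s R M \<longleftrightarrow> R rB = B \<and> R rW = 2 ^ v \<and>
     (\<forall>r. R (2 * r) = regs s r) \<and> (\<forall>r. regs s r < 2 ^ v) \<and> (\<forall>a. mem s a < 2 ^ v) \<and>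
     (\<forall>a<2 ^ v. M (B + a) = mem s a)"

lemma even_neq_odd [simp]: "2 * r \<noteq> rB" "2 * r \<noteq> rW" "2 * r \<noteq> rA" "2 * r \<noteq> rZ" "2 * r \<noteq> rL"
  "rB \<noteq> 2 * r" "rW \<noteq> 2 * r" "rA \<noteq> 2 * r" "rZ \<noteq> 2 * r" "rL \<noteq> 2 * r" for r :: nat
  by presburger+

lemma simulate_step:
  assumes code: "code_at Q q (simulate q P)"
    and v: "0 < v" "v \<le> w" "B + 2 ^ v \<le> 2 ^ w"
    and s: "\<not> halted P s" "sim_rel v B s R M"
  shows "\<exists>R' M'. reach w Q 2 (cfg (q + 2 * pc s) R M)
      (cfg (q + 2 * min (pc (step v P s)) (length P)) R' M') \<and> sim_rel v B (step v P s) R' M'"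
proof -
  have pc: "pc s < length P" and i: "P ! pc s \<noteq> Halt" using s(1) by (auto simp: halted_def)
  have st: "step v P s = exec_instr v (P ! pc s) s" using s(1) by (simp add: step_def)
  have c: "code_at Q (q + 2 * pc s) (sim_instr q (length P) (P ! pc s))"
    using code pc by (rule code_at_simulate)
  have dvd: "x mod 2 ^ w mod 2 ^ v = x mod (2::nat) ^ v" for x
    using v(2) by (simp add: mod_mod_cancel le_imp_power_dvd)
  have addr: "(regs s a + B) mod 2 ^ w = B + regs s a" for a
    using s(2) v(3) unfolding sim_rel_def by (metis add.commute add_less_cancel_left less_le_trans mod_less)
  note rel = s(2)[unfolded sim_rel_def]
  show ?thesis
  proof (cases "P ! pc s")
    case (Const d x)
    let ?R = "R(2 * d := x mod 2 ^ v)"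
    have "reach w Q 2 (cfg (q + 2 * pc s) R M) (cfg (q + 2 * Suc (pc s)) ?R M)"
      using c rel dvd unfolding Const by (intro reach_block[OF c[unfolded Const]]) auto
    moreover have "sim_rel v B (step v P s) ?R M"
      using rel unfolding st Const sim_rel_def by auto
    ultimately show ?thesis using pc unfolding st Const by (intro exI2[of _ ?R M]) simp
  next
    case (Alu f d a b)
    let ?R = "R(2 * d := alu v f (regs s a) (regs s b))"
    have alu: "alu w f (regs s a) (regs s b) mod 2 ^ v = alu v f (regs s a) (regs s b)"
      "alu v f (regs s a) (regs s b) < 2 ^ v"
      using alu_mod[OF _ _ v(2,1)] rel by auto
    have "reach w Q 2 (cfg (q + 2 * pc s) R M) (cfg (q + 2 * Suc (pc s)) ?R M)"
      using c rel alu unfolding Alu by (intro reach_block[OF c[unfolded Alu]]) auto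
    moreover have "sim_rel v B (step v P s) ?R M"
      using rel alu unfolding st Alu sim_rel_def by auto
    ultimately show ?thesis using pc unfolding st Alu by (intro exI2[of _ ?R M]) simp
  next
    case (Load d a)
    let ?R = "R(rA := B + regs s a, 2 * d := mem s (regs s a))"
    have "reach w Q 2 (cfg (q + 2 * pc s) R M) (cfg (q + 2 * Suc (pc s)) ?R M)"
      using c rel addr unfolding Load by (intro reach_block[OF c[unfolded Load]]) auto
    moreover have "sim_rel v B (step v P s) ?R M"
      using rel unfolding st Load sim_rel_def by auto
    ultimately show ?thesis using pc unfolding st Load by (intro exI2[of _ ?R M]) simp
  next
    case (Store a b)
    let ?R = "R(rA := B + regs s a)" and ?M = "M(B + regs s a := regs s b)"
    have "reach w Q 2 (cfg (q + 2 * pc s) R M) (cfg (q + 2 * Suc (pc s)) ?R ?M)"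
      using c rel addr unfolding Store by (intro reach_block[OF c[unfolded Store]]) auto
    moreover have "sim_rel v B (step v P s) ?R ?M"
      using rel unfolding st Store sim_rel_def by auto
    ultimately show ?thesis using pc unfolding st Store by (intro exI2[of _ ?R ?M]) simp
  next
    case (JumpIfZero a l)
    note c = c[unfolded JumpIfZero sim_instr.simps]
    have c1: "code_at Q (q + 2 * pc s) [JumpIfZero (2 * a) (q + 2 * min l (length P))]"
      "code_at Q (Suc (q + 2 * pc s)) [Const rA 0]"
      using c by (metis code_at_Cons)+
    show ?thesis
    proof (cases "regs s a = 0")
      case True
      have "reach w Q (Suc 1) (cfg (q + 2 * pc s) R M) (cfg (q + 2 * min l (length P)) R M)"
        using rel True by (intro reach_instr[OF c1(1)]) (auto simp: reach_refl)
      then show ?thesis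
        using rel True unfolding st JumpIfZero sim_rel_def
        by (intro exI2[of _ R M]) (simp add: numeral_2_eq_2)
    next
      case False
      let ?R = "R(rA := 0)"
      have "reach w Q (Suc 1) (cfg (q + 2 * pc s) R M) (cfg (q + 2 * Suc (pc s)) ?R M)"
        using rel False reach_block[OF c1(2), of w R M ?R M 1]
        by (intro reach_instr[OF c1(1)]) auto
      then have "reach w Q 2 (cfg (q + 2 * pc s) R M) (cfg (q + 2 * Suc (pc s)) ?R M)"
        by (rule reach_mono) simp
      then show ?thesis
        using rel False pc unfolding st JumpIfZero sim_rel_def by (intro exI2[of _ ?R M]) simp
    qed
  next
    case Halt
    with i show ?thesis by blast
  qed
qed

lemma simulate_steps:
  assumes code: "code_at Q q (simulate q P)"
    and v: "0 < v" "v \<le> w" "B + 2 ^ v \<le> 2 ^ w" and s: "sim_rel v B s R M"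
  shows "\<exists>R' M'. reach w Q (2 * t) (cfg (q + 2 * min (pc s) (length P)) R M)
      (cfg (q + 2 * min (pc ((step v P ^^ t) s)) (length P)) R' M') \<and>
      sim_rel v B ((step v P ^^ t) s) R' M'"
proof (induction t)
  case 0
  then show ?case using s by (intro exI2[of _ R M]) (simp add: reach_refl)
next
  case (Suc t)
  then obtain R1 M1 where 1: "reach w Q (2 * t) (cfg (q + 2 * min (pc s) (length P)) R M)
      (cfg (q + 2 * min (pc ((step v P ^^ t) s)) (length P)) R1 M1)"
    "sim_rel v B ((step v P ^^ t) s) R1 M1" by blast
  let ?s = "(step v P ^^ t) s"
  show ?case
  proof (cases "halted P ?s")
    case True
    then have "(step v P ^^ Suc t) s = ?s" by (simp add: step_def)
    then show ?thesis using 1 reach_mono[OF 1(1), of "2 * Suc t"] by (intro exI2[of _ R1 M1]) simp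
  next
    case False
    then have "min (pc ?s) (length P) = pc ?s" by (simp add: halted_def)
    with simulate_step[OF code v False 1(2)] obtain R' M' where
      "reach w Q 2 (cfg (q + 2 * min (pc ?s) (length P)) R1 M1)
        (cfg (q + 2 * min (pc (step v P ?s)) (length P)) R' M')" "sim_rel v B (step v P ?s) R' M'"
      by auto
    then show ?thesis using reach_trans[OF 1(1)] by (intro exI2[of _ R' M']) force
  qed
qed

text \<open>The two extra steps are for runs that stop at \<open>Halt\<close>, from where the
  simulating code still has to jump to its end.\<close>

lemma simulate_run:
  assumes code: "code_at Q q (simulate q P)"
    and v: "0 < v" "v \<le> w" "B + 2 ^ v \<le> 2 ^ w" and s: "sim_rel v B s R M" "pc s = 0"
    and halt: "halted P ((step v P ^^ t) s)"
  shows "\<exists>R' M'. reach w Q (2 * t + 2) (cfg q R M) (cfg (q + 2 * length P) R' M') \<and>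
      (\<forall>r. R' (2 * r) = regs ((step v P ^^ t) s) r)"
proof -
  let ?s = "(step v P ^^ t) s"
  obtain R1 M1 where 1: "reach w Q (2 * t) (cfg q R M) (cfg (q + 2 * min (pc ?s) (length P)) R1 M1)"
    "sim_rel v B ?s R1 M1"
    using simulate_steps[OF code v s(1), of t] s(2) by auto
  show ?thesis
  proof (cases "length P \<le> pc ?s")
    case True
    then have "min (pc ?s) (length P) = length P" by simp
    then show ?thesis using 1 reach_mono[OF 1(1), of "2 * t + 2"]
      by (intro exI2[of _ R1 M1]) (simp add: sim_rel_def)
  next
    case False
    then have "P ! pc ?s = Halt" "pc ?s < length P" using halt by (auto simp: halted_def)
    then have "code_at Q (q + 2 * pc ?s) [Const rA 0, JumpIfZero rA (q + 2 * length P)]"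
      using code_at_simulate[OF code, of "pc ?s"] by simp
    then have c: "code_at Q (q + 2 * pc ?s) [Const rA 0]"
      "code_at Q (Suc (q + 2 * pc ?s)) [JumpIfZero rA (q + 2 * length P)]" by (metis code_at_Cons)+
    have "reach w Q (Suc (Suc 0)) (cfg (q + 2 * pc ?s) R1 M1) (cfg (q + 2 * length P) (R1(rA := 0)) M1)"
      by (intro reach_instr[OF c(1)]; simp; intro reach_instr[OF c(2)]) (simp_all add: reach_refl)
    then have "reach w Q (2 * t + 2) (cfg q R M) (cfg (q + 2 * length P) (R1(rA := 0)) M1)"
      using reach_trans[OF 1(1)] False by (fastforce simp: min_def)
    then show ?thesis
      using 1(2) by (intro exI2[of _ "R1(rA := 0)" M1]) (simp add: sim_rel_def)
  qed
qed

section \<open>A program that writes an input and runs an algorithm on it\<close>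

text \<open>This allows the cells of the graph to be stored from address \<open>B\<close> on while
  later cells are still being computed from the formula.\<close>

lemma eval_mem_cong:
  assumes "0 < B" "\<And>a. a < B \<Longrightarrow> M a = M' a"
  shows "eval w B M e env = eval w B M' e env"
proof (induction e arbitrary: env)
  case (Loop c i e)
  have "(\<lambda>j x. eval w B M e (env @ [n, x, j])) = (\<lambda>j x. eval w B M' e (env @ [n, x, j]))" for n
    using Loop.IH(3) by (intro ext)
  then show ?case using Loop.IH(1,2) by (simp add: Let_def)
qed (use assms in \<open>simp_all add: Let_def\<close>)

text \<open>The first input cell is the number \<open>N\<close> of variables, so this puts
  \<open>(C * (N + 1)) ^ D\<close> into \<open>rB\<close>.\<close>

definition prelude :: "nat \<Rightarrow> nat \<Rightarrow> instr list" where
  "prelude C D = [Const rA 0, Load rA rA, Const rZ 1, Alu OpAdd rA rA rZ, Const rZ C,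
     Alu OpMul rA rA rZ, Const rB 1] @ replicate D (Alu OpMul rB rB rA)"

lemma fold_mult:
  "R rB = x mod 2 ^ w \<Longrightarrow> \<exists>R'. fold (exec_regs w) (replicate D (Alu OpMul rB rB rA)) (R, M) = (R', M) \<and>
     R' rB = (x * R rA ^ D) mod 2 ^ w \<and> (\<forall>r. r \<noteq> rB \<longrightarrow> R' r = R r)"
proof (induction D arbitrary: R x)
  case (Suc D)
  define R1 where "R1 = R(rB := (R rB * R rA) mod 2 ^ w)"
  have R1: "R1 rB = (x * R rA) mod 2 ^ w" "R1 rA = R rA" "\<And>r. r \<noteq> rB \<Longrightarrow> R1 r = R r"
    using Suc.prems by (simp_all add: R1_def mod_mult_left_eq)
  from Suc.IH[of R1 "x * R rA", OF this(1)] obtain R' where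
    "fold (exec_regs w) (replicate D (Alu OpMul rB rB rA)) (R1, M) = (R', M)"
    "R' rB = (x * R rA * R1 rA ^ D) mod 2 ^ w" "\<forall>r. r \<noteq> rB \<longrightarrow> R' r = R1 r" by blast
  moreover have "exec_regs w (Alu OpMul rB rB rA) (R, M) = (R1, M)" by (simp add: R1_def)
  ultimately show ?case
    using R1 by (intro exI[of _ R']) (simp add: mult.assoc del: exec_regs.simps fold_replicate)
qed simp

lemma prelude_run:
  "\<exists>R. fold (exec_regs w) (prelude C D) ((\<lambda>_. 0), M) = (R, M) \<and>
     R rB = (C * (M 0 + 1)) ^ D mod 2 ^ w \<and> (\<forall>r. R (2 * r) = 0)"
proof -
  define R0 where "R0 = (\<lambda>_. 0 :: nat)(rA := (M 0 + 1 mod 2 ^ w) mod 2 ^ w * (C mod 2 ^ w) mod 2 ^ w,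
    rZ := C mod 2 ^ w, rB := 1 mod 2 ^ w)"
  obtain R where R: "fold (exec_regs w) (replicate D (Alu OpMul rB rB rA)) (R0, M) = (R, M)"
    "R rB = (1 * R0 rA ^ D) mod 2 ^ w" "\<forall>r. r \<noteq> rB \<longrightarrow> R r = R0 r"
    using fold_mult[of R0 1 w D M] by (auto simp: R0_def)
  have "fold (exec_regs w) (prelude C D) ((\<lambda>_. 0), M) = (R, M)"
    unfolding prelude_def fold_append comp_apply R(1)[symmetric]
    by (rule arg_cong[where f = "fold (exec_regs w) _"]) (auto simp: R0_def fun_eq_iff)
  moreover have "R0 rA = (C * (M 0 + 1)) mod 2 ^ w"
    by (simp add: R0_def mod_simps mult.commute)
  then have "R rB = (C * (M 0 + 1)) ^ D mod 2 ^ w" using R(2) by (simp add: power_mod)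
  moreover have "\<forall>r. R (2 * r) = 0" using R(3) by (simp add: R0_def)
  ultimately show ?thesis by blast
qed

text \<open>\<open>rL\<close> holds the number of cells and \<open>rW\<close> the modulus
  \<open>2 ^ v\<close> of the simulation. The cell counter is \<open>rx 0\<close>, which makes it
  the only variable of \<open>eC\<close>. All bookkeeping is in odd registers, because the simulated
  registers must still be 0 when the simulation starts.\<close>

definition program :: "nat \<Rightarrow> nat \<Rightarrow> exp \<Rightarrow> exp \<Rightarrow> exp \<Rightarrow> instr list \<Rightarrow> instr list \<Rightarrow> instr list" where
  "program C D eL eW eC P post = (let
     p1 = length (prelude C D);
     c1 = compile 0 p1 eL; p2 = p1 + length c1 + 1;
     c2 = compile 0 p2 eW; p3 = p2 + length c2 + 2;
     c3 = compile 1 (p3 + 2) eC; p4 = p3 + 2 + length c3 + 6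
   in prelude C D @ c1 @ [Alu OpOr rL (rx 0) (rx 0)] @
      c2 @ [Alu OpOr rW (rx 0) (rx 0), Const (rx 0) 0] @
      [Alu OpLess rZ (rx 0) rL] @ [JumpIfZero rZ p4] @ c3 @
      [Alu OpAdd rA (rx 0) rB, Store rA (rx 1), Const rZ 1, Alu OpAdd (rx 0) (rx 0) rZ, Const rZ 0] @
      [JumpIfZero rZ p3] @ simulate p4 P @ post)"

lemma rx_neq_special [simp]: "rx i \<noteq> rL" "rx i \<noteq> rW" "rx i \<noteq> rA" "rx i \<noteq> 2 * r"
  "rL \<noteq> rx i" "rW \<noteq> rx i" "rA \<noteq> rx i" "2 * r \<noteq> rx i"
  unfolding rx_def by presburger+

lemma frame_special: "frame d R R' \<Longrightarrow> R' rL = R rL" "frame d R R' \<Longrightarrow> R' rW = R rW"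
  "frame d R R' \<Longrightarrow> R' (2 * r) = R (2 * r)"
  by (auto simp: frame_def)

lemma program_run:
  fixes xs ys :: "nat list"
  defines "M \<equiv> mem (init_config xs)"
  assumes B: "B = (C * (M 0 + 1)) ^ D" "0 < B" "length xs \<le> B"
    and v: "0 < v" "v \<le> w" "B + 2 ^ v \<le> 2 ^ w"
    and wf: "wf_exp 0 eL" "wf_exp 0 eW" "wf_exp 1 eC"
    and eL: "eval w B M eL [] = length ys" and eW: "eval w B M eW [] = 2 ^ v"
    and eC: "\<And>t. t < length ys \<Longrightarrow> eval w B M eC [t] = ys ! t"
    and ys: "length ys \<le> 2 ^ v" "\<And>y. y \<in> set ys \<Longrightarrow> y < 2 ^ v"
    and halt: "halted P ((step v P ^^ t) (init_config ys))"
    and post: "\<forall>i\<in>set post. straight i"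
  shows "\<exists>R M\<^sub>1 R' M'. reach w (program C D eL eW eC P post)
      (cost B eL + cost B eW + length ys * (cost B eC + 8) + 2 * t + (length post + D + 14))
      (init_config xs) (cfg (length (program C D eL eW eC P post)) R' M') \<and>
      (\<forall>r. R (2 * r) = regs ((step v P ^^ t) (init_config ys)) r) \<and>
      fold (exec_regs w) post (R, M\<^sub>1) = (R', M')"
proof -
  define c1 where "c1 = compile 0 (length (prelude C D)) eL"
  define p1 where "p1 = length (prelude C D)"
  define p2 where "p2 = p1 + length c1 + 1"
  define c2 where "c2 = compile 0 p2 eW"
  define p3 where "p3 = p2 + length c2 + 2"
  define c3 where "c3 = compile 1 (p3 + 2) eC"
  define p4 where "p4 = p3 + 2 + length c3 + 6"
  define Q where "Q = program C D eL eW eC P post"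
  have all: "Q = prelude C D @ c1 @ [Alu OpOr rL (rx 0) (rx 0)] @
      c2 @ [Alu OpOr rW (rx 0) (rx 0), Const (rx 0) 0] @
      [Alu OpLess rZ (rx 0) rL] @ [JumpIfZero rZ p4] @ c3 @
      [Alu OpAdd rA (rx 0) rB, Store rA (rx 1), Const rZ 1, Alu OpAdd (rx 0) (rx 0) rZ, Const rZ 0] @
      [JumpIfZero rZ p3] @ simulate p4 P @ post"
    by (simp add: Q_def program_def Let_def c1_def p1_def p2_def c2_def p3_def c3_def p4_def)
  have "code_at Q 0 Q" by (auto simp: code_at_def)
  then have code: "code_at Q 0 (prelude C D)" "code_at Q p1 c1" "code_at Q (p1 + length c1) [Alu OpOr rL (rx 0) (rx 0)]"
    "code_at Q p2 c2" "code_at Q (p2 + length c2) [Alu OpOr rW (rx 0) (rx 0), Const (rx 0) 0]"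
    "code_at Q p3 [Alu OpLess rZ (rx 0) rL]" "code_at Q (p3 + 1) [JumpIfZero rZ p4]" "code_at Q (p3 + 2) c3"
    "code_at Q (p3 + 2 + length c3) [Alu OpAdd rA (rx 0) rB, Store rA (rx 1), Const rZ 1, Alu OpAdd (rx 0) (rx 0) rZ, Const rZ 0]"
    "code_at Q (p3 + 2 + length c3 + 5) [JumpIfZero rZ p3]" "code_at Q p4 (simulate p4 P)"
    "code_at Q (p4 + 2 * length P) post"
    unfolding all[THEN arg_cong[where f = "code_at Q 0"]] code_at_append
    by (simp_all add: p1_def p2_def p3_def p4_def numeral_eq_Suc)
  have len: "length Q = p4 + 2 * length P + length post"
    unfolding all by (simp add: p1_def p2_def p3_def p4_def)
  have Bw: "B < 2 ^ w" using v(3) zero_less_power[of "2::nat" v] by linarith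
  have w: "w > 0" using v by linarith
  have init: "init_config xs = cfg 0 (\<lambda>_. 0) M" by (simp add: M_def init_config_def)
  obtain R1 where R1: "fold (exec_regs w) (prelude C D) ((\<lambda>_. 0), M) = (R1, M)" "R1 rB = B" "\<forall>r. R1 (2 * r) = 0"
    using prelude_run[of w C D M] Bw B(1) by auto
  have "\<forall>i\<in>set (prelude C D). straight i" by (auto simp: prelude_def)
  then have r1: "reach w Q (7 + D) (cfg 0 (\<lambda>_. 0) M) (cfg p1 R1 M)"
    by (intro reach_block[OF code(1) _ R1(1)]) (simp_all add: p1_def prelude_def)
  have "computes w B M Q p1 eL [] R1"
    using code(2) wf(1) R1(2) B(2) Bw by (intro compile_correct) (simp_all add: c1_def p1_def env_ok_def)
  then obtain R2 where R2: "reach w Q (cost B eL) (cfg p1 R1 M) (cfg (p1 + length c1) R2 M)"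
    "R2 (rx 0) = length ys" "frame 0 R1 R2" using eL unfolding computes_def c1_def p1_def by auto
  define R3 where "R3 = R2(rL := length ys)"
  have r3: "reach w Q 1 (cfg (p1 + length c1) R2 M) (cfg p2 R3 M)"
    using R2(2) by (intro reach_block[OF code(3)]) (simp_all add: R3_def p2_def)
  have R3: "R3 rB = B" "R3 rL = length ys" "\<forall>r. R3 (2 * r) = 0"
    using R1 frameD[OF R2(3)] frame_special[OF R2(3)] by (simp_all add: R3_def)
  have "computes w B M Q p2 eW [] R3"
    using code(4) wf(2) R3(1) B(2) Bw by (intro compile_correct) (simp_all add: c2_def env_ok_def)
  then obtain R4 where R4: "reach w Q (cost B eW) (cfg p2 R3 M) (cfg (p2 + length c2) R4 M)"
    "R4 (rx 0) = 2 ^ v" "frame 0 R3 R4" using eW unfolding computes_def c2_def by auto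
  define R5 where "R5 = R4(rW := 2 ^ v, rx 0 := 0)"
  have r5: "reach w Q 2 (cfg (p2 + length c2) R4 M) (cfg p3 R5 M)"
    using R4(2) by (intro reach_block[OF code(5)]) (simp_all add: R5_def p3_def)
  define Mt where "Mt j a = (if B \<le> a \<and> a < B + j then ys ! (a - B) else M a)" for j a
  have "j \<le> length ys \<Longrightarrow> \<exists>R. reach w Q (j * (cost B eC + 8)) (cfg p3 R5 M) (cfg p3 R (Mt j)) \<and>
      R rB = B \<and> R rL = length ys \<and> R rW = 2 ^ v \<and> R (rx 0) = j \<and> (\<forall>r. R (2 * r) = 0)" for j
  proof (induction j)
    case 0
    have "Mt 0 = M" by (auto simp: Mt_def)
    then show ?case
      using R3 frameD[OF R4(3)] frame_special[OF R4(3)]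
      by (intro exI[of _ R5]) (simp add: reach_refl R5_def)
  next
    case (Suc j)
    then obtain R where R: "reach w Q (j * (cost B eC + 8)) (cfg p3 R5 M) (cfg p3 R (Mt j))"
      "R rB = B" "R rL = length ys" "R rW = 2 ^ v" "R (rx 0) = j" "\<forall>r. R (2 * r) = 0" by auto
    define R6 where "R6 = R(rZ := 1)"
    have c7: "code_at Q (Suc p3) [JumpIfZero rZ p4]" using code(7) by simp
    have r6: "reach w Q (Suc (Suc 0)) (cfg p3 R (Mt j)) (cfg (p3 + 2) R6 (Mt j))"
      using R Suc.prems
      by (intro reach_instr[OF code(6)]; simp; intro reach_instr[OF c7]) (simp_all add: reach_refl R6_def)
    have "computes w B (Mt j) Q (p3 + 2) eC [j] R6"
      using code(8) wf(3) R B(2) Bw by (intro compile_correct) (simp_all add: c3_def env_ok_def R6_def)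
    moreover have "eval w B (Mt j) eC [j] = ys ! j"
      using eC[of j] Suc.prems eval_mem_cong[of B "Mt j" M w eC "[j]"] B(2) by (simp add: Mt_def)
    ultimately obtain R7 where R7: "reach w Q (cost B eC) (cfg (p3 + 2) R6 (Mt j)) (cfg (p3 + 2 + length c3) R7 (Mt j))"
      "R7 (rx 1) = ys ! j" "frame 1 R6 R7" unfolding computes_def c3_def by auto
    have v7: "R7 rB = B" "R7 rL = length ys" "R7 rW = 2 ^ v" "R7 (rx 0) = j" "\<forall>r. R7 (2 * r) = 0"
      using R frameD[OF R7(3)] frame_special[OF R7(3)] by (simp_all add: R6_def)
    define R8 where "R8 = R7(rA := B + j, rx 0 := Suc j, rZ := 0)"
    have le: "B + j < 2 ^ w" "Suc j < 2 ^ w" using v(3) ys(1) Suc.prems B(2) by linarith+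
    have "fold (exec_regs w) [Alu OpAdd rA (rx 0) rB, Store rA (rx 1), Const rZ 1, Alu OpAdd (rx 0) (rx 0) rZ, Const rZ 0]
        (R7, Mt j) = (R8, Mt (Suc j))"
      using v7 R7(2) le w by (auto simp: R8_def Mt_def fun_eq_iff add.commute)
    then have r8: "reach w Q 5 (cfg (p3 + 2 + length c3) R7 (Mt j)) (cfg (p3 + 2 + length c3 + 5) R8 (Mt (Suc j)))"
      by (intro reach_block[OF code(9)]) simp_all
    have "reach w Q (Suc 0) (cfg (p3 + 2 + length c3 + 5) R8 (Mt (Suc j))) (cfg p3 R8 (Mt (Suc j)))"
      by (intro reach_instr[OF code(10)]) (simp_all add: reach_refl R8_def)
    from reach_trans[OF R(1) reach_trans[OF r6 reach_trans[OF R7(1) reach_trans[OF r8 this]]]]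
    have "reach w Q (Suc j * (cost B eC + 8)) (cfg p3 R5 M) (cfg p3 R8 (Mt (Suc j)))"
      by (rule reach_mono) simp
    moreover have "R8 rB = B \<and> R8 rL = length ys \<and> R8 rW = 2 ^ v \<and> R8 (rx 0) = Suc j \<and> (\<forall>r. R8 (2 * r) = 0)"
      using v7 by (simp add: R8_def)
    ultimately show ?case by blast
  qed
  from this[of "length ys"] obtain R6 where
    R6: "reach w Q (length ys * (cost B eC + 8)) (cfg p3 R5 M) (cfg p3 R6 (Mt (length ys)))"
    "R6 rB = B" "R6 rL = length ys" "R6 rW = 2 ^ v" "R6 (rx 0) = length ys" "\<forall>r. R6 (2 * r) = 0" by auto
  define R7 where "R7 = R6(rZ := 0)"
  have c7: "code_at Q (Suc p3) [JumpIfZero rZ p4]" using code(7) by simp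
  have r7: "reach w Q (Suc (Suc 0)) (cfg p3 R6 (Mt (length ys))) (cfg p4 R7 (Mt (length ys)))"
    using R6 by (intro reach_instr[OF code(6)]; simp; intro reach_instr[OF c7]) (simp_all add: reach_refl R7_def)
  have "sim_rel v B (init_config ys) R7 (Mt (length ys))"
    unfolding sim_rel_def
  proof (intro conjI allI impI)
    fix a assume "a < (2::nat) ^ v"
    show "Mt (length ys) (B + a) = mem (init_config ys) a"
      using B(3) by (simp add: Mt_def init_config_def M_def)
  next
    fix a show "mem (init_config ys) a < 2 ^ v" using ys(2) by (simp add: init_config_def)
  qed (use R6 in \<open>simp_all add: R7_def init_config_def\<close>)
  from simulate_run[OF code(11) v this _ halt] obtain R8 M8 where
    R8: "reach w Q (2 * t + 2) (cfg p4 R7 (Mt (length ys))) (cfg (p4 + 2 * length P) R8 M8)"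
    "\<forall>r. R8 (2 * r) = regs ((step v P ^^ t) (init_config ys)) r" by (auto simp: init_config_def)
  obtain R9 M9 where R9: "fold (exec_regs w) post (R8, M8) = (R9, M9)" by fastforce
  have "reach w Q (length post) (cfg (p4 + 2 * length P) R8 M8) (cfg (length Q) R9 M9)"
    by (intro reach_block[OF code(12) post R9]) (simp_all add: len)
  from reach_trans[OF r1 reach_trans[OF R2(1) reach_trans[OF r3 reach_trans[OF R4(1) reach_trans[OF r5
    reach_trans[OF R6(1) reach_trans[OF r7 reach_trans[OF R8(1) this]]]]]]]]
  have "reach w Q (cost B eL + cost B eW + length ys * (cost B eC + 8) + 2 * t + (length post + D + 14))
      (init_config xs) (cfg (length Q) R9 M9)"
    unfolding init by (rule reach_mono) simp
  then show ?thesis using R8(2) R9 unfolding Q_def by blast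
qed

section \<open>Expressions that compute the graph\<close>

text \<open>The address in \<open>encode_cnf\<close> of the cell with the length of clause
  \<open>j\<close>; the 2 counts the header cells.\<close>

definition clause_pos :: "cnf \<Rightarrow> nat \<Rightarrow> nat" where
  "clause_pos F j = 2 + (\<Sum>i<j. length (F ! i) + 1)"

lemma encode_cnf_split:
  assumes "j < length F"
  obtains as bs where "encode_cnf N F = as @ (length (F ! j) # map (\<lambda>(i, b). 2 * i + of_bool b) (F ! j)) @ bs"
    "length as = clause_pos F j"
proof
  let ?e = "\<lambda>C. length C # map (\<lambda>(i, b). 2 * i + of_bool b) C"
  have "concat (map ?e F) = concat (map ?e (take j F @ F ! j # drop (Suc j) F))"
    using id_take_nth_drop[OF assms] by simp
  also have "\<dots> = concat (map ?e (take j F)) @ ?e (F ! j) @ concat (map ?e (drop (Suc j) F))"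
    unfolding map_append concat_append list.map concat.simps ..
  finally show "encode_cnf N F = (N # length F # concat (map ?e (take j F))) @ ?e (F ! j) @
      concat (map ?e (drop (Suc j) F))" by (simp add: encode_cnf_def)
  have "length (concat (map ?e (take j F))) = (\<Sum>i<j. length (F ! i) + 1)"
    using assms by (simp add: length_concat comp_def sum_list_sum_nth min_def atLeast0LessThan)
  then show "length (N # length F # concat (map ?e (take j F))) = clause_pos F j"
    by (simp add: clause_pos_def)
qed

abbreviation (input) "Add \<equiv> Op OpAdd"
abbreviation (input) "Mul \<equiv> Op OpMul"
abbreviation (input) "Sub \<equiv> Op OpSub"
abbreviation (input) "Div \<equiv> Op OpDiv"
abbreviation (input) "Mod \<equiv> Op OpMod"
abbreviation (input) "Shl \<equiv> Op OpShl"
abbreviation (input) "Shr \<equiv> Op OpShr"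
abbreviation (input) "Less \<equiv> Op OpLess"

locale evaluation =
  fixes w B :: nat and N :: nat and F :: cnf and M :: "nat \<Rightarrow> nat"
  defines "M \<equiv> mem (init_config (encode_cnf N F))"
  assumes B: "length (encode_cnf N F) \<le> B" "B < 2 ^ w" "10 < B"
begin

abbreviation "ev \<equiv> eval w B M"

lemma w_pos: "w > 0" using B by (cases w) auto

lemma M_nth: "i < length (encode_cnf N F) \<Longrightarrow> M i = encode_cnf N F ! i"
  by (simp add: M_def init_config_def)

lemma M_clause:
  assumes "j < length F"
  shows "M (clause_pos F j) = length (F ! j)" "clause_pos F j + length (F ! j) < B"
    "y < length (F ! j) \<Longrightarrow> M (clause_pos F j + 1 + y) = (case F ! j ! y of (i, b) \<Rightarrow> 2 * i + of_bool b)"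
proof -
  obtain as bs where e: "encode_cnf N F = as @ (length (F ! j) # map (\<lambda>(i, b). 2 * i + of_bool b) (F ! j)) @ bs"
    "length as = clause_pos F j" using encode_cnf_split[OF assms] by blast
  have len: "clause_pos F j + length (F ! j) < length (encode_cnf N F)" unfolding e(1) by (simp add: e(2))
  then show "clause_pos F j + length (F ! j) < B" using B(1) by linarith
  show "M (clause_pos F j) = length (F ! j)" using len by (simp add: M_nth) (simp add: e nth_append)
  show "M (clause_pos F j + 1 + y) = (case F ! j ! y of (i, b) \<Rightarrow> 2 * i + of_bool b)" if "y < length (F ! j)"
    using len that by (simp add: M_nth) (simp add: e nth_append)
qed

lemma M_0: "M 0 = N" and M_1: "M 1 = length F" and length_less_B: "length F < B"
proof -
  have "length F \<le> length (concat (map (\<lambda>C. length C # map (\<lambda>(i, b). 2 * i + of_bool b) C) F))"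
    by (induction F) auto
  then have "length F + 2 \<le> length (encode_cnf N F)" by (simp add: encode_cnf_def)
  then show "M 0 = N" "M 1 = length F" "length F < B"
    using B(1) M_nth[of 0] M_nth[of 1] by (simp_all add: encode_cnf_def)
qed

lemma ev_Lit: "x < 2 ^ w \<Longrightarrow> ev (Lit x) env = x" by simp

lemma ev_Var: "env ! i = v \<Longrightarrow> ev (Var i) env = v" by simp

lemma ev_Add: "ev a env = x \<Longrightarrow> ev b (env @ [x]) = y \<Longrightarrow> x + y < 2 ^ w \<Longrightarrow> ev (Add a b) env = x + y"
  by (simp add: Let_def)

lemma ev_Mul: "ev a env = x \<Longrightarrow> ev b (env @ [x]) = y \<Longrightarrow> x * y < 2 ^ w \<Longrightarrow> ev (Mul a b) env = x * y"
  by (simp add: Let_def)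

lemma ev_Sub: "ev a env = x \<Longrightarrow> ev b (env @ [x]) = y \<Longrightarrow> y \<le> x \<Longrightarrow> x < 2 ^ w \<Longrightarrow> ev (Sub a b) env = x - y"
proof -
  assume "y \<le> x" "x < 2 ^ w"
  then have "x + 2 ^ w - y = x - y + 2 ^ w" "x - y < 2 ^ w" by linarith+
  then have "(x + 2 ^ w - y) mod 2 ^ w = x - y" by (simp only: mod_add_self2 mod_less)
  then show "ev a env = x \<Longrightarrow> ev b (env @ [x]) = y \<Longrightarrow> ev (Sub a b) env = x - y"
    by (simp add: Let_def)
qed

lemma ev_Div: "ev a env = x \<Longrightarrow> ev b (env @ [x]) = y \<Longrightarrow> ev (Div a b) env = x div y"
  by (simp add: Let_def)

lemma ev_Mod: "ev a env = x \<Longrightarrow> ev b (env @ [x]) = y \<Longrightarrow> ev (Mod a b) env = x mod y"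
  by (simp add: Let_def)

lemma ev_Shr: "ev a env = x \<Longrightarrow> ev b (env @ [x]) = y \<Longrightarrow> ev (Shr a b) env = x div 2 ^ y"
  by (simp add: Let_def)

lemma ev_Shl: "ev a env = x \<Longrightarrow> ev b (env @ [x]) = y \<Longrightarrow> x * 2 ^ y < 2 ^ w \<Longrightarrow> ev (Shl a b) env = x * 2 ^ y"
  by (simp add: Let_def)

lemma ev_Less: "ev a env = x \<Longrightarrow> ev b (env @ [x]) = y \<Longrightarrow> ev (Less a b) env = of_bool (x < y)"
  by (simp add: Let_def)

lemma ev_Get: "ev a env = x \<Longrightarrow> x < B \<Longrightarrow> ev (Get a) env = M x" by simp

lemma ev_Ite: "ev c env = of_bool P \<Longrightarrow> (P \<Longrightarrow> ev a env = x) \<Longrightarrow> (\<not> P \<Longrightarrow> ev b env = y) \<Longrightarrow>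
    ev (Ite c a b) env = (if P then x else y)" by simp

lemma ev_Let: "ev a env = x \<Longrightarrow> ev b (env @ [x]) = y \<Longrightarrow> ev (LetIn a b) env = y" by simp

lemma ev_Loop:
  assumes "ev c env = n" "n < B" "ev i (env @ [n]) = f 0"
    and "\<And>j. j < n \<Longrightarrow> ev e (env @ [n, f j, j]) = f (Suc j)"
  shows "ev (Loop c i e) env = f n"
proof -
  have "j \<le> n \<Longrightarrow> rec_nat (ev i (env @ [n])) (\<lambda>j x. ev e (env @ [n, x, j])) j = f j" for j
    by (induction j) (use assms in auto)
  then show ?thesis using assms(1,2) by (simp add: Let_def)
qed

end

text \<open>There is no instruction for equality; two words are equal iff their exclusive or is
  0.\<close>

definition Eq :: "exp \<Rightarrow> exp \<Rightarrow> exp" where "Eq a b = Less (Op OpXor a b) (Lit 1)"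

context evaluation begin

lemma xor_eq_0_iff_nat: "xor x y = 0 \<longleftrightarrow> x = (y::nat)"
proof
  assume "xor x y = 0"
  moreover have "xor (xor x y) y = x" by (simp add: xor.assoc)
  ultimately show "x = y" by simp
qed simp

lemma ev_Eq: "ev a env = x \<Longrightarrow> ev b (env @ [x]) = y \<Longrightarrow> ev (Eq a b) env = of_bool (x = y)"
proof -
  show "ev a env = x \<Longrightarrow> ev b (env @ [x]) = y \<Longrightarrow> ev (Eq a b) env = of_bool (x = y)"
    using w_pos by (auto simp: Eq_def Let_def xor_eq_0_iff_nat)
qed

lemmas ev_ops = ev_Lit ev_Var ev_Add ev_Mul ev_Sub ev_Div ev_Mod ev_Shr ev_Shl ev_Less ev_Get ev_Eq

end

text \<open>
  Levels: 2 number of clauses, 3 block length, 4 its power of 2, 21 test, 24 block, 25 assignment of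
  the block, 26 power of \<open>R\<close>, 29 slot, 32 index of the clause within the test, 34 its number
  in the formula, 35 its position in memory, 37 accumulator, 38 index of the literal, 39 literal.
\<close>

definition litE :: exp where
  "litE = Ite (Eq (Div (Div (Var 39) (Lit 2)) (Var 3)) (Var 24))
        (Ite (Eq (Mod (Shr (Var 25) (Mod (Div (Var 39) (Lit 2)) (Var 3))) (Lit 2))
               (Mod (Var 39) (Lit 2))) (Lit 1) (Var 37))
        (Var 37)"

definition scanE :: exp where
  "scanE = LetIn (Get (Add (Add (Var 35) (Lit 1)) (Var 38))) litE"

definition satE :: exp where
  "satE = LetIn (Loop (Var 32) (Lit 1) (Mul (Var 34) (Var 2)))
    (LetIn (Mod (Div (Var 21) (Var 33)) (Var 2))
    (LetIn (Loop (Var 34) (Lit 2) (Add (Add (Var 36) (Get (Var 36))) (Lit 1)))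
    (Loop (Get (Var 35)) (Lit 0)
      scanE)))"

context evaluation begin

text \<open>Digit \<open>c\<close> of the test selects the clause, whose address is found by
  skipping the earlier clauses one by one. The bound on \<open>length F ^ c\<close> keeps the
  computed power exact.\<close>

lemma ev_satE:
  assumes env: "length env = 33" "env ! 2 = length F" "env ! 3 = b" "env ! 21 = r" "env ! 24 = i"
    "env ! 25 = x" "env ! 32 = c" and "F \<noteq> []" "c < B" "length F ^ c < 2 ^ w"
  shows "ev satE env = of_bool (part_sat b i x (F ! (r div length F ^ c mod length F)))"
proof -
  define j where "j = r div length F ^ c mod length F"
  define p where "p = length F ^ c"
  have j: "j < length F" using assms by (simp add: j_def)
  note clause = M_clause[OF j]
  define sat where "sat y \<longleftrightarrow> (\<exists>y'<y. case F ! j ! y' of (v, s) \<Rightarrow> v div b = i \<and> odd (x div 2 ^ (v mod b)) = s)" for y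
  have 1: "ev (Loop (Var 32) (Lit 1) (Mul (Var 34) (Var 2))) env = p"
    unfolding p_def
  proof (rule ev_Loop[where f = "\<lambda>k. length F ^ k"])
    fix k assume "k < c"
    then have "length F ^ Suc k \<le> length F ^ c" using \<open>F \<noteq> []\<close> by (intro power_increasing) (auto simp: Suc_leI)
    then have "length F ^ k * length F < 2 ^ w" using assms(10) by (simp add: mult.commute)
    then show "ev (Mul (Var 34) (Var 2)) (env @ [c, length F ^ k, k]) = length F ^ Suc k"
      unfolding power_Suc2 by (intro ev_ops) (simp_all add: env nth_append)
  qed (use env B assms w_pos in simp_all)
  have 2: "ev (Mod (Div (Var 21) (Var 33)) (Var 2)) (env @ [p]) = j"
    unfolding j_def p_def by (intro ev_ops) (simp_all add: env nth_append)
  have 3: "ev (Loop (Var 34) (Lit 2) (Add (Add (Var 36) (Get (Var 36))) (Lit 1))) (env @ [p, j]) = clause_pos F j"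
  proof (rule ev_Loop[where f = "clause_pos F"])
    fix k assume "k < j"
    then have k: "k < length F" using j by simp
    have "clause_pos F k + M (clause_pos F k) + 1 = clause_pos F (Suc k)"
      using M_clause(1)[OF k] by (simp add: clause_pos_def)
    moreover have "clause_pos F k + M (clause_pos F k) < B" using M_clause(1,2)[OF k] by simp
    ultimately show "ev (Add (Add (Var 36) (Get (Var 36))) (Lit 1)) ((env @ [p, j]) @ [j, clause_pos F k, k]) =
        clause_pos F (Suc k)"
      using B by (simp only: flip: \<open>clause_pos F k + M (clause_pos F k) + 1 = clause_pos F (Suc k)\<close>)
        (intro ev_ops; simp add: env nth_append)
  qed (use env B assms length_less_B j in \<open>simp_all add: nth_append clause_pos_def\<close>)
  have 4: "ev (Loop (Get (Var 35)) (Lit 0)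
      scanE) (env @ [p, j, clause_pos F j]) = of_bool (sat (length (F ! j)))"
  proof (rule ev_Loop[where f = "\<lambda>y. of_bool (sat y)"])
    show "ev (Get (Var 35)) (env @ [p, j, clause_pos F j]) = length (F ! j)"
      using clause(1,2) by (subst ev_Get[of _ _ "clause_pos F j"]) (simp_all add: nth_append env)
    show "length (F ! j) < B" using clause(2) by simp
    show "ev (Lit 0) ((env @ [p, j, clause_pos F j]) @ [length (F ! j)]) = of_bool (sat 0)" by (simp add: sat_def)
    fix y assume y: "y < length (F ! j)"
    obtain v s where vs: "F ! j ! y = (v, s)" by fastforce
    define lit where "lit = 2 * v + of_bool s"
    have M: "M (clause_pos F j + 1 + y) = lit" using clause(3)[OF y] by (simp add: vs lit_def)
    let ?env = "(env @ [p, j, clause_pos F j]) @ [length (F ! j), of_bool (sat y), y]"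
    have A: "ev (Get (Add (Add (Var 35) (Lit 1)) (Var 38))) ?env = lit"
      unfolding M[symmetric] using y clause(2) B by (intro ev_ops) (simp_all add: nth_append env)
    have "ev litE (?env @ [lit]) = (if lit div 2 div b = i then
            (if x div 2 ^ (lit div 2 mod b) mod 2 = lit mod 2 then 1 else of_bool (sat y)) else of_bool (sat y))"
      unfolding litE_def using B by (intro ev_Ite ev_ops) (simp_all add: nth_append env)
    also have "\<dots> = of_bool (sat (Suc y))"
    proof -
      have l: "lit div 2 = v" "lit mod 2 = of_bool s" by (auto simp: lit_def)
      have "x div 2 ^ (v mod b) mod 2 = of_bool s \<longleftrightarrow> odd (x div 2 ^ (v mod b)) = s"
        by (auto simp: odd_iff_mod_2_eq_one)
      then show ?thesis unfolding l using vs by (auto simp: sat_def less_Suc_eq)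
    qed
    finally show "ev scanE ?env = of_bool (sat (Suc y))" unfolding scanE_def by (rule ev_Let[OF A])
  qed
  have "sat (length (F ! j)) \<longleftrightarrow> part_sat b i x (F ! j)"
    unfolding sat_def part_sat_def by (auto simp: in_set_conv_nth Bex_def)
  then show ?thesis
    using 4 unfolding satE_def j_def[symmetric]
    by (intro ev_Let[OF 1] ev_Let[OF 2] ev_Let) (use 3 in simp_all)
qed

end

definition clauseE :: "nat \<Rightarrow> exp" where
  "clauseE R = Ite (Eq (Mod (Div (Var 32) (Var 26)) (Lit R)) (Var 29))
     (Ite satE (Lit 1) (Var 31)) (Var 31)"

definition slotE :: "nat \<Rightarrow> nat \<Rightarrow> exp" where
  "slotE k R = Ite (Loop (Lit (R ^ k)) (Lit 0) (clauseE R)) (Var 28) (Lit 0)"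

definition covE :: "nat \<Rightarrow> nat \<Rightarrow> nat \<Rightarrow> exp" where
  "covE k R v = LetIn (Div (Var v) (Var 4)) (LetIn (Mod (Var v) (Var 4))
    (LetIn (Loop (Var 24) (Lit 1) (Mul (Var 27) (Lit R)))
    (Loop (Lit R) (Lit 1)
      (slotE k R))))"

context evaluation begin


lemma ev_covE:
  assumes env: "length env = 24" "env ! 2 = length F" "env ! 3 = b" "env ! 4 = 2 ^ b" "env ! 21 = r"
    "env ! v = a" "v < 24" and a: "a div 2 ^ b < k" and "F \<noteq> []" "length F ^ (R ^ k) < 2 ^ w"
    and R: "R ^ k < B" "0 < k" "1 < R"
  shows "ev (covE k R v) env = of_bool (covers F b R k a r)"
proof -
  define i x where "i = a div 2 ^ b" and "x = a mod 2 ^ b"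
  \<comment> \<open>The number of a block is below \<open>k\<close> and thus below
    \<open>R ^ k\<close>, which is below \<open>B\<close>. So the reduction of loop counts modulo
    \<open>B\<close> has no effect.\<close>
  have Rk: "R \<le> R ^ k" "R ^ i \<le> R ^ k" "k < R ^ k"
    using R a by (auto simp: i_def intro: power_increasing self_le_power power_gt_expt)
  have 1: "ev (Loop (Var 24) (Lit 1) (Mul (Var 27) (Lit R))) (env @ [i, x]) = R ^ i"
  proof (rule ev_Loop[where f = "\<lambda>j. R ^ j"])
    fix j assume "j < i"
    then have "R ^ Suc j \<le> R ^ i" using R by (intro power_increasing) auto
    then have "R ^ j * R < 2 ^ w" using Rk(2) R(1) B(2) unfolding power_Suc2 by linarith
    then show "ev (Mul (Var 27) (Lit R)) ((env @ [i, x]) @ [i, R ^ j, j]) = R ^ Suc j"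
      unfolding power_Suc2 using Rk R B by (intro ev_ops) (simp_all add: env nth_append)
  qed (use env B w_pos Rk R a in \<open>simp_all add: nth_append i_def\<close>)
  define good where "good e c \<longleftrightarrow> c div R ^ i mod R = e \<and>
     part_sat b i x (F ! (r div length F ^ c mod length F))" for e c
  have inner: "ev (Loop (Lit (R ^ k)) (Lit 0)
             (clauseE R)) (env @ [i, x, R ^ i, R, s, e]) =
      of_bool (\<exists>c < R ^ k. good e c)" for s e
  proof (rule ev_Loop[where f = "\<lambda>j. of_bool (\<exists>c<j. good e c)"])
    fix j assume j: "j < R ^ k"
    let ?env = "(env @ [i, x, R ^ i, R, s, e]) @ [R ^ k, of_bool (\<exists>c<j. good e c), j]"
    have "length F ^ j \<le> length F ^ (R ^ k)" using j \<open>F \<noteq> []\<close> by (intro power_increasing) (auto simp: Suc_leI)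
    then have sat: "ev satE ?env = of_bool (part_sat b i x (F ! (r div length F ^ j mod length F)))"
      using j assms by (intro ev_satE) (simp_all add: nth_append)
    have "ev (clauseE R) ?env =
        (if j div R ^ i mod R = e then
          (if part_sat b i x (F ! (r div length F ^ j mod length F)) then 1 else of_bool (\<exists>c<j. good e c))
         else of_bool (\<exists>c<j. good e c))"
      unfolding clauseE_def using B R Rk w_pos by (intro ev_Ite sat ev_ops) (simp_all add: nth_append env)
    also have "\<dots> = of_bool (\<exists>c<Suc j. good e c)" by (auto simp: good_def less_Suc_eq)
    finally show "ev (clauseE R) ?env = of_bool (\<exists>c<Suc j. good e c)" .
  qed (use B R in simp_all)
  have 2: "ev (Loop (Lit R) (Lit 1)
      (slotE k R)) (env @ [i, x, R ^ i]) = of_bool (\<forall>e<R. \<exists>c < R ^ k. good e c)"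
  proof (rule ev_Loop[where f = "\<lambda>j. of_bool (\<forall>e<j. \<exists>c < R ^ k. good e c)"])
    fix j assume j: "j < R"
    let ?s = "of_bool (\<forall>e<j. \<exists>c < R ^ k. good e c) :: nat"
    have "ev (slotE k R) (env @ [i, x, R ^ i, R, ?s, j]) = (if \<exists>c < R ^ k. good j c then ?s else 0)"
      unfolding slotE_def by (intro ev_Ite inner ev_ops) (simp_all add: nth_append env)
    also have "\<dots> = of_bool (\<forall>e<Suc j. \<exists>c < R ^ k. good e c)" by (auto simp: less_Suc_eq)
    finally show "ev (slotE k R) ((env @ [i, x, R ^ i]) @ [R, ?s, j]) = of_bool (\<forall>e<Suc j. \<exists>c < R ^ k. good e c)"
      by simp
  qed (use B R Rk w_pos in simp_all)
  have 3: "ev (Div (Var v) (Var 4)) env = i" "ev (Mod (Var v) (Var 4)) (env @ [i]) = x"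
    unfolding i_def x_def using env by (intro ev_ops; simp add: nth_append)+
  show ?thesis
    unfolding covE_def covers_def i_def[symmetric] x_def[symmetric] good_def[symmetric]
    by (intro ev_Let[OF 3(1)] ev_Let[OF 3(2)] ev_Let[of _ _ "R ^ i"]) (use 1 2 in simp_all)
qed

end

lemma nth_concat_pairs:
  "i < 2 * length es \<Longrightarrow> concat (map (\<lambda>(u, v). [u, v]) es) ! i =
     (if even i then fst (es ! (i div 2)) else snd (es ! (i div 2)))"
proof (induction es arbitrary: i)
  case (Cons e es)
  obtain u v where e: "e = (u, v)" by fastforce
  show ?case
  proof (cases "i < 2")
    case True
    then have "i = 0 \<or> i = 1" by auto
    then show ?thesis by (auto simp: e)
  next
    case False
    then obtain j where "i = Suc (Suc j)" by (metis add_2_eq_Suc le_Suc_ex not_less)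
    then show ?thesis using Cons by (simp add: e)
  qed
qed simp

lemma length_encode_graph: "length (encode_graph n es) = 2 * length es + 2"
  by (induction es) (auto simp: encode_graph_def)

text \<open>One more than the quotient, so that \<open>N < k * nbits k N\<close> and
  \<open>k\<close> blocks hold all variables.\<close>

definition nbits :: "nat \<Rightarrow> nat \<Rightarrow> nat" where "nbits k N = N div k + 1"

text \<open>Each of the \<open>k + 1\<close> centers chooses at most two elements.\<close>

definition slots :: "nat \<Rightarrow> nat" where "slots k = 2 * (k + 1)"

definition elems :: "nat \<Rightarrow> nat \<Rightarrow> nat" where "elems k N = k * 2 ^ nbits k N"

text \<open>The factor \<open>k + 2\<close> makes more copies of every test than there are centers.\<close>

definition tests :: "nat \<Rightarrow> cnf \<Rightarrow> nat" where
  "tests k F = length F ^ (slots k ^ k) * (k + 2)"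

abbreviation red_cov :: "nat \<Rightarrow> nat \<Rightarrow> cnf \<Rightarrow> nat \<Rightarrow> nat \<Rightarrow> bool" where
  "red_cov k N F \<equiv> covers F (nbits k N) (slots k) k"

locale reduction =
  fixes k l N :: nat and F :: cnf
  assumes k_pos: "k \<ge> 1" and l_pos: "l \<ge> 1"
begin

sublocale G: cover_graph "elems k N" "tests k F" l "red_cov k N F"
  using k_pos l_pos by unfold_locales (simp_all add: elems_def)

text \<open>The ends of an edge are consecutive positions on the same path, so the parity of the
  cell index can be added to the position and both ends are instances of
  \<open>node\<close>.\<close>

lemma nth_encode_graph:
  assumes "t < 2 * (l * G.edges) + 2"
  shows "encode_graph G.order G.edge_list ! t = (if t = 0 then G.order else if t = 1 then l * G.edges
    else G.node ((t - 2) div 2 div l) ((t - 2) div 2 mod l + t mod 2))"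
proof (cases "t < 2")
  case True
  then have "t = 0 \<or> t = 1" by auto
  then show ?thesis by (auto simp: encode_graph_def)
next
  case False
  then obtain i where i: "t = Suc (Suc i)" by (metis add_2_eq_Suc le_Suc_ex not_less)
  then have "i div 2 < l * G.edges" using assms by auto
  then have "G.edge_list ! (i div 2) = (G.node (i div 2 div l) (i div 2 mod l), G.node (i div 2 div l) (Suc (i div 2 mod l)))"
    unfolding G.edge_list_def by simp
  moreover have "concat (map (\<lambda>(u, v). [u, v]) G.edge_list) ! i =
     (if even i then fst (G.edge_list ! (i div 2)) else snd (G.edge_list ! (i div 2)))"
    using assms i by (intro nth_concat_pairs) simp
  ultimately show ?thesis by (auto simp: i encode_graph_def odd_iff_mod_2_eq_one)
qed

end

text \<open>
  Levels: 0 index of the cell, 1 to 13 the list \<open>penv\<close> below, 14 edge of the subdivided graph, 15 edge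
  of the core graph, 16 position on it, 19 index of the \<open>Mid\<close> vertex, which is split into
  21 test, 22 and 23 elements.
\<close>

definition ownE :: exp where
  "ownE = LetIn (Add (Mul (Lit 4) (Var 5)) (Var 6))
    (Ite (Less (Var 15) (Var 17)) (Add (Var 15) (Lit 1))
      (Add (Add (Lit 1) (Var 17)) (Div (Sub (Var 15) (Var 17)) (Lit 2))))"

definition targE :: "nat \<Rightarrow> exp" where
  "targE k = Ite (covE k (slots k) 22)
    (Ite (Eq (Var 23) (Var 5)) (Mul (Lit 4) (Add (Var 22) (Lit 1)))
      (Ite (Eq (Var 23) (Var 22)) (Add (Var 10) (Var 21))
        (Ite (covE k (slots k) 23) (Add (Var 9) (Add (Mul (Var 21) (Var 5)) (Var 23)))
          (Add (Var 10) (Var 21)))))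
    (Lit 0)"

definition secondE :: "nat \<Rightarrow> exp" where
  "secondE k = LetIn (Div (Var 20) (Var 5)) (LetIn (Mod (Var 20) (Var 5))
    (LetIn (Mod (Var 19) (Add (Var 5) (Lit 1))) (targE k)))"

definition halfE :: "nat \<Rightarrow> exp" where
  "halfE k = Ite (Eq (Mod (Sub (Var 15) (Var 18)) (Lit 2)) (Lit 0)) (Add (Var 9) (Var 20)) (secondE k)"

definition midE :: "nat \<Rightarrow> exp" where
  "midE k = LetIn (Div (Sub (Var 15) (Var 18)) (Lit 2))
    (LetIn (Div (Var 19) (Add (Var 5) (Lit 1))) (halfE k))"

definition kindE :: "nat \<Rightarrow> exp" where
  "kindE k = Ite (Less (Var 15) (Var 17)) (Ite (Eq (Mod (Var 15) (Lit 4)) (Lit 0)) (Lit 0) (Var 15))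
      (Ite (Less (Var 15) (Var 18)) (Add (Var 10) (Sub (Var 15) (Var 17))) (midE k))"

definition otherE :: "nat \<Rightarrow> exp" where
  "otherE k = LetIn (Mul (Lit 4) (Var 5)) (LetIn (Add (Var 17) (Var 6))
    (kindE k))"

definition nodeE :: "nat \<Rightarrow> nat \<Rightarrow> exp" where
  "nodeE k l = Ite (Eq (Var 16) (Lit 0)) (otherE k) (Ite (Eq (Var 16) (Lit l)) ownE
      (Add (Add (Var 11) (Mul (Var 15) (Lit (l - 1)))) (Sub (Var 16) (Lit 1))))"

definition endpointE :: "nat \<Rightarrow> nat \<Rightarrow> exp" where
  "endpointE k l = LetIn (Div (Sub (Var 0) (Lit 2)) (Lit 2)) (LetIn (Div (Var 14) (Lit l))
    (LetIn (Add (Mod (Var 14) (Lit l)) (Mod (Var 0) (Lit 2))) (nodeE k l)))"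

definition cellE :: "nat \<Rightarrow> nat \<Rightarrow> exp" where
  "cellE k l = Ite (Eq (Var 0) (Lit 0)) (Var 12) (Ite (Eq (Var 0) (Lit 1)) (Var 13)
    (endpointE k l))"

text \<open>The sizes of the graph are recomputed for every cell, which costs only a polynomial
  factor.\<close>

definition with_params :: "nat \<Rightarrow> nat \<Rightarrow> exp \<Rightarrow> exp" where
  "with_params k l e = LetIn (Get (Lit 0)) (LetIn (Get (Lit 1))
    (LetIn (Add (Div (Var 1) (Lit k)) (Lit 1))
    (LetIn (Shl (Lit 1) (Var 3))
    (LetIn (Mul (Lit k) (Var 4))
    (LetIn (Mul (Loop (Lit (slots k ^ k)) (Lit 1) (Mul (Var 7) (Var 2))) (Lit (k + 2)))
    (LetIn (Mul (Mul (Var 6) (Var 5)) (Add (Var 5) (Lit 1)))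
    (LetIn (Add (Add (Mul (Lit 4) (Var 5)) (Var 6)) (Mul (Lit 2) (Var 7)))
    (LetIn (Add (Add (Add (Lit 1) (Mul (Lit 4) (Var 5))) (Var 6)) (Var 7))
    (LetIn (Add (Var 9) (Mul (Var 6) (Var 5)))
    (LetIn (Add (Var 10) (Var 6))
    (LetIn (Add (Var 11) (Mul (Var 8) (Lit (l - 1))))
    (LetIn (Mul (Lit l) (Var 8)) e))))))))))))"

section \<open>Evaluation of the expressions without overflow\<close>

locale reduction_eval = reduction k l N F + evaluation w B N F M
  for k l N :: nat and F :: cnf and w B :: nat and M :: "nat \<Rightarrow> nat" +
  assumes cst: "slots k ^ k < B" "l < B" "k + 2 < B"
    and big: "G.order + 2 * (l * G.edges) + 2 < 2 ^ w"
begin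

definition penv :: "nat \<Rightarrow> nat list" where
  "penv t = [t, N, length F, nbits k N, 2 ^ nbits k N, elems k N, tests k F, G.mids, G.edges,
     G.gate0, G.hub0, G.verts, G.order, l * G.edges]"

text \<open>Every size that is computed is bounded in terms of the order and the number of edges, so
  the single assumption \<open>big\<close> rules out overflows.\<close>

lemma bounds:
  "nbits k N < 2 ^ w" "2 ^ nbits k N < (2 :: nat) ^ w" "elems k N < 2 ^ w" "tests k F < 2 ^ w" "G.mids < 2 ^ w"
  "G.edges < 2 ^ w" "G.gate0 < 2 ^ w" "G.hub0 < 2 ^ w" "G.verts < 2 ^ w" "G.order < 2 ^ w" "l * G.edges < 2 ^ w"
  "length F ^ (slots k ^ k) < 2 ^ w" "tests k F * elems k N < 2 ^ w" "elems k N + 1 < 2 ^ w"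
  "4 * elems k N + tests k F + 1 < 2 ^ w" "2 * G.mids < 2 ^ w" "2 * (l * G.edges) + 2 < 2 ^ w"
proof -
  have e: "G.edges \<le> l * G.edges" using l_pos by (cases l) auto
  have h: "2 ^ nbits k N \<le> elems k N" using k_pos by (cases k) (auto simp: elems_def)
  have n: "elems k N \<ge> 1" using G.n_pos .
  have nb: "nbits k N < 2 ^ nbits k N" by (rule less_exp)
  have t: "length F ^ (slots k ^ k) \<le> tests k F" by (simp add: tests_def)
  note defs = G.edges_def G.order_def G.verts_def G.hub0_def G.gate0_def G.mid0_def
  show "2 ^ nbits k N < (2 :: nat) ^ w" "elems k N < 2 ^ w" "tests k F < 2 ^ w" "G.mids < 2 ^ w"
    "G.edges < 2 ^ w" "G.gate0 < 2 ^ w" "G.hub0 < 2 ^ w" "G.verts < 2 ^ w" "G.order < 2 ^ w" "l * G.edges < 2 ^ w"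
    "length F ^ (slots k ^ k) < 2 ^ w" "tests k F * elems k N < 2 ^ w" "elems k N + 1 < 2 ^ w"
    "4 * elems k N + tests k F + 1 < 2 ^ w" "2 * G.mids < 2 ^ w" "2 * (l * G.edges) + 2 < 2 ^ w"
    using big e h n t defs by linarith+
  then show "nbits k N < 2 ^ w" using nb by linarith
qed

lemma lits: "k < 2 ^ w" "k + 2 < 2 ^ w" "l < 2 ^ w" "l - 1 < 2 ^ w" "slots k ^ k < 2 ^ w" "(0::nat) < 2 ^ w"
    "(1::nat) < 2 ^ w" "(2::nat) < 2 ^ w" "(4::nat) < 2 ^ w"
  using cst B by linarith+

lemma ev_tests:
  assumes "length env = 6" "env ! 2 = length F"
  shows "ev (Mul (Loop (Lit (slots k ^ k)) (Lit 1) (Mul (Var 7) (Var 2))) (Lit (k + 2))) env = tests k F"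
proof -
  have "ev (Loop (Lit (slots k ^ k)) (Lit 1) (Mul (Var 7) (Var 2))) env = length F ^ (slots k ^ k)"
  proof (rule ev_Loop[where f = "\<lambda>j. length F ^ j"])
    fix j assume j: "j < slots k ^ k"
    show "ev (Mul (Var 7) (Var 2)) (env @ [slots k ^ k, length F ^ j, j]) = length F ^ Suc j"
    proof (cases "F = []")
      case True
      then show ?thesis using assms by (simp add: nth_append)
    next
      case False
      then have "length F ^ Suc j \<le> length F ^ (slots k ^ k)" using j by (intro power_increasing) (auto simp: Suc_leI)
      then have "length F ^ j * length F < 2 ^ w" using bounds(12) unfolding power_Suc2 by linarith
      then show ?thesis unfolding power_Suc2 by (intro ev_ops) (simp_all add: assms nth_append)
    qed
  qed (use lits cst w_pos in simp_all)
  then show ?thesis unfolding tests_def using lits bounds(4) by (intro ev_ops) (simp_all add: tests_def)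
qed

lemma ev_with_params: "ev (with_params k l e) [t] = ev e (penv t)"
proof -
  have 1: "ev (Get (Lit 0)) [t] = N" and 2: "ev (Get (Lit 1)) [t, N] = length F"
    using M_0 M_1 B w_pos by simp_all
  have 3: "ev (Add (Div (Var 1) (Lit k)) (Lit 1)) [t, N, length F] = nbits k N"
    unfolding nbits_def using lits bounds(1) by (intro ev_ops) (simp_all add: nbits_def)
  have 4: "ev (Shl (Lit 1) (Var 3)) [t, N, length F, nbits k N] = 2 ^ nbits k N"
    using lits bounds(2) by (subst ev_Shl[of _ _ 1 _ "nbits k N"]) simp_all
  have 5: "ev (Mul (Lit k) (Var 4)) [t, N, length F, nbits k N, 2 ^ nbits k N] = elems k N"
    unfolding elems_def using lits bounds(3) by (intro ev_ops) (simp_all add: elems_def)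
  let ?p = "[t, N, length F, nbits k N, 2 ^ nbits k N, elems k N]"
  have 6: "ev (Mul (Loop (Lit (slots k ^ k)) (Lit 1) (Mul (Var 7) (Var 2))) (Lit (k + 2))) ?p = tests k F"
    by (rule ev_tests) simp_all
  have 7: "ev (Mul (Mul (Var 6) (Var 5)) (Add (Var 5) (Lit 1))) (?p @ [tests k F]) = G.mids"
    unfolding G.mids_def using lits bounds(5,13,14) by (intro ev_ops) (simp_all add: G.mids_def)
  have 8: "ev (Add (Add (Mul (Lit 4) (Var 5)) (Var 6)) (Mul (Lit 2) (Var 7)))
      (?p @ [tests k F, G.mids]) = G.edges"
    unfolding G.edges_def using lits bounds(6,15,16) by (intro ev_ops) (simp_all add: G.edges_def)
  have 9: "ev (Add (Add (Add (Lit 1) (Mul (Lit 4) (Var 5))) (Var 6)) (Var 7))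
      (?p @ [tests k F, G.mids, G.edges]) = G.gate0"
    unfolding G.gate0_def G.mid0_def using lits bounds(7,15)
    by (intro ev_ops) (simp_all add: G.gate0_def G.mid0_def)
  have 10: "ev (Add (Var 9) (Mul (Var 6) (Var 5)))
      (?p @ [tests k F, G.mids, G.edges, G.gate0]) = G.hub0"
    unfolding G.hub0_def using lits bounds(8,13) by (intro ev_ops) (simp_all add: G.hub0_def)
  have 11: "ev (Add (Var 10) (Var 6)) (?p @ [tests k F, G.mids, G.edges, G.gate0, G.hub0]) = G.verts"
    unfolding G.verts_def using bounds(9) by (intro ev_ops) (simp_all add: G.verts_def)
  have 12: "ev (Add (Var 11) (Mul (Var 8) (Lit (l - 1))))
      (?p @ [tests k F, G.mids, G.edges, G.gate0, G.hub0, G.verts]) = G.order"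
    unfolding G.order_def using lits bounds(10) by (intro ev_ops) (simp_all add: G.order_def)
  have 13: "ev (Mul (Lit l) (Var 8))
      (?p @ [tests k F, G.mids, G.edges, G.gate0, G.hub0, G.verts, G.order]) = l * G.edges"
    using lits bounds(11) by (intro ev_ops) simp_all
  note flat = append_Cons append_Nil
  show ?thesis
    by (simp only: with_params_def penv_def eval.simps(6) flat 1 2 3 4 5 6 7[unfolded flat] 8[unfolded flat]
        9[unfolded flat] 10[unfolded flat] 11[unfolded flat] 12[unfolded flat] 13[unfolded flat])
qed

lemma penv_nth [simp]: "length (penv t) = 14" "penv t ! 0 = t" "penv t ! 1 = N" "penv t ! 2 = length F"
  "penv t ! 3 = nbits k N" "penv t ! 4 = 2 ^ nbits k N" "penv t ! 5 = elems k N" "penv t ! 6 = tests k F"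
  "penv t ! 7 = G.mids" "penv t ! 8 = G.edges" "penv t ! 9 = G.gate0" "penv t ! 10 = G.hub0"
  "penv t ! 11 = G.verts" "penv t ! 12 = G.order" "penv t ! 13 = l * G.edges"
  by (simp_all add: penv_def)

lemma ev_ownE:
  assumes "z < G.edges" shows "ev ownE (penv t @ [y, z, p]) = G.own z"
proof -
  let ?c = "4 * elems k N + tests k F"
  have c: "ev (Add (Mul (Lit 4) (Var 5)) (Var 6)) (penv t @ [y, z, p]) = ?c"
    using lits bounds(15) by (intro ev_ops) (simp_all add: nth_append)
  have z: "z < 2 ^ w" "z + 1 < 2 ^ w" using assms bounds(6) by linarith+
  have zm: "z + 1 \<le> G.verts" if "z < ?c" using that by (simp add: G.verts_def G.hub0_def G.gate0_def G.mid0_def)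
  have "1 + ?c + (z - ?c) div 2 < 2 ^ w"
  proof -
    have "(z - ?c) div 2 \<le> G.mids" using assms by (simp add: G.edges_def)
    then have "1 + ?c + (z - ?c) div 2 \<le> G.gate0" by (simp add: G.gate0_def G.mid0_def)
    then show ?thesis using bounds(7) by linarith
  qed
  then have "ev (Ite (Less (Var 15) (Var 17)) (Add (Var 15) (Lit 1))
      (Add (Add (Lit 1) (Var 17)) (Div (Sub (Var 15) (Var 17)) (Lit 2))))
      (penv t @ [y, z, p, ?c]) = (if z < ?c then z + 1 else 1 + ?c + (z - ?c) div 2)"
    using lits z by (intro ev_Ite ev_ops) (simp_all add: nth_append)
  then show ?thesis
    unfolding ownE_def G.own_def G.mid0_def by (intro ev_Let[OF c]) (simp add: add.assoc)
qed

lemma ev_targE: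
  assumes "r < tests k F" "a < elems k N" "a' \<le> elems k N"
  shows "ev (targE k) (penv t @ [y, z, p, c, c', y', y'', r, a, a']) = G.enc (G.targ r a a')"
proof -
  let ?env = "penv t @ [y, z, p, c, c', y', y'', r, a, a']"
  have "F \<noteq> []" using assms(1) by (auto simp: tests_def power_0_left slots_def split: if_splits)
  have R: "0 < k" "1 < slots k" using k_pos by (auto simp: slots_def)
  have cov: "ev (covE k (slots k) v) ?env = of_bool (red_cov k N F x r)"
    if "v = 22 \<and> x = a \<or> v = 23 \<and> x = a'" "x < elems k N" for v x
    using that R cst bounds(12) \<open>F \<noteq> []\<close>
    by (intro ev_covE) (auto simp: nth_append elems_def less_mult_imp_div_less)
  have valid: "G.valid (G.targ r a a')" using assms by (rule G.valid_targ)
  have hub: "G.hub0 + r < 2 ^ w" using assms(1) bounds(9) by (simp add: G.verts_def)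
  \<comment> \<open>The number of \<open>Leg a 3\<close> is 1 + (4a + 3) = 4(a + 1).\<close>
  have leg: "4 * (a + 1) < 2 ^ w" proof -
    have "4 * (a + 1) \<le> 4 * elems k N" using assms(2) by simp
    then show ?thesis using bounds(15) by linarith
  qed
  have gate: "G.gate0 + (r * elems k N + a') < 2 ^ w" if "a' < elems k N"
    using G.enc_less[of "Gate r a'"] that assms(1) bounds(9) by simp
  have "ev (targE k) ?env = (if red_cov k N F a r then
      (if a' = elems k N then 4 * (a + 1) else if a' = a then G.hub0 + r else
        if red_cov k N F a' r then G.gate0 + (r * elems k N + a') else G.hub0 + r) else 0)"
    unfolding targE_def
    by (intro ev_Ite cov ev_ops)
      (use assms hub leg gate lits in \<open>simp_all add: nth_append\<close>)
  also have "\<dots> = G.enc (G.targ r a a')" by (auto simp: G.targ_def)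
  finally show ?thesis .
qed

lemma ev_otherE:
  assumes "z < G.edges" shows "ev (otherE k) (penv t @ [y, z, p]) = G.other z"
proof -
  let ?n = "elems k N"
  define c where "c = 4 * ?n"
  define c' where "c' = c + tests k F"
  define y' where "y' = (z - c') div 2"
  define u where "u = y' div (?n + 1)"
  define r where "r = u div ?n"
  define a where "a = u mod ?n"
  define a' where "a' = y' mod (?n + 1)"
  have z: "z < 2 ^ w" using assms bounds(6) by linarith
  have c: "ev (Mul (Lit 4) (Var 5)) (penv t @ [y, z, p]) = c"
    unfolding c_def using lits bounds(15) by (intro ev_ops) (simp_all add: nth_append)
  have c': "ev (Add (Var 17) (Var 6)) (penv t @ [y, z, p, c]) = c'"
    unfolding c'_def using lits bounds(15) by (intro ev_ops) (simp_all add: nth_append c_def)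
  let ?env = "penv t @ [y, z, p, c, c']"
  have hub: "G.hub0 + (z - c) < 2 ^ w" if "z < c'"
    using that bounds(9) \<open>z < 2 ^ w\<close> by (simp add: G.verts_def c'_def)
  have y: "ev (Div (Sub (Var 15) (Var 18)) (Lit 2)) ?env = y'" if "\<not> z < c'"
    unfolding y'_def using that lits z by (intro ev_ops) (simp_all add: nth_append)
  have y': "ev (Div (Var 19) (Add (Var 5) (Lit 1))) (?env @ [y']) = u"
    unfolding u_def using lits bounds(14) by (intro ev_ops) (simp_all add: nth_append)
  have rest: "ev (secondE k) (?env @ [y', u]) =
      G.enc (G.targ r a a')" if "\<not> z < c'"
  proof -
    have "y' < G.mids" using assms that by (auto simp: G.edges_def y'_def c'_def c_def)
    then have "u < tests k F * ?n" unfolding G.mids_def u_def by (rule less_mult_imp_div_less)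
    then have "r < tests k F" unfolding r_def by (rule less_mult_imp_div_less)
    moreover have "a < ?n" using G.n_pos by (simp add: a_def)
    moreover have "a' \<le> ?n" using mod_less_divisor[of "?n + 1" y'] unfolding a'_def by linarith
    ultimately have targ: "ev (targE k) (?env @ [y', u, r, a, a']) = G.enc (G.targ r a a')"
      using ev_targE[of r a a' t y z p c c' y' "u"] by simp
    have 1: "ev (Div (Var 20) (Var 5)) (?env @ [y', u]) = r"
      unfolding r_def by (intro ev_ops) (simp_all add: nth_append)
    have 2: "ev (Mod (Var 20) (Var 5)) (?env @ [y', u, r]) = a"
      unfolding a_def by (intro ev_ops) (simp_all add: nth_append)
    have 3: "ev (Mod (Var 19) (Add (Var 5) (Lit 1))) (?env @ [y', u, r, a]) = a'"
      unfolding a'_def using lits bounds(14) by (intro ev_ops) (simp_all add: nth_append)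
    have 4: "ev (LetIn (Mod (Var 19) (Add (Var 5) (Lit 1))) (targE k))
        (?env @ [y', u, r, a]) = G.enc (G.targ r a a')"
      by (rule ev_Let[OF 3]) (use targ in \<open>simp only: append.assoc append_Cons append_Nil\<close>)
    have 5: "ev (LetIn (Mod (Var 20) (Var 5)) (LetIn (Mod (Var 19) (Add (Var 5) (Lit 1))) (targE k)))
        (?env @ [y', u, r]) = G.enc (G.targ r a a')"
      by (rule ev_Let[OF 2]) (use 4 in \<open>simp only: append.assoc append_Cons append_Nil\<close>)
    show ?thesis
      unfolding secondE_def by (rule ev_Let[OF 1]) (use 5 in \<open>simp only: append.assoc append_Cons append_Nil\<close>)
  qed
  have gate: "G.gate0 + u < 2 ^ w" if "\<not> z < c'"
  proof -
    have "y' < G.mids" using assms that by (auto simp: G.edges_def y'_def c'_def c_def)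
    then have "u < tests k F * ?n" unfolding G.mids_def u_def by (rule less_mult_imp_div_less)
    then show ?thesis using bounds(8) by (simp add: G.hub0_def)
  qed
  have slot: "ev (midE k) ?env =
    (if (z - c') mod 2 = 0 then G.gate0 + u else G.enc (G.targ r a a'))" if nz: "\<not> z < c'"
    unfolding midE_def
  proof (rule ev_Let[OF y[OF nz]], rule ev_Let[OF y'])
    show "ev (halfE k)
      ((?env @ [y']) @ [u]) =
      (if (z - c') mod 2 = 0 then G.gate0 + u else G.enc (G.targ r a a'))"
      unfolding halfE_def
    proof (rule ev_Ite)
      show "ev (Eq (Mod (Sub (Var 15) (Var 18)) (Lit 2)) (Lit 0)) ((?env @ [y']) @ [u]) =
          of_bool ((z - c') mod 2 = 0)"
        using nz lits z by (intro ev_ops) (simp_all add: nth_append)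
      show "ev (Add (Var 9) (Var 20)) ((?env @ [y']) @ [u]) = G.gate0 + u"
        using gate[OF nz] by (intro ev_ops) (simp_all add: nth_append)
    qed (use rest[OF nz] in simp)
  qed
  have "ev (otherE k) (penv t @ [y, z, p]) = (if z < c then (if z mod 4 = 0 then 0 else z)
      else if z < c' then G.hub0 + (z - c) else
      if (z - c') mod 2 = 0 then G.gate0 + u else G.enc (G.targ r a a'))"
    unfolding otherE_def
  proof (rule ev_Let[OF c], rule ev_Let)
    show "ev (Add (Var 17) (Var 6)) ((penv t @ [y, z, p]) @ [c]) = c'" using c' by simp
    show "ev (kindE k) (((penv t @ [y, z, p]) @ [c]) @ [c']) =
      (if z < c then (if z mod 4 = 0 then 0 else z)
      else if z < c' then G.hub0 + (z - c) else
      if (z - c') mod 2 = 0 then G.gate0 + u else G.enc (G.targ r a a'))"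
      unfolding kindE_def append.assoc append_Cons append_Nil
      by (intro ev_Ite slot ev_ops) (use hub lits z in \<open>simp_all add: nth_append\<close>)
  qed
  then show ?thesis
    unfolding G.other_def Let_def c_def c'_def y'_def u_def r_def a_def a'_def by simp
qed

lemma ev_cellE:
  assumes "t < 2 * (l * G.edges) + 2"
  shows "ev (cellE k l) (penv t) = encode_graph G.order G.edge_list ! t"
proof -
  define y z p where "y = (t - 2) div 2" and "z = y div l" and "p = y mod l + t mod 2"
  have t: "t < 2 ^ w" using assms bounds(17) by linarith
  have e: "ev (endpointE k l) (penv t) =
      G.node z p" if nt: "t \<noteq> 0" "t \<noteq> 1"
  proof -
    have "y < l * G.edges" using assms nt by (auto simp: y_def)
    then have z: "z < G.edges" unfolding z_def by (rule G.div_less_edges)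
    have "y mod l < l" "t mod 2 \<le> 1" using l_pos by auto
    then have p: "p \<le> l" unfolding p_def by linarith
    have 1: "ev (Div (Sub (Var 0) (Lit 2)) (Lit 2)) (penv t) = y"
      unfolding y_def using t nt lits by (intro ev_ops) simp_all
    have 2: "ev (Div (Var 14) (Lit l)) (penv t @ [y]) = z"
      unfolding z_def using lits by (intro ev_ops) (simp_all add: nth_append)
    have 3: "ev (Add (Mod (Var 14) (Lit l)) (Mod (Var 0) (Lit 2))) (penv t @ [y, z]) = p"
      unfolding p_def using lits p by (intro ev_ops) (simp_all add: nth_append p_def)
    have inner: "G.verts + z * (l - 1) + (p - 1) < 2 ^ w" if "p \<noteq> 0" "p \<noteq> l"
      using G.node_less[OF z p] that bounds(10) by (simp add: G.node_def)
    have "ev (nodeE k l) (penv t @ [y, z, p]) =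
      (if p = 0 then G.other z else if p = l then G.own z else G.verts + z * (l - 1) + (p - 1))"
      unfolding nodeE_def by (intro ev_Ite ev_ops ev_otherE[OF z] ev_ownE[OF z])
        (use lits p inner in \<open>simp_all add: nth_append\<close>)
    then show ?thesis
      unfolding G.node_def endpointE_def
      by (intro ev_Let[OF 1] ev_Let[OF 2] ev_Let[of _ _ p]) (simp_all only: append.assoc append_Cons append_Nil 3)
  qed
  have "ev (cellE k l) (penv t) = (if t = 0 then G.order else if t = 1 then l * G.edges else G.node z p)"
    unfolding cellE_def by (intro ev_Ite e ev_ops) (use lits in simp_all)
  also have "\<dots> = encode_graph G.order G.edge_list ! t"
    using nth_encode_graph[OF assms] by (simp add: z_def p_def y_def)
  finally show ?thesis .
qed

end

section \<open>Running time\<close>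

text \<open>The dummy value 0 takes the place of the cell index at level 0.\<close>

definition lenE :: "nat \<Rightarrow> nat \<Rightarrow> exp" where
  "lenE k l = LetIn (Lit 0) (with_params k l (Add (Mul (Lit 2) (Var 13)) (Lit 2)))"

definition log_stepE :: exp where
  "log_stepE = Ite (Less (Shl (Lit 1) (Var 15)) (Add (Var 12) (Lit 1))) (Add (Var 15) (Lit 1)) (Var 15)"

text \<open>Counts up to the least \<open>i\<close> with \<open>n + 1 \<le> 2 ^ i\<close>, where
  \<open>n\<close> is the order. With \<open>n < 2 ^ (s * (N + 1))\<close> there are enough rounds,
  and surplus rounds change nothing.\<close>

definition logE :: "nat \<Rightarrow> exp" where
  "logE s = Loop (Mul (Lit s) (Add (Var 1) (Lit 1))) (Lit 0) log_stepE"

definition wordE :: "nat \<Rightarrow> nat \<Rightarrow> nat \<Rightarrow> nat \<Rightarrow> exp" where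
  "wordE k l s c = LetIn (Lit 0) (with_params k l
    (LetIn (logE s)
    (Shl (Lit 1) (Mul (Lit c) (Var 14)))))"

text \<open>Turns the real logarithm into comparisons with powers of 2, which \<open>logE\<close>
  can evaluate.\<close>

lemma less_ceiling_log: "i < nat \<lceil>log 2 (real n + 1)\<rceil> \<longleftrightarrow> 2 ^ i < n + 1"
proof -
  have "i < nat \<lceil>log 2 (real n + 1)\<rceil> \<longleftrightarrow> real i < log 2 (real n + 1)"
    by (simp add: zless_nat_eq_int_zless less_ceiling_iff)
  also have "\<dots> \<longleftrightarrow> 2 powr real i < real n + 1" by (simp add: less_log_iff)
  also have "\<dots> \<longleftrightarrow> 2 ^ i < n + 1"
    by (simp add: powr_realpow) (metis of_nat_1 of_nat_add of_nat_less_iff of_nat_numeral of_nat_power Suc_eq_plus1 add.commute)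
  finally show ?thesis .
qed

context reduction_eval begin

lemma ev_lenE: "ev (lenE k l) [] = 2 * (l * G.edges) + 2"
proof -
  have "ev (Add (Mul (Lit 2) (Var 13)) (Lit 2)) (penv 0) = 2 * (l * G.edges) + 2"
    using lits bounds(17) by (intro ev_ops) (simp_all add: nth_append)
  then show ?thesis unfolding lenE_def by (intro ev_Let[of _ _ 0]) (simp_all add: ev_with_params)
qed

lemma ev_wordE:
  assumes s: "1 \<le> s" "s * (N + 1) < B" "s * (N + 1) < w" "c * (s * (N + 1)) < w" "c < B" "G.order < 2 ^ (s * (N + 1))"
  shows "ev (wordE k l s c) [] = 2 ^ log_word_length c G.order"
proof -
  define L where "L = nat \<lceil>log 2 (real G.order + 1)\<rceil>"
  define n where "n = s * (N + 1)"
  have Ln: "L \<le> n" using less_ceiling_log[of n G.order] s(6) by (simp add: L_def n_def not_less[symmetric])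
  have pw: "2 ^ i < (2::nat) ^ w" if "i \<le> n" for i using that s(3) by (simp add: n_def)
  have L: "i < L \<longleftrightarrow> 2 ^ i < G.order + 1" for i unfolding L_def by (rule less_ceiling_log)
  have order: "G.order + 1 < 2 ^ w" using big by linarith
  have N: "N + 1 \<le> n" using s(1) unfolding n_def by (metis mult_le_mono1 nat_mult_1)
  have nB: "n < B" "n < 2 ^ w" using s(2) B(2) by (auto simp: n_def)
  have 1: "ev (Mul (Lit s) (Add (Var 1) (Lit 1))) (penv 0) = n"
  proof -
    have "s \<le> n" by (simp add: n_def)
    then show ?thesis unfolding n_def using nB N lits by (intro ev_ops) (simp_all add: n_def penv_def)
  qed
  have 2: "ev (logE s) (penv 0) = min n L"
    unfolding logE_def
  proof (rule ev_Loop[where f = "\<lambda>j. min j L"])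
    fix j assume j: "j < n"
    have lt: "min j L + 1 < 2 ^ w" using j nB by linarith
    have "ev (Less (Shl (Lit 1) (Var 15)) (Add (Var 12) (Lit 1))) (penv 0 @ [n, min j L, j]) =
        of_bool (1 * 2 ^ min j L < G.order + 1)"
      using lits order pw[of "min j L"] j by (intro ev_ops) (simp_all add: nth_append)
    also have "1 * 2 ^ min j L < G.order + 1 \<longleftrightarrow> j < L" using L[of "min j L"] by auto
    finally have "ev log_stepE (penv 0 @ [n, min j L, j]) = (if j < L then min j L + 1 else min j L)"
      unfolding log_stepE_def by (rule ev_Ite) (use lits lt in \<open>(intro ev_ops; simp add: nth_append)+\<close>)
    also have "\<dots> = min (Suc j) L" by auto
    finally show "ev log_stepE (penv 0 @ [n, min j L, j]) = min (Suc j) L" .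
  qed (use 1 nB in simp_all)
  have "c * L \<le> c * n" using Ln by simp
  then have cL: "c * L < w" using s(4) unfolding n_def by linarith
  then have "c * L < 2 ^ w" using less_exp[of w] by linarith
  moreover have "2 ^ (c * L) < (2::nat) ^ w" using cL by simp
  ultimately have 3: "ev (Shl (Lit 1) (Mul (Lit c) (Var 14))) (penv 0 @ [L]) = 1 * 2 ^ (c * L)"
    using lits s(5) B(2) by (intro ev_ops) (simp_all add: nth_append)
  have "ev (LetIn (logE s)
    (Shl (Lit 1) (Mul (Lit c) (Var 14)))) (penv 0) = 2 ^ (c * L)"
    by (rule ev_Let[OF 2]) (use 3 Ln in \<open>simp add: min_def\<close>)
  moreover have lit: "ev (Lit 0) [] = 0" by simp
  ultimately show ?thesis
    unfolding wordE_def log_word_length_def L_def[symmetric]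
    by (simp only: eval.simps(6) lit append_Nil ev_with_params)
qed

lemma ev_cell: "t < 2 * (l * G.edges) + 2 \<Longrightarrow>
    ev (with_params k l (cellE k l)) [t] = encode_graph G.order G.edge_list ! t"
  by (simp add: ev_with_params ev_cellE)

end

lemma wf_exps: "wf_exp 0 (lenE k l)" "wf_exp 0 (wordE k l s c)" "wf_exp 1 (with_params k l (cellE k l))"
  by (simp_all add: lenE_def wordE_def logE_def log_stepE_def with_params_def cellE_def endpointE_def nodeE_def
      ownE_def otherE_def kindE_def midE_def halfE_def secondE_def targE_def covE_def slotE_def clauseE_def
      satE_def scanE_def litE_def Eq_def)

section \<open>Polynomial factors\<close>

definition poly_bounded :: "(nat \<Rightarrow> nat) \<Rightarrow> bool" where
  "poly_bounded f \<longleftrightarrow> (\<exists>C D. \<forall>N. f N \<le> C * (N + 1) ^ D)"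

lemma poly_boundedI: "(\<And>N. f N \<le> C * (N + 1) ^ D) \<Longrightarrow> poly_bounded f"
  unfolding poly_bounded_def by blast

lemma poly_bounded_const: "poly_bounded (\<lambda>N. c)"
  by (rule poly_boundedI[of _ c 0]) simp

lemma poly_bounded_id: "poly_bounded (\<lambda>N. N)"
  by (rule poly_boundedI[of _ 1 1]) simp

lemma poly_bounded_add:
  assumes "poly_bounded f" "poly_bounded g" shows "poly_bounded (\<lambda>N. f N + g N)"
proof -
  obtain C D C' D' where f: "\<And>N. f N \<le> C * (N + 1) ^ D" and g: "\<And>N. g N \<le> C' * (N + 1) ^ D'"
    using assms unfolding poly_bounded_def by blast
  show ?thesis
  proof (rule poly_boundedI[of _ "C + C'" "D + D'"])
    fix N
    have "C * (N + 1) ^ D \<le> C * (N + 1) ^ (D + D')" "C' * (N + 1) ^ D' \<le> C' * (N + 1) ^ (D + D')"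
      by (intro mult_left_mono power_increasing; simp)+
    then show "f N + g N \<le> (C + C') * (N + 1) ^ (D + D')"
      using f[of N] g[of N] unfolding add_mult_distrib by linarith
  qed
qed

lemma poly_bounded_mult:
  assumes "poly_bounded f" "poly_bounded g" shows "poly_bounded (\<lambda>N. f N * g N)"
proof -
  obtain C D C' D' where f: "\<And>N. f N \<le> C * (N + 1) ^ D" and g: "\<And>N. g N \<le> C' * (N + 1) ^ D'"
    using assms unfolding poly_bounded_def by blast
  show ?thesis
  proof (rule poly_boundedI[of _ "C * C'" "D + D'"])
    fix N
    have "f N * g N \<le> (C * (N + 1) ^ D) * (C' * (N + 1) ^ D')" using f g by (intro mult_mono) auto
    then show "f N * g N \<le> (C * C') * (N + 1) ^ (D + D')" by (simp add: power_add mult_ac)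
  qed
qed

lemma poly_bounded_power:
  assumes "poly_bounded f" shows "poly_bounded (\<lambda>N. f N ^ d)"
  by (induction d) (use assms in \<open>simp_all add: poly_bounded_const poly_bounded_mult\<close>)

lemmas poly_bounded_intros = poly_bounded_const poly_bounded_id poly_bounded_add poly_bounded_mult poly_bounded_power

lemma poly_bounded_cost: "poly_bounded B \<Longrightarrow> poly_bounded (\<lambda>N. cost (B N) e)"
  by (induction e) (simp_all only: cost.simps poly_bounded_intros)

text \<open>By \<open>N + 1 \<le> 2 ^ (N + 1)\<close>. Hence words with a linear number of bits hold
  every polynomially bounded value.\<close>

lemma poly_bounded_exp:
  assumes "poly_bounded f" shows "\<exists>c. \<forall>N. f N < 2 ^ (c * (N + 1))"
proof -
  obtain C D where f: "\<And>N. f N \<le> C * (N + 1) ^ D" using assms unfolding poly_bounded_def by blast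
  have "f N < 2 ^ ((C + D) * (N + 1))" for N
  proof -
    have "(N + 1) ^ D \<le> (2 ^ (N + 1)) ^ D" using less_exp[of "N + 1"] by (intro power_mono) auto
    then have D: "(N + 1) ^ D \<le> 2 ^ (D * (N + 1))" by (metis mult.commute power_mult)
    have "C < 2 ^ C" by (rule less_exp)
    also have "\<dots> \<le> 2 ^ (C * (N + 1))" by (rule power_increasing) auto
    finally have C: "C < 2 ^ (C * (N + 1))" .
    have "f N \<le> C * 2 ^ (D * (N + 1))" using f[of N] D by (meson le_trans mult_le_mono2)
    also have "\<dots> < 2 ^ (C * (N + 1)) * 2 ^ (D * (N + 1))" using C by simp
    finally show ?thesis unfolding power_add[symmetric] add_mult_distrib .
  qed
  then show ?thesis by blast
qed

text \<open>Bernoulli's inequality bounds \<open>N + 1\<close> by a multiple of \<open>r ^ N\<close>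
  for any \<open>r > 1\<close>, so a power of \<open>N + 1\<close> disappears in an arbitrarily
  small increase of the base.\<close>

lemma poly_times_exp_le:
  fixes s g :: real
  assumes "poly_bounded f" "0 < s" "s < g"
  shows "\<exists>K. \<forall>N. real (f N) * s ^ N \<le> K * g ^ N"
proof -
  obtain C D where f: "\<And>N. f N \<le> C * (N + 1) ^ D" using assms unfolding poly_bounded_def by blast
  \<comment> \<open>The root of order \<open>D + 1\<close> instead of \<open>D\<close> also makes
    sense for \<open>D = 0\<close>; the surplus factor \<open>r > 1\<close> is dropped at the
    end.\<close>
  define r where "r = root (Suc D) (g / s)"
  have r: "r > 1" "r ^ Suc D = g / s"
    using assms real_root_pow_pos[of "Suc D" "g / s"] by (simp_all only: r_def) simp_all
  define c where "c = 1 + 1 / (r - 1)"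
  have "real N + 1 \<le> c * r ^ N" for N
  proof -
    have "1 + real N * (r - 1) \<le> r ^ N" using Bernoulli_inequality[of "r - 1" N] r by simp
    then have N: "real N \<le> r ^ N / (r - 1)" using r by (simp add: field_simps)
    have "1 \<le> r ^ N" using r by simp
    with N show ?thesis unfolding c_def by (simp add: algebra_simps)
  qed
  then have N: "(real N + 1) ^ D \<le> (c * r ^ N) ^ D" for N by (intro power_mono) auto
  have c: "c \<ge> 0" using r by (simp add: c_def)
  have "real (f N) * s ^ N \<le> (real C * c ^ D) * g ^ N" for N
  proof -
    have "real (f N) \<le> real (C * (N + 1) ^ D)" using f[of N] by (rule of_nat_mono)
    also have "\<dots> = real C * (real N + 1) ^ D" by (simp add: algebra_simps)
    also have "\<dots> \<le> real C * (c * r ^ N) ^ D" using N[of N] by (rule mult_left_mono) simp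
    also have "\<dots> = real C * c ^ D * (r ^ D) ^ N"
      by (simp add: power_mult_distrib power_mult[symmetric] mult.commute)
    also have "\<dots> \<le> real C * c ^ D * (g / s) ^ N"
    proof (intro mult_left_mono power_mono)
      have "r ^ D * 1 \<le> r ^ D * r" using r by (intro mult_left_mono) auto
      then show "r ^ D \<le> g / s" using r(2) by (simp add: mult.commute)
    qed (use r c in auto)
    finally have "real (f N) * s ^ N \<le> real C * c ^ D * (g / s) ^ N * s ^ N"
      using assms by (intro mult_right_mono) auto
    also have "\<dots> = real C * c ^ D * g ^ N" using assms by (simp add: power_divide)
    finally show ?thesis .
  qed
  then show ?thesis by blast
qed

text \<open>Clauses are lists, so this bounds the number of lists of at most \<open>q\<close> of the
  \<open>2 * N\<close> literals. With \<open>N + 1\<close> the base is positive and all shorter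
  lengths are dominated by length \<open>q\<close>.\<close>

definition clause_bound :: "nat \<Rightarrow> nat \<Rightarrow> nat" where
  "clause_bound q N = (q + 1) * (2 * (N + 1)) ^ q"

lemma length_qcnf:
  assumes "is_qcnf q N F" shows "length F \<le> clause_bound q N"
proof -
  let ?A = "{..<N} \<times> (UNIV :: bool set)"
  have "set F \<subseteq> {C. set C \<subseteq> ?A \<and> length C \<le> q}" using assms by (auto simp: is_qcnf_def)
  then have "card (set F) \<le> card {C. set C \<subseteq> ?A \<and> length C \<le> q}"
    by (intro card_mono finite_lists_length_le) auto
  also have "\<dots> = (\<Sum>i\<le>q. card ?A ^ i)" by (rule card_lists_length_le) simp
  also have "\<dots> \<le> (\<Sum>i\<le>q. (2 * (N + 1)) ^ q)"
  proof (rule sum_mono)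
    fix i assume "i \<in> {..q}"
    then have "card ?A ^ i \<le> (2 * (N + 1)) ^ i" "(2 * (N + 1)) ^ i \<le> (2 * (N + 1)) ^ q"
      by (intro power_mono power_increasing; simp)+
    then show "card ?A ^ i \<le> (2 * (N + 1)) ^ q" by linarith
  qed
  finally show ?thesis using assms by (simp add: is_qcnf_def distinct_card clause_bound_def)
qed

lemma length_encode_cnf:
  assumes "is_qcnf q N F" shows "length (encode_cnf N F) \<le> 2 + clause_bound q N * (q + 1)"
proof -
  have "length (concat (map (\<lambda>C. length C # map (\<lambda>(i, b). 2 * i + of_bool b) C) G)) \<le> length G * (q + 1)"
    if "set G \<subseteq> set F" for G
    using that
  proof (induction G)
    case (Cons C G)
    then have "length C \<le> q" using assms by (auto simp: is_qcnf_def)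
    then show ?case using Cons by simp
  qed simp
  from this[of F] have "length (encode_cnf N F) \<le> 2 + length F * (q + 1)" by (simp add: encode_cnf_def)
  also have "\<dots> \<le> 2 + clause_bound q N * (q + 1)"
    using length_qcnf[OF assms] by (intro add_mono mult_right_mono) auto
  finally show ?thesis .
qed

lemma encode_cnf_entries:
  assumes "is_qcnf q N F" "x \<in> set (encode_cnf N F)"
  shows "x = length F \<or> x \<le> q + 2 * N + 1"
proof -
  have "x = N \<or> x = length F \<or> (\<exists>C\<in>set F. x = length C \<or> (\<exists>(i, b)\<in>set C. x = 2 * i + of_bool b))"
    using assms(2) by (force simp: encode_cnf_def)
  then show ?thesis using assms(1) by (force simp: is_qcnf_def)
qed

section \<open>The radius and the size of the graph of a formula\<close>

context reduction begin

lemma tests_Nil: "tests k [] = 0"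
proof -
  have "slots k ^ k > 0" by (simp add: slots_def)
  then have "(0::nat) ^ (slots k ^ k) = 0" by (rule zero_power)
  then show ?thesis by (simp only: tests_def list.size mult_0)
qed

lemma radius_satisfiable:
  assumes "is_qcnf q N F" "satisfiable F" shows "G.radius (k + 1) \<le> enat (5 * l)"
proof -
  have "N < k * nbits k N"
    using k_pos mod_less_divisor[of k N] mult_div_mod_eq[of k N] unfolding nbits_def add_mult_distrib2
    by linarith
  then have vars: "v < k * nbits k N" if "C \<in> set F" "(v, s) \<in> set C" for C v s
    using assms(1) that unfolding is_qcnf_def by force
  obtain A where "A \<subseteq> {..<k * 2 ^ nbits k N} \<and> card A = k \<and> (\<forall>t. F \<noteq> [] \<longrightarrow> (\<exists>a\<in>A. red_cov k N F a t))"
    using covers_of_satisfiable[OF assms(2) vars, where R = "slots k"] by (rule exE)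
  then have A: "A \<subseteq> {..<elems k N}" "card A = k" "\<And>t. F \<noteq> [] \<Longrightarrow> \<exists>a\<in>A. red_cov k N F a t"
    unfolding elems_def by blast+
  have "\<exists>a\<in>A. red_cov k N F a r" if "r < tests k F" for r
    using that tests_Nil by (intro A(3)) auto
  from G.radius_le[OF A(1) this] show ?thesis using A(2) by simp
qed

lemma radius_unsatisfiable:
  assumes "\<not> satisfiable F" shows "enat (9 * l) \<le> G.radius (k + 1)"
proof (rule G.radius_ge)
  fix A X :: "nat set" assume A: "A \<subseteq> {..<elems k N}" "card A \<le> 2 * (k + 1)" "finite X" "card X \<le> k + 1"
  have "finite A" using A(1) finite_subset by blast
  then obtain t where t: "t < tests k F" "t \<notin> X"
    "\<And>a. a \<in> A \<Longrightarrow> a div 2 ^ nbits k N < k \<Longrightarrow> \<not> red_cov k N F a t"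
    using escape_of_unsatisfiable[OF assms, of A "slots k" X "k + 2" k "nbits k N"] A
    unfolding tests_def slots_def by auto
  have "a div 2 ^ nbits k N < k" if "a \<in> A" for a
    using that A(1) by (auto simp: elems_def intro: less_mult_imp_div_less)
  with t show "\<exists>r<tests k F. r \<notin> X \<and> (\<forall>a\<in>A. \<not> red_cov k N F a r)" by blast
qed

end

text \<open>For \<open>n\<close> elements and \<open>T\<close> tests there are at most
  \<open>(4 + 5 * T) * n\<^sup>2\<close> core edges: \<open>4 * n\<close> in legs, \<open>T\<close>
  at tips and twice \<open>T * (n\<^sup>2 + n)\<close> at \<open>Mid\<close> vertices. The factor
  \<open>4 ^ b\<close> of \<open>n\<^sup>2 = k\<^sup>2 * 4 ^ b\<close> is split off.\<close>

definition size_bound :: "nat \<Rightarrow> nat \<Rightarrow> nat \<Rightarrow> nat \<Rightarrow> nat" where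
  "size_bound k l q N = l * ((4 + 5 * (clause_bound q N ^ (slots k ^ k) * (k + 2))) * k\<^sup>2)"

lemma four_power: "(4::nat) ^ b = (2 ^ b)\<^sup>2"
proof -
  have "(4::nat) ^ b = (2\<^sup>2) ^ b" by simp
  also have "\<dots> = 2 ^ (b * 2)" by (simp only: power_mult[symmetric] mult.commute)
  finally show ?thesis by (simp only: power_mult)
qed

lemma (in reduction) size_le:
  assumes "is_qcnf q N F" shows "l * G.edges \<le> size_bound k l q N * 4 ^ nbits k N"
proof -
  let ?n = "elems k N" and ?T = "clause_bound q N ^ (slots k ^ k) * (k + 2)"
  have T: "tests k F \<le> ?T" unfolding tests_def using length_qcnf[OF assms] by (intro mult_right_mono power_mono) auto
  have n: "1 \<le> ?n" "?n \<le> ?n\<^sup>2" "1 \<le> ?n\<^sup>2" using G.n_pos by (auto simp: power2_eq_square)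
  have "tests k F * 1 \<le> ?T * ?n\<^sup>2" using T n by (intro mult_mono) auto
  moreover have "G.mids \<le> ?T * (2 * ?n\<^sup>2)"
  proof -
    have "G.mids = tests k F * (?n\<^sup>2 + ?n)" by (simp add: G.mids_def power2_eq_square algebra_simps)
    also have "\<dots> \<le> ?T * (2 * ?n\<^sup>2)" using T n by (intro mult_mono) auto
    finally show ?thesis .
  qed
  ultimately have "G.edges \<le> 4 * ?n\<^sup>2 + ?T * ?n\<^sup>2 + 2 * (?T * (2 * ?n\<^sup>2))"
    using n unfolding G.edges_def by linarith
  also have "\<dots> = (4 + 5 * ?T) * ?n\<^sup>2" by (simp add: algebra_simps)
  also have "?n\<^sup>2 = k\<^sup>2 * 4 ^ nbits k N"
    by (simp only: elems_def power_mult_distrib four_power)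
  finally have "l * G.edges \<le> l * ((4 + 5 * ?T) * (k\<^sup>2 * 4 ^ nbits k N))" by simp
  then show ?thesis by (simp add: size_bound_def mult.assoc)
qed

lemma poly_bounded_clause_bound: "poly_bounded (clause_bound q)"
  unfolding clause_bound_def by (intro poly_bounded_intros)

lemma poly_bounded_size_bound: "poly_bounded (size_bound k l q)"
  unfolding size_bound_def by (intro poly_bounded_intros poly_bounded_clause_bound)

lemma sum_pow2_le: "2 ^ x + 2 ^ y \<le> (2::nat) ^ (x + y + 1)"
proof -
  have "(2::nat) ^ x \<le> 2 ^ (x + y)" "(2::nat) ^ y \<le> 2 ^ (x + y)" by (intro power_increasing; simp)+
  moreover have "(2::nat) ^ (x + y + 1) = 2 * 2 ^ (x + y)" by simp
  ultimately show ?thesis by linarith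
qed


text \<open>A block has at most one bit more than \<open>N / k\<close>, hence the factor
  \<open>2 ^ (k - 1)\<close>.\<close>

lemma pow_nbits_le:
  assumes "k \<ge> 1"
  shows "real (2 ^ (nbits k N * (k - 1))) \<le> 2 ^ (k - 1) * (2 powr ((real k - 1) / real k)) ^ N"
proof -
  have "real (N div k) * (real k - 1) \<le> real N / real k * (real k - 1)"
    using assms of_nat_div_le_of_nat[of N k, where 'a = real] by (intro mult_right_mono) auto
  then have "2 powr (real (N div k) * (real k - 1)) \<le> 2 powr (real N * ((real k - 1) / real k))"
    by (intro powr_mono) (simp_all add: field_simps)
  also have "\<dots> = (2 powr ((real k - 1) / real k)) ^ N"
    by (simp add: powr_realpow[symmetric] powr_powr mult.commute)
  also have "2 powr (real (N div k) * (real k - 1)) = 2 ^ (N div k * (k - 1))"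
    using assms by (simp add: powr_realpow[symmetric] of_nat_diff)
  finally have "2 ^ (k - 1) * 2 ^ (N div k * (k - 1)) \<le> 2 ^ (k - 1) * (2 powr ((real k - 1) / real k)) ^ N"
    by (intro mult_left_mono) auto
  moreover have "2 ^ (nbits k N * (k - 1)) = 2 ^ (k - 1) * (2::real) ^ (N div k * (k - 1))"
    unfolding nbits_def add_mult_distrib power_add mult_1 by (rule mult.commute)
  ultimately show ?thesis by simp
qed

text \<open>The exponent of \<open>G\<close> is raised from \<open>(k - 1) / 2\<close> to
  \<open>k\<close>, so that for polynomially bounded \<open>G\<close> the first factor is again a
  natural power and polynomially bounded.\<close>

lemma powr_size_le:
  assumes "1 \<le> G" "m \<le> G * 4 ^ b" "k \<ge> 1"
  shows "real m powr ((real k - 1) / 2) \<le> real (G ^ k * 2 ^ (b * (k - 1)))"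
proof -
  let ?e = "(real k - 1) / 2"
  have e: "0 \<le> ?e" "?e \<le> real k" using assms(3) by auto
  have "real m powr ?e \<le> real (G * 4 ^ b) powr ?e"
    using e assms(2) by (intro powr_mono2 of_nat_mono) auto
  also have "\<dots> = real G powr ?e * (real (4 ^ b)) powr ?e" by (simp add: powr_mult)
  also have "real (4 ^ b) = 2 powr (2 * real b)"
    by (simp add: four_power powr_realpow[symmetric] power2_eq_square powr_add[symmetric])
  also have "(2 powr (2 * real b)) powr ?e = 2 powr (real b * (real k - 1))" by (simp add: powr_powr)
  also have "\<dots> = real (2 ^ (b * (k - 1)))"
    using assms(3) by (simp add: powr_realpow[symmetric] of_nat_diff)
  also have "real G powr ?e \<le> real G powr real k" using assms(1) e by (intro powr_mono) auto
  also have "\<dots> = real (G ^ k)" using assms(1) by (simp add: powr_realpow)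
  finally show ?thesis by (simp add: mult_right_mono)
qed

text \<open>\<open>accepts\<close> stands for the decision rule: a flag for a decider, a threshold
  on the output for an approximation algorithm. \<open>post\<close> turns it into the answer in
  register 0 of the simulating machine, and \<open>w\<^sub>0\<close> makes room for the constants in
  \<open>post\<close>.\<close>

theorem sat_reduces_to_radius:
  fixes k l q c w\<^sub>0 :: nat and K g :: real
  assumes k: "k \<ge> 3" and l: "l \<ge> 1"
    and decides: "\<And>n es. \<lbrakk>graph_input n es; k + 1 \<le> n;
        k_radius (k + 1) {..<n} (edges_of es) \<le> enat (5 * l) \<or>
        enat (9 * l) \<le> k_radius (k + 1) {..<n} (edges_of es)\<rbrakk> \<Longrightarrow>
      runs_within (log_word_length c n) P (encode_graph n es) (K * real (length es) powr ((real k - 1) / 2))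
        (\<lambda>R. accepts R \<longleftrightarrow> k_radius (k + 1) {..<n} (edges_of es) \<le> enat (5 * l))"
    and straight: "\<forall>i\<in>set post. straight i"
    and post: "\<And>w R M R' M'. w\<^sub>0 \<le> w \<Longrightarrow> fold (exec_regs w) post (R, M) = (R', M') \<Longrightarrow>
        R' 0 \<noteq> 0 \<longleftrightarrow> accepts (\<lambda>r. R (2 * r))"
    and g: "2 powr ((real k - 1) / real k) < g"
  shows "qsat_solvable_in q (\<lambda>N. g ^ N)"
proof -
  let ?e = "(real k - 1) / 2"
  obtain s\<^sub>1 where s1: "\<And>N. size_bound k l q N < 2 ^ (s\<^sub>1 * (N + 1))"
    using poly_bounded_exp[OF poly_bounded_size_bound] by blast
  \<comment> \<open>Of the 4, one half pays for the factor \<open>4 ^ nbits k N\<close>, the other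
    for a factor 4 that absorbs three times the number of edges plus 3.\<close>
  define s where "s = s\<^sub>1 + 4"
  \<comment> \<open>\<open>C\<close> collects all constants that have to stay below
    \<open>B\<close>. The exponent \<open>q + 1\<close> accommodates the length of the formula,
    which is of order \<open>N ^ q\<close>.\<close>
  define C where "C = 12 + q + (q + 1) * (q + 1) * 2 ^ q + slots k ^ k + l + k + s + c"
  define B where "B N = (C * (N + 1)) ^ (q + 1)" for N
  have B_poly: "poly_bounded B" unfolding B_def by (intro poly_bounded_intros)
  obtain s\<^sub>2 where s2: "\<And>N. B N < 2 ^ (s\<^sub>2 * (N + 1))" using poly_bounded_exp[OF B_poly] by blast
  \<comment> \<open>The summands give room for \<open>B\<close>, for the simulated memory of
    \<open>2 ^ v\<close> cells, for the size of the graph and for \<open>post\<close>; the 2 covers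
    the sum \<open>B + 2 ^ v\<close> and strict inequalities.\<close>
  define d where "d = s\<^sub>2 + c * s + s + w\<^sub>0 + 2"
  define eL eW eC where "eL = lenE k l" and "eW = wordE k l s c" and "eC = with_params k l (cellE k l)"
  define Q where "Q = program C (q + 1) eL eW eC P post"
  define \<kappa> where "\<kappa> = nat \<lceil>\<bar>K\<bar>\<rceil>"
  define cst where "cst = length post + (q + 1) + 14"
  \<comment> \<open>The running time with the exponential factor
    \<open>2 ^ (nbits k N * (k - 1))\<close> taken out.\<close>
  define p where "p N = cost (B N) eL + cost (B N) eW + (2 * size_bound k l q N + 2) * (cost (B N) eC + 8) +
     2 * (\<kappa> * size_bound k l q N ^ k) + cst" for N
  have "poly_bounded p"
    unfolding p_def by (intro poly_bounded_intros poly_bounded_cost B_poly poly_bounded_size_bound)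
  then have "poly_bounded (\<lambda>N. 2 ^ (k - 1) * p N)" by (intro poly_bounded_intros)
  then obtain K' where K': "\<And>N. real (2 ^ (k - 1) * p N) * (2 powr ((real k - 1) / real k)) ^ N \<le> K' * g ^ N"
    using poly_times_exp_le[OF _ _ g] by fastforce
  show ?thesis
    unfolding qsat_solvable_in_def
  proof (intro exI allI impI)
    fix N F assume cnf: "is_qcnf q N F"
    interpret reduction k l N F using k l by unfold_locales auto
    let ?es = "G.edge_list" and ?n = "G.order" and ?m = "l * G.edges"
    define w where "w = d * (N + 1)"
    define v where "v = log_word_length c ?n"
    define ys where "ys = encode_graph ?n ?es"
    have B1: "C * (N + 1) \<le> B N"
      unfolding B_def using self_le_power[of "C * (N + 1)" "q + 1"] by (simp add: C_def)
    have B2: "C * (N + 1) ^ q \<le> B N"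
    proof -
      have "C ^ 1 * (N + 1) ^ q \<le> C ^ (q + 1) * (N + 1) ^ (q + 1)"
        by (intro mult_mono power_increasing) (auto simp: C_def)
      then show ?thesis by (simp only: B_def power_mult_distrib power_one_right)
    qed
    have B3: "C \<le> B N" using B1 by (metis le_trans le_add2 mult_le_mono2 mult.right_neutral)
    have len: "length (encode_cnf N F) \<le> B N"
    proof -
      have "2 * 1 \<le> 2 * (N + 1) ^ q" by (intro mult_left_mono) auto
      moreover have "clause_bound q N * (q + 1) = (q + 1) * (q + 1) * 2 ^ q * (N + 1) ^ q"
        by (simp only: clause_bound_def power_mult_distrib mult_ac)
      ultimately have "2 + clause_bound q N * (q + 1) \<le> 2 * (N + 1) ^ q + (q + 1) * (q + 1) * 2 ^ q * (N + 1) ^ q"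
        by linarith
      also have "\<dots> = (2 + (q + 1) * (q + 1) * 2 ^ q) * (N + 1) ^ q" by (simp only: add_mult_distrib)
      also have "\<dots> \<le> C * (N + 1) ^ q" unfolding C_def by (intro mult_right_mono) auto
      finally show ?thesis using length_encode_cnf[OF cnf] B2 by linarith
    qed
    have B_exp: "B N < 2 ^ (s\<^sub>2 * (N + 1))" by (rule s2)
    have w_ge: "2 ^ (s\<^sub>2 * (N + 1)) \<le> (2::nat) ^ w"
      unfolding w_def d_def by (intro power_increasing mult_right_mono) auto
    have Bw: "B N < 2 ^ w" using B_exp w_ge by linarith
    have m_le: "?m \<le> size_bound k l q N * 4 ^ nbits k N" using cnf by (rule size_le)
    have order_le: "?n \<le> ?m + 1" using G.graph_input_edge_list by (simp add: graph_input_def)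
    have m_exp: "3 * ?m + 3 < 2 ^ (s * (N + 1))"
    proof -
      have "nbits k N \<le> N + 1" by (simp add: nbits_def)
      then have "(4::nat) ^ nbits k N \<le> 4 ^ (N + 1)" by (intro power_increasing) auto
      also have "\<dots> = 2 ^ (2 * (N + 1))" by (simp add: power_mult)
      finally have "(size_bound k l q N + 1) * 4 ^ nbits k N \<le> 2 ^ (s\<^sub>1 * (N + 1)) * 2 ^ (2 * (N + 1))"
        using s1[of N] by (intro mult_mono) auto
      moreover have "?m + 1 \<le> (size_bound k l q N + 1) * 4 ^ nbits k N"
        using m_le one_le_power[of "4::nat" "nbits k N"] unfolding add_mult_distrib mult_1 by linarith
      ultimately have "?m + 1 \<le> 2 ^ (s\<^sub>1 * (N + 1)) * 2 ^ (2 * (N + 1))" by linarith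
      then have "4 * (?m + 1) \<le> 2 ^ (s\<^sub>1 * (N + 1)) * 2 ^ (2 * (N + 1)) * 2 ^ (2 * 1)" by simp
      also have "\<dots> \<le> 2 ^ (s\<^sub>1 * (N + 1)) * 2 ^ (2 * (N + 1)) * 2 ^ (2 * (N + 1))"
        by (intro mult_left_mono power_increasing) auto
      also have "\<dots> = 2 ^ (s * (N + 1))"
      proof -
        have "s * (N + 1) = s\<^sub>1 * (N + 1) + 2 * (N + 1) + 2 * (N + 1)" by (simp add: s_def algebra_simps)
        then show ?thesis by (simp only: power_add)
      qed
      finally have "4 * (?m + 1) \<le> 2 ^ (s * (N + 1))" .
      moreover have "4 * (x + 1) \<le> y \<Longrightarrow> 3 * x + 3 < y" for x y :: nat by presburger
      ultimately show ?thesis by blast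
    qed
    have sw: "2 ^ (s * (N + 1)) \<le> (2::nat) ^ w"
      unfolding w_def d_def by (intro power_increasing mult_right_mono) auto
    have big: "?n + 2 * ?m + 2 < 2 ^ w" using m_exp sw order_le by linarith
    define M where "M = mem (init_config (encode_cnf N F))"
    interpret reduction_eval k l N F w "B N" M
    proof unfold_locales
      show "length (encode_cnf N F) \<le> B N" "B N < 2 ^ w" by (fact len Bw)+
      show "10 < B N" "slots k ^ k < B N" "l < B N" "k + 2 < B N" using B3 by (simp_all add: C_def)
      show "?n + 2 * ?m + 2 < 2 ^ w" by (rule big)
    qed (simp add: M_def)
    have order_lt: "?n < 2 ^ (s * (N + 1))" using m_exp order_le by linarith
    have v_le: "v \<le> c * (s * (N + 1))"
    proof -
      have "\<not> s * (N + 1) < nat \<lceil>log 2 (real ?n + 1)\<rceil>" using order_lt unfolding less_ceiling_log by linarith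
      then show ?thesis unfolding v_def log_word_length_def not_less by (rule mult_le_mono2)
    qed
    have "B N + 2 ^ v \<le> 2 ^ (s\<^sub>2 * (N + 1)) + 2 ^ (c * (s * (N + 1)))"
      using B_exp power_increasing[OF v_le, of "2::nat"] by linarith
    also have "\<dots> \<le> 2 ^ (s\<^sub>2 * (N + 1) + c * (s * (N + 1)) + 1)" by (rule sum_pow2_le)
    also have "\<dots> \<le> 2 ^ w" unfolding w_def d_def by (intro power_increasing) (auto simp: algebra_simps)
    finally have Bv: "B N + 2 ^ v \<le> 2 ^ w" .
    have vw: "v < w" using v_le by (auto simp: w_def d_def algebra_simps)
    have "k + 1 \<le> ?n"
    proof -
      have "k * 1 \<le> elems k N" unfolding elems_def by (intro mult_left_mono) auto
      then show ?thesis using G.verts_le_order k unfolding G.verts_def G.hub0_def G.gate0_def G.mid0_def by linarith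
    qed
    moreover have sat: "satisfiable F \<longleftrightarrow> G.radius (k + 1) \<le> enat (5 * l)"
      "G.radius (k + 1) \<le> enat (5 * l) \<or> enat (9 * l) \<le> G.radius (k + 1)"
    proof -
      have "\<not> enat (9 * l) \<le> enat (5 * l)" using l by simp
      then show "satisfiable F \<longleftrightarrow> G.radius (k + 1) \<le> enat (5 * l)"
        using radius_satisfiable[OF cnf] radius_unsatisfiable by (meson order_trans)
      show "G.radius (k + 1) \<le> enat (5 * l) \<or> enat (9 * l) \<le> G.radius (k + 1)"
        using radius_satisfiable[OF cnf] radius_unsatisfiable by blast
    qed
    ultimately have "runs_within v P ys (K * real (length ?es) powr ?e)
        (\<lambda>R. accepts R \<longleftrightarrow> G.radius (k + 1) \<le> enat (5 * l))"
      unfolding v_def ys_def by (intro decides G.graph_input_edge_list) auto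
    then obtain t where t: "real t \<le> K * real ?m powr ?e" "halted P ((step v P ^^ t) (init_config ys))"
      "accepts (regs ((step v P ^^ t) (init_config ys))) \<longleftrightarrow> satisfiable F"
      and ys: "length ys \<le> 2 ^ v" "\<And>y. y \<in> set ys \<Longrightarrow> y < 2 ^ v"
      unfolding runs_within_def sat(1) by auto
    have len_ys: "length ys = 2 * ?m + 2" by (simp add: ys_def length_encode_graph)
    \<comment> \<open>The given algorithm may come with \<open>c = 0\<close>, but at least two input
      cells have to fit into its memory.\<close>
    then have "v > 0" using ys(1) by (cases v) auto
    have M0: "M 0 = N" by (rule M_0)
    let ?time = "cost (B N) eL + cost (B N) eW + length ys * (cost (B N) eC + 8) + 2 * t + (length post + (q + 1) + 14)"
    have "\<exists>R M\<^sub>1 R' M'. reach w Q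
        ?time (init_config (encode_cnf N F)) (cfg (length Q) R' M') \<and>
        (\<forall>r. R (2 * r) = regs ((step v P ^^ t) (init_config ys)) r) \<and>
        fold (exec_regs w) post (R, M\<^sub>1) = (R', M')"
      unfolding Q_def
    proof (rule program_run)
      show "B N = (C * (mem (init_config (encode_cnf N F)) 0 + 1)) ^ (q + 1)"
        using M0 by (simp add: B_def M_def)
      show "0 < B N" using B3 by (simp add: C_def)
      show "v \<le> w" using vw by simp
      show "wf_exp 0 eL" "wf_exp 0 eW" "wf_exp 1 eC" unfolding eL_def eW_def eC_def by (rule wf_exps)+
      show "eval w (B N) (mem (init_config (encode_cnf N F))) eL [] = length ys"
        unfolding eL_def len_ys M_def[symmetric] by (rule ev_lenE)
      show "eval w (B N) (mem (init_config (encode_cnf N F))) eW [] = 2 ^ v"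
        unfolding eW_def v_def M_def[symmetric]
      proof (rule ev_wordE)
        show "1 \<le> s" by (simp add: s_def)
        have "s * (N + 1) < C * (N + 1)" unfolding C_def by (intro mult_strict_right_mono) auto
        then show "s * (N + 1) < B N" using B1 by linarith
        show "s * (N + 1) < w" "c * (s * (N + 1)) < w" by (auto simp: w_def d_def algebra_simps)
        show "c < B N" using B3 by (simp add: C_def)
        show "?n < 2 ^ (s * (N + 1))" by (rule order_lt)
      qed
      show "eval w (B N) (mem (init_config (encode_cnf N F))) eC [j] = ys ! j" if "j < length ys" for j
        using that unfolding eC_def ys_def M_def[symmetric] by (intro ev_cell) (simp add: length_encode_graph)
    qed (use len Bv ys t(2) straight \<open>v > 0\<close> in auto)
    then obtain R M\<^sub>1 R' M' where run: "reach w Q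
        ?time (init_config (encode_cnf N F)) (cfg (length Q) R' M')"
      "\<forall>r. R (2 * r) = regs ((step v P ^^ t) (init_config ys)) r"
      "fold (exec_regs w) post (R, M\<^sub>1) = (R', M')" by blast
    have "w\<^sub>0 \<le> w" by (simp add: w_def d_def)
    then have result: "R' 0 \<noteq> 0 \<longleftrightarrow> satisfiable F" using post[OF _ run(3)] run(2) t(3) by simp
    have time: "real ?time \<le> K' * g ^ N"
    proof -
      let ?G = "size_bound k l q N" and ?h = "2 ^ (nbits k N * (k - 1)) :: nat"
      have G1: "1 \<le> ?G" using k l by (simp add: size_bound_def)
      \<comment> \<open>Here \<open>k \<ge> 3\<close> enters: writing the graph must not cost more
        than the budget for the simulation.\<close>
      have "(4::nat) ^ nbits k N = 2 ^ (nbits k N * 2)" by (simp only: four_power power_mult)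
      also have "\<dots> \<le> ?h" using k by (intro power_increasing mult_left_mono) auto
      finally have "?G * 4 ^ nbits k N \<le> ?G * ?h" by (rule mult_left_mono) simp
      then have "length ys \<le> 2 * (?G * ?h) + 2 * 1" using m_le len_ys by linarith
      also have "\<dots> \<le> 2 * (?G * ?h) + 2 * ?h" by (intro add_mono mult_left_mono) auto
      also have "\<dots> = (2 * ?G + 2) * ?h" by (simp add: algebra_simps)
      finally have "length ys * (cost (B N) eC + 8) \<le> (2 * ?G + 2) * ?h * (cost (B N) eC + 8)"
        by (rule mult_right_mono) simp
      moreover have "t \<le> \<kappa> * (?G ^ k * ?h)"
      proof -
        have "real t \<le> K * real ?m powr ?e" by (rule t(1))
        also have "\<dots> \<le> real \<kappa> * real (?G ^ k * ?h)"
        proof (rule mult_mono)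
          show "K \<le> real \<kappa>" unfolding \<kappa>_def by linarith
          show "real ?m powr ?e \<le> real (?G ^ k * ?h)" using G1 m_le k by (intro powr_size_le) auto
        qed auto
        finally show ?thesis by (simp only: of_nat_mult[symmetric] of_nat_le_iff)
      qed
      moreover have "x \<le> x * ?h" for x by simp
      ultimately have "?time \<le> cost (B N) eL * ?h + cost (B N) eW * ?h + (2 * ?G + 2) * ?h * (cost (B N) eC + 8) +
          2 * (\<kappa> * (?G ^ k * ?h)) + cst * ?h"
        unfolding cst_def by (intro add_mono mult_left_mono) auto
      also have "\<dots> = p N * ?h" by (simp add: p_def algebra_simps)
      finally have "real ?time \<le> real (p N * ?h)" by (rule of_nat_mono)
      also have "\<dots> \<le> real (p N) * (2 ^ (k - 1) * (2 powr ((real k - 1) / real k)) ^ N)"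
        using pow_nbits_le[of k N] k by (simp only: of_nat_mult) (intro mult_left_mono, auto)
      also have "\<dots> = real (2 ^ (k - 1) * p N) * (2 powr ((real k - 1) / real k)) ^ N" by simp
      also have "\<dots> \<le> K' * g ^ N" by (rule K')
      finally show ?thesis .
    qed
    show "runs_within (d * (N + 1)) Q (encode_cnf N F) (K' * g ^ N) (\<lambda>R. R 0 \<noteq> 0 \<longleftrightarrow> satisfiable F)"
    proof -
      have "length (encode_cnf N F) \<le> 2 ^ w" using len Bw by linarith
      moreover have "x < 2 ^ w" if "x \<in> set (encode_cnf N F)" for x
      proof -
        have "q + 2 * N + 1 \<le> C * (N + 1)" by (simp add: C_def algebra_simps)
        then have "x < B N \<or> x \<le> B N" using encode_cnf_entries[OF cnf that] length_less_B B1 by auto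
        then show ?thesis using Bw by linarith
      qed
      moreover obtain u where u: "(step w Q ^^ u) (init_config (encode_cnf N F)) = cfg (length Q) R' M'"
        "u \<le> ?time"
        using run(1) unfolding reach_def by blast
      moreover have "real u \<le> K' * g ^ N" using time of_nat_mono[OF u(2), where 'a = real] by linarith
      ultimately show ?thesis
        unfolding runs_within_def w_def[symmetric] using result
        by (intro conjI ballI exI[of _ u] exI[of _ "cfg (length Q) R' M'"]) (auto simp: halted_def)
    qed
  qed
qed

section \<open>Lower bounds for the \<open>k\<close>-radius\<close>

lemma runs_within_mono:
  assumes "runs_within w P xs T ok" "T \<le> T'" "\<And>R. ok R \<Longrightarrow> ok' R"
  shows "runs_within w P xs T' ok'"
  using assms unfolding runs_within_def by (meson order_trans)

theorem no_fast_decider: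
  fixes k l c w\<^sub>0 :: nat and K e :: real
  assumes SETH "k \<ge> 3" "l \<ge> 1" "e \<le> (real k - 1) / 2"
    and straight: "\<forall>i\<in>set post. straight i"
    and post: "\<And>w R M R' M'. w\<^sub>0 \<le> w \<Longrightarrow> fold (exec_regs w) post (R, M) = (R', M') \<Longrightarrow>
        R' 0 \<noteq> 0 \<longleftrightarrow> accepts (\<lambda>r. R (2 * r))"
    and decides: "\<And>n es. \<lbrakk>graph_input n es; k + 1 \<le> n;
        k_radius (k + 1) {..<n} (edges_of es) \<le> enat (5 * l) \<or>
        enat (9 * l) \<le> k_radius (k + 1) {..<n} (edges_of es)\<rbrakk> \<Longrightarrow>
      runs_within (log_word_length c n) P (encode_graph n es) (K * real (length es) powr e)
        (\<lambda>R. accepts R \<longleftrightarrow> k_radius (k + 1) {..<n} (edges_of es) \<le> enat (5 * l))"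
  shows False
proof -
  \<comment> \<open>The base that is reached up to polynomial factors. The midpoint between it and 2
    leaves room for these factors.\<close>
  define s where "s = 2 powr ((real k - 1) / real k)"
  have "s < 2 powr 1" unfolding s_def using assms(2) by (intro powr_less_mono) auto
  then have s: "s < (2 + s) / 2" "2 - (2 - (2 + s) / 2) = (2 + s) / 2" "2 - (2 + s) / 2 > 0" by (auto simp: field_simps)
  have "\<exists>q\<ge>3. \<not> qsat_solvable_in q (\<lambda>N. (2 - (2 - (2 + s) / 2)) ^ N)"
    using \<open>SETH\<close> s(3) unfolding SETH_def by blast
  then obtain q where q: "\<not> qsat_solvable_in q (\<lambda>N. ((2 + s) / 2) ^ N)" unfolding s(2) by blast
  have "qsat_solvable_in q (\<lambda>N. ((2 + s) / 2) ^ N)"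
  proof (rule sat_reduces_to_radius[where c = c and P = P and K = "\<bar>K\<bar>" and accepts = accepts and w\<^sub>0 = w\<^sub>0 and post = post])
    fix n es assume *: "graph_input n es" "k + 1 \<le> n"
      "k_radius (k + 1) {..<n} (edges_of es) \<le> enat (5 * l) \<or>
        enat (9 * l) \<le> k_radius (k + 1) {..<n} (edges_of es)"
    \<comment> \<open>With at least one edge, a larger exponent gives a larger power, even if
      \<open>e\<close> is negative.\<close>
    have "1 \<le> length es" using *(1,2) assms(2) by (simp add: graph_input_def)
    then have "real (length es) powr e \<le> real (length es) powr ((real k - 1) / 2)"
      using assms(4) by (intro powr_mono) auto
    then have "K * real (length es) powr e \<le> \<bar>K\<bar> * real (length es) powr ((real k - 1) / 2)"
      by (intro mult_mono) auto
    with decides[OF *] show "runs_within (log_word_length c n) P (encode_graph n es)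
        (\<bar>K\<bar> * real (length es) powr ((real k - 1) / 2))
        (\<lambda>R. accepts R \<longleftrightarrow> k_radius (k + 1) {..<n} (edges_of es) \<le> enat (5 * l))"
      by (rule runs_within_mono)
  qed (use assms(2,3) straight post s in \<open>auto simp: s_def\<close>)
  with q show False by blast
qed

text \<open>The quotient of words decides the comparison of the fraction with \<open>b\<close> without risking an overflow.\<close>

definition below_threshold :: "nat \<Rightarrow> instr list" where
  "below_threshold b = [Alu OpDiv rA 0 2, Const rZ b, Alu OpLess rA rA rZ, Const rZ 0,
     Alu OpLess rZ rZ 2, Alu OpAnd 0 rA rZ]"

lemma below_threshold_correct:
  assumes "b \<le> w" "fold (exec_regs w) (below_threshold b) (R, M) = (R', M')"
  shows "R' 0 \<noteq> 0 \<longleftrightarrow> R 2 \<noteq> 0 \<and> R 0 div R 2 < b"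
proof -
  have "b < 2 ^ w" using assms(1) less_exp[of w] by linarith
  then show ?thesis using assms(2) by (auto simp: below_threshold_def split: if_splits)
qed

lemma output_value_less:
  "output_value R < ereal (real b) \<longleftrightarrow> R 1 \<noteq> 0 \<and> R 0 div R 1 < b"
proof -
  have "real (R 0) / real (R 1) < real b \<longleftrightarrow> R 0 div R 1 < b" if "R 1 \<noteq> 0"
  proof -
    have "real (R 0) / real (R 1) < real b \<longleftrightarrow> real (R 0) < real (b * R 1)"
      using that by (simp add: divide_less_eq)
    also have "\<dots> \<longleftrightarrow> R 0 div R 1 < b" using that by (simp add: div_less_iff_less_mult del: of_nat_mult)
    finally show ?thesis .
  qed
  then show ?thesis by (simp add: output_value_def)
qed

text \<open>At radius \<open>5 * l\<close> the output is at most
  \<open>9 * l - 5 * \<epsilon> * l + \<beta>\<close>, so a sufficiently large \<open>l\<close>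
  absorbs the additive error. \<open>\<epsilon> < 1\<close> keeps the factor
  \<open>9 / 5 - \<epsilon>\<close> positive and the bound monotone in the radius.\<close>

lemma approximation_threshold:
  fixes \<epsilon> \<beta> :: real
  assumes "is_approximation (9 / 5 - \<epsilon>) \<beta> r x" "0 < \<epsilon>" "\<epsilon> < 1" "\<beta> < 5 * \<epsilon> * real l"
    and "r \<le> enat (5 * l) \<or> enat (9 * l) \<le> r"
  shows "x < ereal (real (9 * l)) \<longleftrightarrow> r \<le> enat (5 * l)"
proof (cases "r \<le> enat (5 * l)")
  case True
  then obtain j where j: "r = enat j" "j \<le> 5 * l" by (cases r) auto
  have "x \<le> ereal ((9 / 5 - \<epsilon>) * real j + \<beta>)" using assms(1) j(1) by (simp add: is_approximation_def)
  also have "(9 / 5 - \<epsilon>) * real j + \<beta> \<le> (9 / 5 - \<epsilon>) * real (5 * l) + \<beta>"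
    using assms(3) j(2) by (intro add_right_mono mult_left_mono of_nat_mono) auto
  also have "\<dots> < real (9 * l)" using assms(4) by (simp add: algebra_simps)
  finally show ?thesis using True by simp
next
  case False
  then have "enat (9 * l) \<le> r" using assms(5) by blast
  then have "ereal_of_enat (enat (9 * l)) \<le> ereal_of_enat r" by (simp only: ereal_of_enat_le_iff)
  also have "\<dots> \<le> x" using assms(1) by (simp add: is_approximation_def)
  finally show ?thesis using False by (simp add: not_less)
qed

text \<open>For many edges the time bound is below 1, so the program makes no step and all registers
  are still 0, which is read as the output \<open>\<infinity>\<close>. Stars have radius at most 1
  and arbitrarily many edges, so this output is wrong for them.\<close>

lemma no_sublinear_approximation:
  fixes \<alpha> \<beta> \<delta> K :: real
  assumes k: "k \<ge> 1" and \<delta>: "\<delta> > 0"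
    and approx: "\<And>n es. graph_input n es \<Longrightarrow> k \<le> n \<Longrightarrow>
      runs_within (log_word_length c n) P (encode_graph n es) (K * real (length es) powr - \<delta>)
        (\<lambda>R. is_approximation \<alpha> \<beta> (k_radius k {..<n} (edges_of es)) (output_value R))"
  shows False
proof -
  \<comment> \<open>The first summand makes \<open>K * m powr - \<delta>\<close> less than 1, the
    second provides at least \<open>k\<close> vertices.\<close>
  define m where "m = nat \<lceil>(\<bar>K\<bar> + 2) powr (1 / \<delta>)\<rceil> + k"
  define es where "es = map (\<lambda>i. (0::nat, Suc i)) [0..<m]"
  let ?V = "{..<m + 1}" and ?E = "edges_of es"
  have es: "graph_input (m + 1) es" "length es = m"
    by (auto simp: graph_input_def es_def distinct_map comp_def inj_on_def doubleton_eq_iff)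
  have "near ?V ?E {..<k} 1 v" if "v \<in> ?V" for v
  proof (cases v)
    case 0
    then show ?thesis using k by (auto intro: near.center)
  next
    case (Suc i)
    have "near ?V ?E {..<k} 0 0" using k by (auto intro: near.center)
    moreover have "{0, Suc i} \<in> ?E" using that Suc by (auto simp: edges_of_def es_def)
    ultimately show ?thesis using near.step[of ?V ?E "{..<k}" 0 0 v] that Suc by simp
  qed
  then have "k_radius k ?V ?E \<le> enat 1"
    by (intro k_radius_le_near[of "{..<k}"]) (auto simp: m_def)
  then obtain j where j: "k_radius k ?V ?E = enat j" by (cases "k_radius k ?V ?E") auto
  have "(\<bar>K\<bar> + 2) powr (1 / \<delta>) \<le> real m" unfolding m_def by linarith
  then have "((\<bar>K\<bar> + 2) powr (1 / \<delta>)) powr \<delta> \<le> real m powr \<delta>" using \<delta> by (intro powr_mono2) auto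
  then have m: "\<bar>K\<bar> + 2 \<le> real m powr \<delta>" using \<delta> by (simp add: powr_powr)
  have less: "K * real m powr - \<delta> < 1"
  proof -
    have "K * real m powr - \<delta> = K / real m powr \<delta>" by (simp add: powr_minus divide_inverse)
    also have "\<dots> < 1" using m by (subst divide_less_eq_1_pos) linarith+
    finally show ?thesis .
  qed
  have "runs_within (log_word_length c (m + 1)) P (encode_graph (m + 1) es) (K * real m powr - \<delta>)
      (\<lambda>R. is_approximation \<alpha> \<beta> (enat j) (output_value R))"
    using approx[OF es(1)] es(2) j by (simp add: m_def)
  then obtain t where t: "real t \<le> K * real m powr - \<delta>" "is_approximation \<alpha> \<beta> (enat j) (output_value
      (regs ((step (log_word_length c (m + 1)) P ^^ t) (init_config (encode_graph (m + 1) es)))))"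
    unfolding runs_within_def by blast
  then have "t = 0" using less by linarith
  with t(2) have "is_approximation \<alpha> \<beta> (enat j) (output_value (\<lambda>_. 0))" by (simp add: init_config_def)
  then show False by (simp add: is_approximation_def output_value_def)
qed

theorem mainTheorem4:
  fixes k l :: nat
  assumes "k \<ge> 2" and "l \<ge> 1" and SETH
  shows "(\<forall>\<delta>::real. \<delta> > 0 \<longrightarrow>
           \<not> k_radius_distinguishable_in (2 * k + 2) (5 * l) (9 * l)
               (\<lambda>m. real m powr (real k - \<delta>))) \<and>
         (\<forall>\<epsilon> \<beta> :: real. 0 < \<epsilon> \<and> \<epsilon> < 1 \<and> \<beta> \<ge> 0 \<longrightarrow>
           (\<forall>\<delta>::real. \<delta> > 0 \<longrightarrow>
             \<not> k_radius_approximable_in k (9 / 5 - \<epsilon>) \<beta>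
                 (\<lambda>m. real m powr (real (k div 2) - 1 - \<delta>))))"
proof (intro conjI allI impI notI)
  fix \<delta> :: real
  assume "\<delta> > 0" "k_radius_distinguishable_in (2 * k + 2) (5 * l) (9 * l) (\<lambda>m. real m powr (real k - \<delta>))"
  then obtain P c K where P: "\<And>n es. graph_input n es \<and> 2 * k + 2 \<le> n \<and>
      (k_radius (2 * k + 2) {..<n} (edges_of es) \<le> enat (5 * l) \<or>
       k_radius (2 * k + 2) {..<n} (edges_of es) \<ge> enat (9 * l)) \<Longrightarrow>
      runs_within (log_word_length c n) P (encode_graph n es) (K * real (length es) powr (real k - \<delta>))
        (\<lambda>R. R 0 \<noteq> 0 \<longleftrightarrow> k_radius (2 * k + 2) {..<n} (edges_of es) \<le> enat (5 * l))"
    unfolding k_radius_distinguishable_in_def by blast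
  have k: "2 * k + 2 = (2 * k + 1) + 1" by simp
  show False
    by (rule no_fast_decider[of "2 * k + 1" l "real k - \<delta>" "[]" 0 "\<lambda>R. R 0 \<noteq> 0" c P K])
      (use assms \<open>\<delta> > 0\<close> P[unfolded k] in auto)
next
  fix \<epsilon> \<beta> \<delta> :: real
  assume \<epsilon>: "0 < \<epsilon> \<and> \<epsilon> < 1 \<and> \<beta> \<ge> 0" and \<delta>: "\<delta> > 0"
    and "k_radius_approximable_in k (9 / 5 - \<epsilon>) \<beta> (\<lambda>m. real m powr (real (k div 2) - 1 - \<delta>))"
  then obtain P c K where P: "\<And>n es. graph_input n es \<Longrightarrow> k \<le> n \<Longrightarrow>
      runs_within (log_word_length c n) P (encode_graph n es)
        (K * real (length es) powr (real (k div 2) - 1 - \<delta>))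
        (\<lambda>R. is_approximation (9 / 5 - \<epsilon>) \<beta> (k_radius k {..<n} (edges_of es)) (output_value R))"
    unfolding k_radius_approximable_in_def by blast
  show False
  \<comment> \<open>For smaller \<open>k\<close> the reduction would have only
    \<open>k - 1 < 3\<close> blocks, but then the claimed exponent is just
    \<open>- \<delta>\<close>.\<close>
  proof (cases "k \<ge> 4")
    case True
    \<comment> \<open>The given \<open>l\<close> may be too small for \<open>\<beta>\<close>; the
      graph of the reduction is built with \<open>l'\<close> instead.\<close>
    define l' where "l' = nat \<lceil>\<beta> / (5 * \<epsilon>)\<rceil> + 1"
    have "\<beta> / (5 * \<epsilon>) < real l'" unfolding l'_def by linarith
    then have l': "\<beta> < 5 * \<epsilon> * real l'" using \<epsilon> by (simp add: field_simps)
    define accepts where "accepts R \<longleftrightarrow> R 1 \<noteq> 0 \<and> R 0 div R 1 < 9 * l'" for R :: "nat \<Rightarrow> nat"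
    have k: "k - 1 + 1 = k" using True by simp
    show False
    proof (rule no_fast_decider[of "k - 1" l' "real (k div 2) - 1 - \<delta>" "below_threshold (9 * l')" "9 * l'" accepts c P K])
      \<comment> \<open>One of the \<open>k\<close> centers is for the root; the remaining
        \<open>k - 1\<close> blocks allow the exponent \<open>(k - 2) / 2\<close>, and rounding
        \<open>k / 2\<close> down only lowers the claim.\<close>
      show "real (k div 2) - 1 - \<delta> \<le> (real (k - 1) - 1) / 2"
        using \<delta> True of_nat_div_le_of_nat[of k 2, where 'a = real] by (simp add: of_nat_diff field_simps)
      show "\<forall>i\<in>set (below_threshold (9 * l')). straight i" by (simp add: below_threshold_def)
      show "R' 0 \<noteq> 0 \<longleftrightarrow> accepts (\<lambda>r. R (2 * r))"
        if "9 * l' \<le> w" "fold (exec_regs w) (below_threshold (9 * l')) (R, M) = (R', M')" for w R M R' M'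
        using below_threshold_correct[OF that] by (simp add: accepts_def)
      show "runs_within (log_word_length c n) P (encode_graph n es)
          (K * real (length es) powr (real (k div 2) - 1 - \<delta>))
          (\<lambda>R. accepts R \<longleftrightarrow> k_radius (k - 1 + 1) {..<n} (edges_of es) \<le> enat (5 * l'))"
        if "graph_input n es" "k - 1 + 1 \<le> n"
          "k_radius (k - 1 + 1) {..<n} (edges_of es) \<le> enat (5 * l') \<or>
           enat (9 * l') \<le> k_radius (k - 1 + 1) {..<n} (edges_of es)" for n es
      proof (rule runs_within_mono[OF P[OF that(1)]])
        fix R assume "is_approximation (9 / 5 - \<epsilon>) \<beta> (k_radius k {..<n} (edges_of es)) (output_value R)"
        from approximation_threshold[OF this _ _ l'] \<epsilon> that(3)
        show "accepts R \<longleftrightarrow> k_radius (k - 1 + 1) {..<n} (edges_of es) \<le> enat (5 * l')"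
          unfolding k accepts_def output_value_less by blast
      qed (use that k in auto)
    qed (use True assms in \<open>auto simp: l'_def\<close>)
  next
    case False
    then have "k div 2 = 1" using assms(1) by simp
    then show False using no_sublinear_approximation[OF _ \<delta>, of k c P K "9 / 5 - \<epsilon>" \<beta>] P assms(1) by simp
  qed
qed

end
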